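(* Let $\hat\Gamma=\arg\max_{\Gamma\in\mathcal{F}_s}\mathcal{D}_{\mathcal{U}_s}(\Gamma,\{X_i\}_{i=1}^n)$ and $\hat\Sigma=\hat\Gamma/\beta$. Assume that $\epsilon<1/5$. Then, there exist absolute constants $C,C_1>0$, such that for any $\delta\in(0,1/2)$ satisfying $C_1\frac{s\log\frac{ep}{s}+\log(1/\delta)}{n}<1$, we have $$\|\hat\Sigma-\Sigma\|_{\rm op}^2\le C\left(\left(\frac{s\log\frac{ep}{s}}{n}\vee\epsilon^2\right)+\frac{\log(1/\delta)}{n}\right),$$ with $\mathbb{P}_{(\epsilon,\Sigma,Q)}$-probability at least $1-2\delta$ uniformly over all probability distributions $Q$ on $\mathbb{R}^p$ and all $\Sigma\in\mathcal{F}_s(M)$.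
   Context: Contamination model: for $\epsilon\in[0,1]$, a covariance matrix $\Sigma\in\mathbb{R}^{p\times p}$ (throughout assumed nonzero) and a probability distribution $Q$ on $\mathbb{R}^p$, $\mathbb{P}_{(\epsilon,\Sigma,Q)}=(1-\epsilon)N(0,\Sigma)+\epsilon Q$; $X_1,\dots,X_n$ are i.i.d. from it, and the same symbol denotes their joint law. Classes: for $S\subset[p]=\{1,\dots,p\}$, $\mathcal{G}(S)=\{G=(g_{ij})\in\mathbb{R}^{p\times p}:g_{ij}=0\text{ if }i\notin S\text{ or }j\notin S\}$; $\mathcal{G}(s)=\bigcup_{S\subset[p]:|S|\le s}\mathcal{G}(S)$; $\mathcal{F}_s=\{\Sigma\succeq0:\Sigma-\mathrm{diag}(\Sigma)\in\mathcal{G}(s)\}$, where $\mathrm{diag}(\Sigma)$ is the diagonal matrix with the diagonal entries of $\Sigma$; $\mathcal{F}(M)=\{\Sigma=\Sigma^T\in\mathbb{R}^{p\times p}:\Sigma\succeq0,\ s_{\max}(\Sigma)\le M\}$, where $s_{\max}$ is the largest singular value and $M>0$ is an absolute constant that does not scale with $p$ or $n$; $\mathcal{F}_s(M)=\mathcal{F}_s\cap\mathcal{F}(M)$. Directions: with $S^{p-1}$ the Euclidean unit sphere of $\mathbb{R}^p$, $\mathcal{V}_S=\{u=(u_i)\in S^{p-1}:u_i=0\text{ if }i\notin S\}$ and $\mathcal{U}_s=\bigcup_{S\subset[p]:|S|=2s}\mathcal{V}_S$. Empirical matrix depth relative to $\mathcal{U}\subset S^{p-1}$: $$\mathcal{D}_{\mathcal{U}}(\Gamma,\{X_i\}_{i=1}^n)=\min_{u\in\mathcal{U}}\min\left\{\frac1n\sum_{i=1}^n\mathbb{I}\{|u^TX_i|^2\le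 u^T\Gamma u\},\ \frac1n\sum_{i=1}^n\mathbb{I}\{|u^TX_i|^2\ge u^T\Gamma u\}\right\}.$$ The constant $\beta$ is defined by $\Phi(\sqrt\beta)=3/4$ with $\Phi$ the standard normal cumulative distribution function. $\|\cdot\|_{\rm op}$ is the operator norm; $a\vee b=\max(a,b)$. *)

theory Defs
  imports "HOL-Probability.Probability" "Jordan_Normal_Form.Char_Poly"
begin

unbundle no inner_syntax
no_notation vec_nth (infixl \<open>$\<close> 90)

text \<open>
  The dimension \<open>p\<close> and the sample size \<open>n\<close> are natural-number variables, since the constants
  of the theorem must not depend on them.  Coordinates are numbered \<open>0, ..., p - 1\<close>, so the index
  set \<open>[p]\<close> is \<open>{..<p}\<close>.  Deterministic vectors and matrices are those of \<^theory>\<open>Jordan_Normal_Form.Matrix\<close>;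
  since these types carry no measurable structure, the sample space \<open>R^p\<close> is the product
  measurable space over \<open>{..<p}\<close>, and a point \<open>x\<close> of it is read as the vector \<open>vec p x\<close>.
\<close>

definition l2_norm :: "real vec \<Rightarrow> real" where
  "l2_norm v = sqrt (v \<bullet> v)"

definition unit_sphere :: "nat \<Rightarrow> real vec set" where
  "unit_sphere p = {u \<in> carrier_vec p. l2_norm u = 1}"

definition op_norm :: "nat \<Rightarrow> real mat \<Rightarrow> real" where
  "op_norm p A = (SUP u \<in> unit_sphere p. l2_norm (A *\<^sub>v u))"

definition s_max :: "real mat \<Rightarrow> real" where
  "s_max A = Max {\<sigma>. 0 \<le> \<sigma> \<and> eigenvalue (transpose_mat A * A) (\<sigma>\<^sup>2)}"

definition psd :: "nat \<Rightarrow> real mat \<Rightarrow> bool" where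
  "psd p A \<longleftrightarrow> A \<in> carrier_mat p p \<and> transpose_mat A = A \<and>
     (\<forall>v \<in> carrier_vec p. 0 \<le> v \<bullet> (A *\<^sub>v v))"

definition G_supp :: "nat \<Rightarrow> nat set \<Rightarrow> real mat set" where
  "G_supp p S = {G \<in> carrier_mat p p. \<forall>i<p. \<forall>j<p. i \<notin> S \<or> j \<notin> S \<longrightarrow> G $$ (i, j) = 0}"

definition G_sparse :: "nat \<Rightarrow> nat \<Rightarrow> real mat set" where
  "G_sparse p s = (\<Union>S \<in> {S. S \<subseteq> {..<p} \<and> card S \<le> s}. G_supp p S)"

definition F_sparse :: "nat \<Rightarrow> nat \<Rightarrow> real mat set" where
  "F_sparse p s = {\<Sigma>. psd p \<Sigma> \<and> \<Sigma> - mat_diag p (\<lambda>i. \<Sigma> $$ (i, i)) \<in> G_sparse p s}"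

definition F_bounded :: "nat \<Rightarrow> real \<Rightarrow> real mat set" where
  "F_bounded p M = {\<Sigma>. psd p \<Sigma> \<and> s_max \<Sigma> \<le> M}"

definition F_sparse_bounded :: "nat \<Rightarrow> nat \<Rightarrow> real \<Rightarrow> real mat set" where
  "F_sparse_bounded p s M = F_sparse p s \<inter> F_bounded p M"

definition V_supp :: "nat \<Rightarrow> nat set \<Rightarrow> real vec set" where
  "V_supp p S = {u \<in> unit_sphere p. \<forall>i<p. i \<notin> S \<longrightarrow> u $ i = 0}"

definition U_sparse :: "nat \<Rightarrow> nat \<Rightarrow> real vec set" where
  "U_sparse p s = (\<Union>S \<in> {S. S \<subseteq> {..<p} \<and> card S = 2 * s}. V_supp p S)"

text \<open>
  For nonempty \<open>U\<close> the infimum below is a minimum, because the depth in a single direction takes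
  values in \<open>{0, 1/n, ..., 1}\<close>.  The \<open>i\<close>-th observation is \<open>X i\<close>.
\<close>

definition matrix_depth ::
    "nat \<Rightarrow> nat \<Rightarrow> real vec set \<Rightarrow> real mat \<Rightarrow> (nat \<Rightarrow> nat \<Rightarrow> real) \<Rightarrow> real" where
  "matrix_depth p n U \<Gamma> X = (INF u \<in> U.
     min ((\<Sum>i<n. of_bool (\<bar>u \<bullet> vec p (X i)\<bar>\<^sup>2 \<le> u \<bullet> (\<Gamma> *\<^sub>v u))) / real n)
         ((\<Sum>i<n. of_bool (\<bar>u \<bullet> vec p (X i)\<bar>\<^sup>2 \<ge> u \<bullet> (\<Gamma> *\<^sub>v u))) / real n))"

definition depth_beta :: real where
  "depth_beta = (THE b. 0 \<le> b \<and> cdf std_normal_distribution (sqrt b) = 3 / 4)"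

definition Rp :: "nat \<Rightarrow> (nat \<Rightarrow> real) measure" where
  "Rp p = (\<Pi>\<^sub>M i \<in> {..<p}. borel)"

text \<open>
  \<open>N(0, \<Sigma>)\<close> is the law of \<open>A Z\<close>, where \<open>Z\<close> has independent standard normal coordinates and
  \<open>A A\<^sup>T = \<Sigma>\<close>.  A square factor \<open>A\<close> exists for every positive semidefinite \<open>\<Sigma>\<close> (which may be
  singular), and the law does not depend on the factor chosen.
\<close>

definition mvn :: "nat \<Rightarrow> real mat \<Rightarrow> (nat \<Rightarrow> real) measure" where
  "mvn p \<Sigma> =
    (let A = (SOME A. A \<in> carrier_mat p p \<and> A * transpose_mat A = \<Sigma>) in
     distr (\<Pi>\<^sub>M i \<in> {..<p}. std_normal_distribution) (Rp p)
       (\<lambda>z. \<lambda>i \<in> {..<p}. (A *\<^sub>v vec p z) $ i))"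

definition contaminated ::
    "nat \<Rightarrow> real \<Rightarrow> real mat \<Rightarrow> (nat \<Rightarrow> real) measure \<Rightarrow> (nat \<Rightarrow> real) measure" where
  "contaminated p \<epsilon> \<Sigma> Q = measure_of (space (Rp p)) (sets (Rp p))
     (\<lambda>B. ennreal (1 - \<epsilon>) * emeasure (mvn p \<Sigma>) B + ennreal \<epsilon> * emeasure Q B)"

definition sample_law ::
    "nat \<Rightarrow> nat \<Rightarrow> real \<Rightarrow> real mat \<Rightarrow> (nat \<Rightarrow> real) measure \<Rightarrow> (nat \<Rightarrow> nat \<Rightarrow> real) measure" where
  "sample_law p n \<epsilon> \<Sigma> Q = (\<Pi>\<^sub>M i \<in> {..<n}. contaminated p \<epsilon> \<Sigma> Q)"

text \<open>
  \<open>E\<close> has probability at least \<open>q\<close>.  An arbitrary choice of maximiser need not be measurable, so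
  \<open>E\<close> is only required to contain a measurable set of probability at least \<open>q\<close>; for measurable
  \<open>E\<close> this is the usual meaning.
\<close>

definition prob_at_least :: "'a measure \<Rightarrow> real \<Rightarrow> 'a set \<Rightarrow> bool" where
  "prob_at_least P q E \<longleftrightarrow> (\<exists>B \<in> sets P. B \<subseteq> E \<and> measure P B \<ge> q)"

end

theory Submission
  imports Defs
begin

text \<open>
  Why the theorem holds.  Fix a direction \<open>u\<close> and put \<open>\<sigma>\<^sup>2 = u\<^sup>T \<Sigma> u\<close>.  A clean observation satisfies
  \<open>\<bar>u\<^sup>T X\<bar> \<le> sqrt \<beta> \<sigma>\<close> with probability \<open>1/2\<close>, so the sample depth of \<open>\<beta> \<Sigma>\<close> is at least
  \<open>(1 - \<epsilon>) / 2\<close> up to the sampling error \<open>\<kappa>\<close>, simultaneously in all sparse directions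
  (\<open>depth_of_scaled_truth\<close>).  The matrix \<open>\<beta> \<Sigma>\<close> competes in the maximisation, hence the maximiser
  \<open>\<Gamma>\<close> is as deep.  The contamination can move each of the two empirical frequencies by at most
  \<open>\<epsilon>\<close>, so the Gaussian probability of \<open>\<bar>u\<^sup>T X\<bar>\<^sup>2 \<le> u\<^sup>T \<Gamma> u\<close> differs from \<open>1/2\<close> by at most a
  multiple \<open>\<Delta>\<close> of \<open>\<epsilon> + \<kappa>\<close>.  As \<open>\<epsilon> < 1/5\<close> keeps \<open>\<Delta>\<close> away from \<open>1/2\<close>, the threshold stays in a
  compact range, where the normal density is bounded below; this turns the error in probability into
  \<open>\<bar>u\<^sup>T \<Gamma> u - \<beta> \<sigma>\<^sup>2\<bar> \<le> K \<Delta> \<sigma>\<^sup>2\<close> (\<open>deep_direction_bound\<close>).  The matrix \<open>\<Gamma> / \<beta> - \<Sigma>\<close> is, off its diagonal,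
  supported on a block of size at most \<open>2 s\<close>; polarisation and \<open>\<sigma>\<^sup>2 \<le> M\<close> therefore carry the bound from
  the quadratic forms of sparse directions to the operator norm (\<open>sparse_quadratic_form\<close>,
  \<open>op_norm_le_quadratic_form\<close>, \<open>quadratic_form_le_s_max\<close>).

  The probabilistic core is that the sampling error \<open>\<kappa>\<close> is of the order of
  \<open>sqrt ((s ln (e p / s) + ln (1 / \<delta>)) / n)\<close>, without a further logarithm, uniformly in \<open>u\<close>.  The
  Gaussian component of the contaminated law \<open>P\<close> has a density with respect to it: there is a weight
  \<open>0 \<le> h \<le> 1\<close> with \<open>(1 - \<epsilon>) N(0, \<Sigma>) = h P\<close> (\<open>dominated_component_density\<close>).  Weighted frequencies
  behave like frequencies of a purely Gaussian sample, whatever the contaminating distribution is, and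
  they bound the true frequencies from below, and from above up to the average of \<open>1 - h\<close>, which is
  close to \<open>\<epsilon>\<close>.

  For one support \<open>S\<close> of size \<open>2 s\<close>, an orthonormal basis of the span of the coordinates in \<open>S\<close> reduces the
  directions supported on \<open>S\<close> to the unit sphere of a Euclidean space of dimension at most \<open>2 s\<close>, also
  when \<open>\<Sigma>\<close> is singular (\<open>gaussian_frame\<close>).  On that sphere the deviation is controlled by chaining along
  lattice nets of mesh \<open>8^-k\<close> (\<open>uniform_hit_deviation\<close>): the indicators attached to neighbouring net points
  differ with probability of order \<open>4^-k\<close>, and this decay outweighs the growth of the nets.  At the
  finest scale the remaining error is controlled by a uniform bound on \<open>\<Sum>i<n. h (X\<^sub>i) \<bar>c \<cdot> Y (X\<^sub>i)\<bar>\<close>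
  (\<open>uniform_abs_moment\<close>).  A union bound over the supports costs \<open>ln (p choose 2 s)\<close>.  All exceptional
  events come from finite nets, hence they are measurable, and the error bound holds at every sample point
  outside them.
\<close>

section \<open>The standard normal law\<close>

abbreviation SN :: "real measure" where "SN \<equiv> std_normal_distribution"

definition half_normal_cdf :: "real \<Rightarrow> real" where
  "half_normal_cdf a = measure SN {x. \<bar>x\<bar> \<le> a}"

lemma prob_space_SN: "prob_space SN"
  using real_dist_normal_dist by (simp add: real_distribution_def)

lemma measure_SN_interval:
  fixes a b :: real
  shows "emeasure SN {a..b} = (\<integral>\<^sup>+x. ennreal (std_normal_density x) * indicator {a..b} x \<partial>lborel)"
  by (subst emeasure_density) auto

lemma SN_interval_le:
  fixes a b :: real assumes "a \<le> b"
  shows "measure SN {a..b} \<le> b - a"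
proof -
  interpret prob_space SN by (rule prob_space_SN)
  have d: "std_normal_density x \<le> 1" for x
  proof -
    have "1 \<le> sqrt (2 * pi)" using pi_ge_two by (intro real_le_rsqrt) auto
    hence "1 / sqrt (2 * pi) \<le> 1" by simp
    moreover have "exp (- x\<^sup>2 / 2) \<le> 1" by simp
    ultimately have "(1 / sqrt (2 * pi)) * exp (- x\<^sup>2 / 2) \<le> 1 * 1"
      by (intro mult_mono) auto
    thus ?thesis by (simp add: std_normal_density_def)
  qed
  have "emeasure SN {a..b} \<le> (\<integral>\<^sup>+x. indicator {a..b} x \<partial>lborel)"
    unfolding measure_SN_interval
    by (intro nn_integral_mono) (auto simp: indicator_def intro: d)
  also have "\<dots> = ennreal (b - a)" using assms by simp
  finally show ?thesis
    using assms by (simp add: emeasure_eq_measure)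
qed

lemma SN_interval_ge:
  fixes a b :: real assumes "0 \<le> a" "a \<le> b" "b \<le> 4"
  shows "std_normal_density 4 * (b - a) \<le> measure SN {a..b}"
proof -
  interpret prob_space SN by (rule prob_space_SN)
  have d: "std_normal_density 4 \<le> std_normal_density x" if "a \<le> x" "x \<le> b" for x
  proof -
    have "x\<^sup>2 \<le> 4\<^sup>2" using that assms by (intro power_mono) auto
    thus ?thesis unfolding std_normal_density_def
      by (intro mult_left_mono) auto
  qed
  have "ennreal (std_normal_density 4 * (b - a)) = (\<integral>\<^sup>+x. ennreal (std_normal_density 4) * indicator {a..b} x \<partial>lborel)"
    using assms by (simp add: nn_integral_cmult_indicator ennreal_mult)
  also have "\<dots> \<le> emeasure SN {a..b}"
    unfolding measure_SN_interval
    by (intro nn_integral_mono) (auto simp: indicator_def intro!: d ennreal_leI)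
  finally show ?thesis
    by (simp add: emeasure_eq_measure)
qed

lemma SN_singleton: "measure SN {a} = 0"
proof -
  interpret prob_space SN by (rule prob_space_SN)
  have "measure SN {a..a} \<le> a - a" by (rule SN_interval_le) simp
  thus ?thesis using measure_nonneg[of SN "{a}"] by simp
qed

lemma SN_second_moment: "(\<integral>x. x\<^sup>2 \<partial>SN) = 1" "integrable SN (\<lambda>x. x\<^sup>2)"
  using std_normal_distribution_even_moments[of 1] by auto

lemma SN_chebyshev:
  assumes "0 < r"
  shows "measure SN {x. r \<le> \<bar>x\<bar>} \<le> 1 / r\<^sup>2"
proof -
  interpret prob_space SN by (rule prob_space_SN)
  have "prob {x \<in> space SN. x\<^sup>2 \<ge> r\<^sup>2} \<le> (\<integral>x. x\<^sup>2 \<partial>SN) / r\<^sup>2"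
    using assms by (intro integral_Markov_inequality_measure[where A = UNIV, simplified] SN_second_moment) auto
  moreover have "{x \<in> space SN. x\<^sup>2 \<ge> r\<^sup>2} = {x. r \<le> \<bar>x\<bar>}"
    using assms abs_le_square_iff[of r] by auto
  ultimately show ?thesis by (simp add: SN_second_moment)
qed

lemma SN_exp: "(\<integral>\<^sup>+x. ennreal (exp (t * x)) \<partial>SN) = ennreal (exp (t\<^sup>2 / 2))"
proof -
  have eq: "std_normal_density x * exp (t * x) = exp (t\<^sup>2/2) * normal_density t 1 x" for x
  proof -
    have "exp (- x\<^sup>2 / 2) * exp (t * x) = exp (t\<^sup>2/2) * exp (-(x - t)\<^sup>2 / 2)"
      unfolding exp_add[symmetric] by (simp add: power2_eq_square algebra_simps add_divide_distrib diff_divide_distrib)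
    thus ?thesis by (simp add: std_normal_density_def normal_density_def)
  qed
  have one: "(\<integral>\<^sup>+x. ennreal (normal_density t 1 x) \<partial>lborel) = 1"
    by (subst nn_integral_eq_integral) auto
  have "(\<integral>\<^sup>+x. ennreal (exp (t * x)) \<partial>SN)
      = (\<integral>\<^sup>+x. ennreal (std_normal_density x) * ennreal (exp (t * x)) \<partial>lborel)"
    by (intro nn_integral_density) auto
  also have "\<dots> = (\<integral>\<^sup>+x. ennreal (exp (t\<^sup>2/2)) * ennreal (normal_density t 1 x) \<partial>lborel)"
    by (simp add: ennreal_mult'[symmetric] eq)
  also have "\<dots> = ennreal (exp (t\<^sup>2/2))"
    by (subst nn_integral_cmult) (auto simp: one)
  finally show ?thesis .
qed

text \<open>
  A two-sided exponential moment: \<open>exp \<bar>y\<bar> \<le> exp y + exp (- y)\<close> reduces it to the moment generating function.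
\<close>

lemma SN_exp_abs: "(\<integral>\<^sup>+x. ennreal (exp \<bar>t * x\<bar>) \<partial>SN) \<le> ennreal (2 * exp (t\<^sup>2 / 2))"
proof -
  have "(\<integral>\<^sup>+x. ennreal (exp \<bar>t * x\<bar>) \<partial>SN) \<le> (\<integral>\<^sup>+x. ennreal (exp (t * x)) + ennreal (exp ((-t) * x)) \<partial>SN)"
    by (intro nn_integral_mono) (auto simp: abs_if ennreal_plus[symmetric] simp del: ennreal_plus intro!: ennreal_leI)
  also have "\<dots> = ennreal (exp (t\<^sup>2 / 2)) + ennreal (exp ((-t)\<^sup>2 / 2))"
    unfolding SN_exp[symmetric] by (intro nn_integral_add) auto
  also have "\<dots> = ennreal (2 * exp (t\<^sup>2 / 2))" by (simp add: ennreal_plus[symmetric] del: ennreal_plus)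
  finally show ?thesis .
qed

lemma half_normal_cdf_ge_cheb: assumes "0 < a" shows "1 - 1 / a\<^sup>2 \<le> half_normal_cdf a"
proof -
  interpret prob_space SN by (rule prob_space_SN)
  have "prob {x. \<not> \<bar>x\<bar> \<le> a} \<le> prob {x. a \<le> \<bar>x\<bar>}"
    by (intro finite_measure_mono) auto
  also have "\<dots> \<le> 1 / a\<^sup>2" using assms by (rule SN_chebyshev)
  also have "prob {x. \<not> \<bar>x\<bar> \<le> a} = 1 - prob {x. \<bar>x\<bar> \<le> a}"
    by (subst prob_compl[symmetric]) (auto intro!: arg_cong[where f = prob])
  finally show ?thesis by (simp add: half_normal_cdf_def)
qed

text \<open>
  On \<open>[0, 4]\<close> the density is at least its value at \<open>4\<close>.  This converts an error in probability into an error
  in the threshold, and is where thresholds have to be bounded.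
\<close>

lemma half_normal_cdf_diff_ge:
  assumes "0 \<le> s" "s \<le> t" "t \<le> 4"
  shows "std_normal_density 4 * (t - s) \<le> half_normal_cdf t - half_normal_cdf s"
proof -
  interpret prob_space SN by (rule prob_space_SN)
  have "half_normal_cdf t - half_normal_cdf s = prob ({x. \<bar>x\<bar> \<le> t} - {x. \<bar>x\<bar> \<le> s})"
    unfolding half_normal_cdf_def using assms by (subst finite_measure_Diff) auto
  also have "\<dots> \<ge> prob ({s..t} - {s})"
    using assms by (intro finite_measure_mono) auto
  also have "prob ({s..t} - {s}) = prob {s..t} - prob {s}"
    using assms by (subst finite_measure_Diff) auto
  also have "\<dots> = prob {s..t}" by (simp add: SN_singleton)
  finally show ?thesis using SN_interval_ge[OF assms] by linarith
qed

lemma cdf_SN_diff: assumes "a \<le> b" shows "cdf SN b - cdf SN a = measure SN {a..b}"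
proof -
  interpret prob_space SN by (rule prob_space_SN)
  have "cdf SN b - cdf SN a = prob ({..b} - {..a})"
    unfolding cdf_def using assms by (subst finite_measure_Diff) auto
  also have "{..b} - {..a} = {a..b} - {a}" using assms by auto
  also have "prob \<dots> = prob {a..b}" using assms by (subst finite_measure_Diff) (auto simp: SN_singleton)
  finally show ?thesis .
qed

lemma SN_reflect: assumes "A \<in> sets borel" shows "measure SN (uminus -` A) = measure SN A"
proof -
  have m: "uminus -` A \<in> sets borel"
    using measurable_sets[of uminus borel borel A] assms by simp
  have "emeasure SN (uminus -` A) = (\<integral>\<^sup>+x. ennreal (std_normal_density x) * indicator (uminus -` A) x \<partial>lborel)"
    using m by (subst emeasure_density) simp_all
  also have "\<dots> = (\<integral>\<^sup>+x. ennreal (std_normal_density x) * indicator A x \<partial>lborel)"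
    using assms nn_integral_real_affine[where c = "-1" and t = 0
        and f = "\<lambda>x. ennreal (std_normal_density x) * indicator A x"]
    by (simp add: std_normal_density_def indicator_def)
  also have "\<dots> = emeasure SN A" using assms by (subst emeasure_density) auto
  finally show ?thesis by (simp add: measure_def)
qed

lemma half_normal_cdf_cdf: assumes "0 \<le> a" shows "half_normal_cdf a = 2 * cdf SN a - 1"
proof -
  interpret prob_space SN by (rule prob_space_SN)
  have "prob {..a} = prob (uminus -` {..a})" by (subst SN_reflect) auto
  also have "uminus -` {..a} = {-a..}" by auto
  finally have r: "prob {-a..} = cdf SN a" by (simp add: cdf_def)
  have "prob {-a..} = 1 - prob {..<-a}"
    by (subst prob_compl[symmetric]) (auto intro!: arg_cong[where f = prob])
  hence l: "prob {..<-a} = 1 - cdf SN a" using r by simp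
  have "{x. \<bar>x\<bar> \<le> a} = {..a} - {..<-a}" using assms by auto
  moreover have "prob ({..a} - {..<-a}) = prob {..a} - prob {..<-a}"
    using assms by (intro finite_measure_Diff) auto
  ultimately have "half_normal_cdf a = cdf SN a - prob {..<-a}" unfolding half_normal_cdf_def cdf_def by simp
  thus ?thesis using l by simp
qed

lemma half_normal_cdf_0: "half_normal_cdf 0 = 0"
  by (simp add: half_normal_cdf_def SN_singleton)

lemma half_normal_cdf_strict_mono: assumes "0 \<le> s" "s < t" shows "half_normal_cdf s < half_normal_cdf t"
proof -
  interpret prob_space SN by (rule prob_space_SN)
  have nz: "measure SN {s..t} \<noteq> 0"
  proof
    assume "measure SN {s..t} = 0"
    hence "emeasure SN {s..t} = 0" by (simp add: emeasure_eq_measure)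
    hence "AE x in lborel. ennreal (std_normal_density x) * indicator {s..t} x = 0"
      using assms by (subst (asm) measure_SN_interval) (auto simp: nn_integral_0_iff_AE)
    hence "AE x in lborel. x \<notin> {s..t}"
      by eventually_elim (use normal_density_pos[of 1 0] in \<open>auto simp: indicator_def less_le split: if_splits\<close>)
    hence "emeasure lborel {s..t} = 0" using emeasure_eq_0_AE[of "\<lambda>x. x \<in> {s..t}" lborel] 
      by (simp add: atLeastAtMost_def atLeast_def atMost_def Collect_conj_eq)
    thus False using assms by simp
  qed
  hence "0 < measure SN {s..t}" by (simp add: less_le measure_nonneg)
  moreover have "cdf SN t - cdf SN s = measure SN {s..t}" using assms by (intro cdf_SN_diff) auto
  ultimately show ?thesis using assms half_normal_cdf_cdf[of s] half_normal_cdf_cdf[of t] by simp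
qed

text \<open>
  The defining equation of \<open>\<beta>\<close> has a unique solution, since the normal distribution function is continuous
  and strictly increasing.  By symmetry it says that \<open>sqrt \<beta>\<close> is the median of the absolute value of a
  standard normal variable; Chebyshev's inequality at \<open>4\<close> gives probability \<open>15/16 > 1/2\<close>, whence
  \<open>sqrt \<beta> < 4\<close>.
\<close>

lemma depth_beta:
  shows depth_beta_pos: "0 < depth_beta" and depth_beta_half_normal_cdf: "half_normal_cdf (sqrt depth_beta) = 1 / 2"
    and depth_beta_less: "sqrt depth_beta < 4"
proof -
  interpret prob_space SN by (rule prob_space_SN)
  have Lip: "\<bar>half_normal_cdf y - half_normal_cdf x\<bar> \<le> 2 * \<bar>y - x\<bar>" if "0 \<le> x" "0 \<le> y" for x y
  proof -
    have *: "\<bar>half_normal_cdf y - half_normal_cdf x\<bar> \<le> 2 * \<bar>y - x\<bar>" if "0 \<le> x" "x \<le> y" for x y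
    proof -
      have "half_normal_cdf y - half_normal_cdf x = 2 * measure SN {x..y}"
        using that half_normal_cdf_cdf[of x] half_normal_cdf_cdf[of y] cdf_SN_diff[of x y] by simp
      thus ?thesis using that SN_interval_le[of x y] measure_nonneg[of SN "{x..y}"] by simp
    qed
    show ?thesis using that *[of x y] *[of y x] by (cases "x \<le> y") (auto simp: abs_minus_commute)
  qed
  have "continuous_on {0..4} half_normal_cdf"
  proof (rule continuous_on_subset[OF lipschitz_on_continuous_on[of 2]])
    show "2-lipschitz_on {0..} half_normal_cdf" using Lip by (auto simp: lipschitz_on_def dist_real_def abs_minus_commute)
  qed auto
  moreover have G4: "15/16 \<le> half_normal_cdf 4" using half_normal_cdf_ge_cheb[of 4] by simp
  ultimately obtain t where t: "0 \<le> t" "t \<le> 4" "half_normal_cdf t = 1/2"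
    using IVT'[of half_normal_cdf 0 "1/2" 4] half_normal_cdf_0 by auto
  have uniq: "y = t" if "0 \<le> y" "half_normal_cdf y = 1/2" for y
    using that t half_normal_cdf_strict_mono[of y t] half_normal_cdf_strict_mono[of t y] by (cases y t rule: linorder_cases) auto
  have "depth_beta = t\<^sup>2"
    unfolding depth_beta_def
  proof (rule the_equality)
    show "0 \<le> t\<^sup>2 \<and> cdf SN (sqrt (t\<^sup>2)) = 3/4" using t half_normal_cdf_cdf[of t] by auto
  next
    fix b assume b: "0 \<le> b \<and> cdf SN (sqrt b) = 3/4"
    hence "half_normal_cdf (sqrt b) = 1/2" by (subst half_normal_cdf_cdf) auto
    hence "sqrt b = t" using b by (intro uniq) auto
    thus "b = t\<^sup>2" using b by auto
  qed
  moreover have "t \<noteq> 0" "t \<noteq> 4" using t half_normal_cdf_0 G4 by auto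
  ultimately have b: "depth_beta = t\<^sup>2" "0 < t" "t < 4"
    using t(1,2) by auto
  hence s: "sqrt depth_beta = t" by (intro real_sqrt_unique) auto
  show "0 < depth_beta" unfolding b(1) using b(2) by simp
  show "half_normal_cdf (sqrt depth_beta) = 1 / 2" "sqrt depth_beta < 4" using b(3) t(3) s by auto
qed

section \<open>Averages of independent samples\<close>

text \<open>
  For negative \<open>x\<close>, multiplying \<open>1 + x + x\<^sup>2\<close> by the second Taylor polynomial of \<open>exp (- x)\<close> gives at least \<open>1\<close>.
\<close>

lemma exp_le_quadratic:
  fixes x :: real assumes "x \<le> 1" shows "exp x \<le> 1 + x + x\<^sup>2"
proof (cases "0 \<le> x")
  case True thus ?thesis using assms by (rule exp_bound)
next
  case neg: False
  have q: "0 < 1 + x + x\<^sup>2" 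
  proof -
    have "1 + x + x\<^sup>2 = (x + 1/2)\<^sup>2 + 3/4" by (simp add: power2_eq_square algebra_simps)
    thus ?thesis by (simp add: add_nonneg_pos)
  qed
  define y where "y = - x"
  have y: "0 < y" using neg by (simp add: y_def)
  have "1 \<le> (1 + x + x\<^sup>2) * (1 + y + y\<^sup>2 / 2)"
  proof -
    have "(1 + x + x\<^sup>2) * (1 + y + y\<^sup>2 / 2) = 1 + y^2/2 + y^3/2 + y^4/2"
      by (simp add: y_def algebra_simps power2_eq_square power3_eq_cube power4_eq_xxxx add_divide_distrib diff_divide_distrib)
    thus ?thesis using y by simp
  qed
  also have "\<dots> \<le> (1 + x + x\<^sup>2) * exp y"
    using q y exp_lower_Taylor_quadratic[of y] by (intro mult_left_mono) auto
  finally show ?thesis by (simp add: y_def exp_minus field_simps)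
qed

lemma iid_exponential_markov:
  fixes g :: "'a \<Rightarrow> real"
  assumes P: "prob_space P" and [measurable]: "g \<in> borel_measurable P"
    and m: "(\<integral>\<^sup>+x. ennreal (exp (g x)) \<partial>P) \<le> ennreal (exp m)"
  shows "measure (\<Pi>\<^sub>M i\<in>{..<n}. P) {X \<in> space (\<Pi>\<^sub>M i\<in>{..<n}. P). real n * m + T \<le> (\<Sum>i<n. g (X i))} \<le> exp (- T)"
proof -
  interpret P: prob_space P by fact
  interpret pr: product_prob_space "\<lambda>_::nat. P" by unfold_locales
  interpret fp: finite_product_prob_space "\<lambda>_::nat. P" "{..<n}" by unfold_locales auto
  let ?PP = "\<Pi>\<^sub>M i\<in>{..<n}. P"
  let ?S = "\<lambda>X. (\<Sum>i<n. g (X i))"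
  have int: "(\<integral>\<^sup>+X. ennreal (exp (?S X)) \<partial>?PP) = (\<Prod>i<n. \<integral>\<^sup>+x. ennreal (exp (g x)) \<partial>P)"
    by (subst pr.product_nn_integral_prod[symmetric])
       (auto simp: exp_sum prod_ennreal intro!: nn_integral_cong)
  have "emeasure ?PP {X \<in> space ?PP. 1 \<le> ennreal (exp (- (n * m + T))) * ennreal (exp (?S X))}
     \<le> ennreal (exp (- (n * m + T))) * (\<integral>\<^sup>+X. ennreal (exp (?S X)) * indicator (space ?PP) X \<partial>?PP)"
    by (rule nn_integral_Markov_inequality) auto
  also have "(\<integral>\<^sup>+X. ennreal (exp (?S X)) * indicator (space ?PP) X \<partial>?PP) = (\<integral>\<^sup>+X. ennreal (exp (?S X)) \<partial>?PP)"
    by (intro nn_integral_cong) auto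
  also have "\<dots> \<le> (\<Prod>i<n. ennreal (exp m))"
    unfolding int by (intro prod_mono_ennreal m)
  also have "\<dots> = ennreal (exp (n * m))"
    by (simp add: ennreal_power exp_of_nat_mult)
  also have "ennreal (exp (- (n * m + T))) * ennreal (exp (n * m)) = ennreal (exp (- T))"
    by (subst ennreal_mult[symmetric]) (auto simp: exp_add[symmetric])
  finally have "emeasure ?PP {X \<in> space ?PP. 1 \<le> ennreal (exp (- (n * m + T))) * ennreal (exp (?S X))}
     \<le> ennreal (exp (- T))" by (simp add: mult_left_mono)
  also have "{X \<in> space ?PP. 1 \<le> ennreal (exp (- (n * m + T))) * ennreal (exp (?S X))}
      = {X \<in> space ?PP. n * m + T \<le> ?S X}"
    by (auto simp: ennreal_mult[symmetric] exp_add[symmetric] simp flip: ennreal_1 )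
  finally show ?thesis by (simp add: fp.emeasure_eq_measure)
qed

text \<open>
  A Bernstein-type bound with the exponent \<open>lam\<close> left free.  The variance proxy \<open>v\<close> enters linearly, so that
  a small \<open>v\<close> can be exploited by a large \<open>lam\<close>; the chaining argument chooses \<open>lam\<close> separately on each
  scale.  Using the second moment instead of the variance avoids centring.
\<close>

lemma iid_chernoff:
  fixes f :: "'a \<Rightarrow> real"
  assumes P: "prob_space P" and [measurable]: "f \<in> borel_measurable P"
    and bd: "\<And>x. x \<in> space P \<Longrightarrow> \<bar>f x\<bar> \<le> 1"
    and var: "(\<integral>x. (f x)\<^sup>2 \<partial>P) \<le> v" and lam: "0 < lam" "lam \<le> 1"
  shows "measure (\<Pi>\<^sub>M i\<in>{..<n}. P) {X \<in> space (\<Pi>\<^sub>M i\<in>{..<n}. P).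
     real n * ((\<integral>x. f x \<partial>P) + lam * v) + T / lam \<le> (\<Sum>i<n. f (X i))} \<le> exp (- T)"
proof -
  interpret P: prob_space P by fact
  have i1: "integrable P f" by (rule P.integrable_const_bound[of _ 1]) (use bd in auto)
  have i2: "integrable P (\<lambda>x. (f x)\<^sup>2)"
    by (rule P.integrable_const_bound[of _ 1]) (use bd in \<open>auto simp: abs_square_le_1\<close>)
  let ?m = "lam * (\<integral>x. f x \<partial>P) + lam\<^sup>2 * v"
  have "(\<integral>\<^sup>+x. ennreal (exp (lam * f x)) \<partial>P) \<le> (\<integral>\<^sup>+x. ennreal (1 + lam * f x + lam\<^sup>2 * (f x)\<^sup>2) \<partial>P)"
  proof (intro nn_integral_mono ennreal_leI)
    fix x assume "x \<in> space P"
    hence "lam * f x \<le> lam * 1" using bd[of x] lam by (intro mult_left_mono) auto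
    hence "lam * f x \<le> 1" using lam by linarith
    thus "exp (lam * f x) \<le> 1 + lam * f x + lam\<^sup>2 * (f x)\<^sup>2"
      using exp_le_quadratic[of "lam * f x"] by (simp add: power_mult_distrib)
  qed
  also have "\<dots> = ennreal (\<integral>x. 1 + lam * f x + lam\<^sup>2 * (f x)\<^sup>2 \<partial>P)"
  proof (rule nn_integral_eq_integral)
    show "integrable P (\<lambda>x. 1 + lam * f x + lam\<^sup>2 * (f x)\<^sup>2)" using i1 i2 by auto
    show "AE x in P. 0 \<le> 1 + lam * f x + lam\<^sup>2 * (f x)\<^sup>2"
    proof (intro AE_I2)
      fix x
      have "1 + lam * f x + lam\<^sup>2 * (f x)\<^sup>2 = (lam * f x + 1/2)\<^sup>2 + 3/4" 
        by (simp add: power2_eq_square algebra_simps)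
      thus "0 \<le> 1 + lam * f x + lam\<^sup>2 * (f x)\<^sup>2" by (metis add_nonneg_nonneg divide_nonneg_nonneg zero_le_numeral zero_le_power2)
    qed
  qed
  also have "\<dots> = ennreal (1 + lam * (\<integral>x. f x \<partial>P) + lam\<^sup>2 * (\<integral>x. (f x)\<^sup>2 \<partial>P))"
    using i1 i2 by (simp add: P.prob_space)
  also have "\<dots> \<le> ennreal (1 + ?m)"
    using var by (intro ennreal_leI) (auto intro: mult_left_mono)
  also have "\<dots> \<le> ennreal (exp ?m)" by (intro ennreal_leI exp_ge_add_one_self)
  finally have "measure (\<Pi>\<^sub>M i\<in>{..<n}. P) {X \<in> space (\<Pi>\<^sub>M i\<in>{..<n}. P). real n * ?m + T \<le> (\<Sum>i<n. lam * f (X i))} \<le> exp (- T)"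
    by (intro iid_exponential_markov P) auto
  also have "{X \<in> space (\<Pi>\<^sub>M i\<in>{..<n}. P). real n * ?m + T \<le> (\<Sum>i<n. lam * f (X i))}
     = {X \<in> space (\<Pi>\<^sub>M i\<in>{..<n}. P). real n * ((\<integral>x. f x \<partial>P) + lam * v) + T / lam \<le> (\<Sum>i<n. f (X i))}"
  proof -
    have "(real n * ?m + T \<le> lam * S) = (real n * ((\<integral>x. f x \<partial>P) + lam * v) + T / lam \<le> S)" for S
    proof -
      have "real n * ?m + T = lam * (real n * ((\<integral>x. f x \<partial>P) + lam * v) + T / lam)"
        using lam by (simp add: algebra_simps power2_eq_square)
      thus ?thesis using lam by simp
    qed
    thus ?thesis by (simp add: sum_distrib_left[symmetric])
  qed
  finally show ?thesis .
qed

lemma iid_chernoff_finite: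
  fixes f :: "'b \<Rightarrow> 'a \<Rightarrow> real"
  assumes P: "prob_space P" and F: "finite F" and n: "0 < n"
    and meas: "\<And>z. z \<in> F \<Longrightarrow> f z \<in> borel_measurable P"
    and bd: "\<And>z x. z \<in> F \<Longrightarrow> x \<in> space P \<Longrightarrow> \<bar>f z x\<bar> \<le> 1"
    and var: "\<And>z. z \<in> F \<Longrightarrow> (\<integral>x. (f z x)\<^sup>2 \<partial>P) \<le> v" and lam: "0 < lam" "lam \<le> 1"
  shows "\<exists>B \<in> sets (\<Pi>\<^sub>M i\<in>{..<n}. P). measure (\<Pi>\<^sub>M i\<in>{..<n}. P) B \<le> 2 * real (card F) * exp (- T) \<and>
    (\<forall>X \<in> space (\<Pi>\<^sub>M i\<in>{..<n}. P) - B. \<forall>z\<in>F.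
      \<bar>(\<Sum>i<n. f z (X i)) / real n - (\<integral>x. f z x \<partial>P)\<bar> \<le> lam * v + T / (real n * lam))"
proof -
  let ?PP = "\<Pi>\<^sub>M i\<in>{..<n}. P"
  interpret P: prob_space P by fact
  interpret pr: product_prob_space "\<lambda>_::nat. P" by unfold_locales
  interpret fp: finite_product_prob_space "\<lambda>_::nat. P" "{..<n}" by unfold_locales auto
  define B1 where "B1 z = {X \<in> space ?PP. real n * ((\<integral>x. f z x \<partial>P) + lam * v) + T / lam \<le> (\<Sum>i<n. f z (X i))}" for z
  define B2 where "B2 z = {X \<in> space ?PP. real n * ((\<integral>x. - f z x \<partial>P) + lam * v) + T / lam \<le> (\<Sum>i<n. - f z (X i))}" for z
  have B: "B1 z \<in> sets ?PP" "B2 z \<in> sets ?PP" if "z \<in> F" for z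
    using meas[OF that, measurable] unfolding B1_def B2_def by measurable
  have m1: "measure ?PP (B1 z) \<le> exp (- T)" if "z \<in> F" for z
    unfolding B1_def by (rule iid_chernoff) (use that assms in auto)
  have m2: "measure ?PP (B2 z) \<le> exp (- T)" if "z \<in> F" for z
    unfolding B2_def by (rule iid_chernoff) (use that assms in \<open>auto intro!: borel_measurable_uminus\<close>)
  show ?thesis
  proof (intro bexI[of _ "\<Union>z\<in>F. B1 z \<union> B2 z"] conjI ballI)
    show "(\<Union>z\<in>F. B1 z \<union> B2 z) \<in> sets ?PP" using F B by auto
    have "measure ?PP (\<Union>z\<in>F. B1 z \<union> B2 z) \<le> (\<Sum>z\<in>F. measure ?PP (B1 z \<union> B2 z))"
      using F B by (intro fp.finite_measure_subadditive_finite) auto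
    also have "\<dots> \<le> (\<Sum>z\<in>F. exp (- T) + exp (- T))"
      using B m1 m2 by (intro sum_mono order.trans[OF measure_Un_le] add_mono) auto
    also have "\<dots> = 2 * real (card F) * exp (- T)" by simp
    finally show "measure ?PP (\<Union>z\<in>F. B1 z \<union> B2 z) \<le> 2 * real (card F) * exp (- T)" .
  next
    fix X z assume "X \<in> space ?PP - (\<Union>z\<in>F. B1 z \<union> B2 z)" "z \<in> F"
    hence "(\<Sum>i<n. f z (X i)) < real n * ((\<integral>x. f z x \<partial>P) + lam * v) + T / lam"
      "(\<Sum>i<n. - f z (X i)) < real n * ((\<integral>x. - f z x \<partial>P) + lam * v) + T / lam"
      unfolding B1_def B2_def by auto
    hence "(\<Sum>i<n. f z (X i)) / n < (\<integral>x. f z x \<partial>P) + lam * v + T / (real n * lam)"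
      "- (\<Sum>i<n. f z (X i)) / n < - (\<integral>x. f z x \<partial>P) + lam * v + T / (real n * lam)"
      using n lam by (simp_all add: field_simps sum_negf)
    thus "\<bar>(\<Sum>i<n. f z (X i)) / real n - (\<integral>x. f z x \<partial>P)\<bar> \<le> lam * v + T / (real n * lam)"
      by linarith
  qed
qed

section \<open>Lattice points\<close>

text \<open>
  Nets of Euclidean balls are taken from lattices, so that rounding provides the projection to the net
  explicitly.  The bound is on the sum norm, which makes counting easy and is implied by a bound on the
  Euclidean norm, at the cost of a factor \<open>sqrt d\<close>, through the Cauchy--Schwarz inequality.
\<close>

definition lattice_ball :: "nat \<Rightarrow> nat \<Rightarrow> (nat \<Rightarrow> int) set" where
  "lattice_ball d R = {m \<in> {..<d} \<rightarrow>\<^sub>E UNIV. (\<Sum>j<d. \<bar>m j\<bar>) \<le> int R}"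

lemma geometric_two_sided:
  fixes lam :: real assumes "0 < lam"
  shows "(\<Sum>i\<in>{- int R..int R}. exp (- lam * \<bar>real_of_int i\<bar>)) \<le> 1 + 2 / lam"
proof -
  define q where "q = exp (- lam)"
  have q: "0 < q" "q < 1" using assms by (auto simp: q_def)
  have eq: "exp (- lam * \<bar>real_of_int i\<bar>) = q ^ nat \<bar>i\<bar>" for i
    unfolding q_def by (subst exp_of_nat_mult[symmetric]) (auto simp: mult.commute)
  have sub: "{- int R..int R} = insert 0 (int ` {1..R} \<union> (\<lambda>k. - int k) ` {1..R})"
  proof (intro equalityI subsetI)
    fix i assume i: "i \<in> {- int R..int R}"
    show "i \<in> insert 0 (int ` {1..R} \<union> (\<lambda>k. - int k) ` {1..R})"
    proof (cases i "0::int" rule: linorder_cases)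
      case less
      hence "i = - int (nat (- i))" "nat (- i) \<in> {1..R}" using i by auto
      thus ?thesis by blast
    next
      case greater
      hence "i = int (nat i)" "nat i \<in> {1..R}" using i by auto
      thus ?thesis by blast
    qed auto
  qed auto
  have "(\<Sum>i\<in>{- int R..int R}. q ^ nat \<bar>i\<bar>) = 1 + (\<Sum>i\<in>int ` {1..R} \<union> (\<lambda>k. - int k) ` {1..R}. q ^ nat \<bar>i\<bar>)"
    unfolding sub by (subst sum.insert) auto
  also have "(\<Sum>i\<in>int ` {1..R} \<union> (\<lambda>k. - int k) ` {1..R}. q ^ nat \<bar>i\<bar>)
      = (\<Sum>i\<in>int ` {1..R}. q ^ nat \<bar>i\<bar>) + (\<Sum>i\<in>(\<lambda>k. - int k) ` {1..R}. q ^ nat \<bar>i\<bar>)"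
    by (subst sum.union_disjoint) auto
  also have "\<dots> = (\<Sum>i=1..R. q ^ i) + (\<Sum>i=1..R. q ^ i)"
    by (subst (1 2) sum.reindex) (auto simp: inj_on_def)
  finally have *: "(\<Sum>i\<in>{- int R..int R}. q ^ nat \<bar>i\<bar>) = 1 + 2 * (\<Sum>i=1..R. q ^ i)" by simp
  have "(\<Sum>i=1..R. q ^ i) = q * (\<Sum>i<R. q ^ i)"
    by (simp add: sum_distrib_left sum.shift_bounds_Suc_ivl lessThan_atLeast0 flip: power_Suc)
       (metis One_nat_def atLeastLessThanSuc_atLeastAtMost sum.shift_bounds_Suc_ivl)
  also have "\<dots> = q * ((1 - q ^ R) / (1 - q))"
    using q by (simp add: sum_gp_strict)
  also have "\<dots> \<le> q * (1 / (1 - q))"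
    using q by (intro mult_left_mono divide_right_mono) auto
  also have "\<dots> \<le> 1 / lam"
  proof -
    have "1 + lam \<le> exp lam" by simp
    hence "q * (1 + lam) \<le> 1" unfolding q_def by (simp add: exp_minus field_simps)
    thus ?thesis using q assms by (simp add: field_simps)
  qed
  finally show ?thesis unfolding eq * by simp
qed

text \<open>
  Each counted point has \<open>exp (lam (R - \<Sum>\<bar>m\<^sub>j\<bar>)) \<ge> 1\<close>, and the sum of these weights over a box factorises into
  one-dimensional geometric sums.  The choice \<open>lam = 1 / r\<close> balances the two factors; the outcome is
  exponential in the dimension, as a volume argument would give.
\<close>

lemma lattice_ball_card:
  assumes "0 < r"
  shows "finite (lattice_ball d (r * d))" "real (card (lattice_ball d (r * d))) \<le> (exp 1 * (1 + 2 * real r)) ^ d"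
proof -
  define R where "R = r * d"
  define lam where "lam = 1 / real r"
  have lam: "0 < lam" using assms by (simp add: lam_def)
  let ?B = "{..<d} \<rightarrow>\<^sub>E {- int R..int R}"
  have fin: "finite ?B" by (intro finite_PiE) auto
  have sub: "lattice_ball d R \<subseteq> ?B"
  proof
    fix m assume m: "m \<in> lattice_ball d R"
    hence S: "(\<Sum>j<d. \<bar>m j\<bar>) \<le> int R" by (simp add: lattice_ball_def)
    have "m j \<in> {- int R..int R}" if "j < d" for j
    proof -
      have "\<bar>m j\<bar> \<le> (\<Sum>j<d. \<bar>m j\<bar>)"
        by (rule member_le_sum[where f = "\<lambda>j. \<bar>m j\<bar>"]) (use that in auto)
      hence "\<bar>m j\<bar> \<le> int R" using S by linarith
      thus ?thesis by (simp add: abs_le_iff)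
    qed
    moreover have "m \<in> {..<d} \<rightarrow>\<^sub>E UNIV" using m by (simp add: lattice_ball_def)
    ultimately show "m \<in> ?B" by (simp add: PiE_iff)
  qed
  show "finite (lattice_ball d (r * d))" using finite_subset[OF sub fin] by (simp add: R_def)
  have "real (card (lattice_ball d R)) = (\<Sum>m\<in>lattice_ball d R. 1)" by simp
  also have "\<dots> \<le> (\<Sum>m\<in>lattice_ball d R. exp (lam * R) * (\<Prod>j<d. exp (- lam * \<bar>real_of_int (m j)\<bar>)))"
  proof (rule sum_mono)
    fix m assume "m \<in> lattice_ball d R"
    hence "(\<Sum>j<d. \<bar>m j\<bar>) \<le> int R" by (simp add: lattice_ball_def)
    hence "real_of_int (\<Sum>j<d. \<bar>m j\<bar>) \<le> real R" by linarith
    hence "lam * (\<Sum>j<d. \<bar>real_of_int (m j)\<bar>) \<le> lam * real R" using lam by (intro mult_left_mono) auto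
    hence "0 \<le> lam * R + (\<Sum>j<d. - lam * \<bar>real_of_int (m j)\<bar>)"
      by (simp add: sum_distrib_left sum_negf)
    hence "1 \<le> exp (lam * R + (\<Sum>j<d. - lam * \<bar>real_of_int (m j)\<bar>))" by simp
    thus "1 \<le> exp (lam * R) * (\<Prod>j<d. exp (- lam * \<bar>real_of_int (m j)\<bar>))"
      by (simp add: exp_add exp_sum)
  qed
  also have "\<dots> \<le> (\<Sum>m\<in>?B. exp (lam * R) * (\<Prod>j<d. exp (- lam * \<bar>real_of_int (m j)\<bar>)))"
    using fin sub by (intro sum_mono2) (auto intro!: mult_nonneg_nonneg prod_nonneg)
  also have "\<dots> = exp (lam * R) * (\<Sum>i\<in>{- int R..int R}. exp (- lam * \<bar>real_of_int i\<bar>)) ^ d"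
  proof -
    have "(\<Prod>j<d. \<Sum>i\<in>{- int R..int R}. exp (- lam * \<bar>real_of_int i\<bar>)) 
        = (\<Sum>m\<in>?B. \<Prod>j<d. exp (- lam * \<bar>real_of_int (m j)\<bar>))"
      by (rule prod_sum_PiE) auto
    thus ?thesis by (simp add: sum_distrib_left[symmetric])
  qed
  also have "\<dots> \<le> exp (lam * R) * (1 + 2 / lam) ^ d"
    using geometric_two_sided[OF lam] by (intro mult_left_mono power_mono) (auto intro: sum_nonneg)
  also have "exp (lam * R) = exp 1 ^ d"
    using assms by (simp add: lam_def R_def exp_of_nat_mult[symmetric])
  finally show "real (card (lattice_ball d (r * d))) \<le> (exp 1 * (1 + 2 * real r)) ^ d"
    by (simp add: lam_def R_def power_mult_distrib)
qed

lemma sum_arith_geometric: "(\<Sum>k<K. (real k + 1) / 2 ^ k) = 4 - (2 * real K + 4) / 2 ^ K"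
proof (induction K)
  case (Suc K)
  have "4 - (2 * real K + 4) / 2 ^ K + (real K + 1) / 2 ^ K = 4 - (2 * real (Suc K) + 4) / 2 ^ Suc K"
    by (simp add: field_simps)
  thus ?case unfolding sum.lessThan_Suc Suc .
qed simp

text \<open>
  With net distance \<open>8^-k\<close> and threshold \<open>4^-k\<close>, Chebyshev's inequality gives a probability of order \<open>4^-k\<close>.
\<close>

lemma power_8_4: "(1 / 8 ^ k)\<^sup>2 / (1 / 4 ^ k)\<^sup>2 = (1 / 4 ^ k :: real)"
  by (simp add: power_divide[symmetric] power_mult_distrib[symmetric] power2_eq_square power_one_over)

section \<open>Uniform deviations for a weighted Gaussian sample\<close>

text \<open>
  \<open>P\<close> is the law of one observation, \<open>N\<close> its Gaussian component of mass \<open>1 - \<epsilon>\<close>, and \<open>h\<close> the density of that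
  component with respect to \<open>P\<close>.  Under \<open>N\<close> the variables \<open>Y 0, ..., Y (d - 1)\<close> are independent standard
  normal; only the laws of their linear combinations are used, so only those are assumed.
\<close>

locale weighted_gaussian =
  fixes P N :: "'a measure" and h :: "'a \<Rightarrow> real" and \<epsilon> :: real
    and d :: nat and Y :: "nat \<Rightarrow> 'a \<Rightarrow> real"
  assumes prob_P: "prob_space P" and prob_N: "prob_space N" and sets_N: "sets N = sets P"
    and h_meas [measurable]: "h \<in> borel_measurable P" and h_nonneg: "0 \<le> h x" and h_le_1: "h x \<le> 1"
    and eps: "0 \<le> \<epsilon>" "\<epsilon> \<le> 1"
    and h_density: "density P (\<lambda>x. ennreal (h x)) = scale_measure (ennreal (1 - \<epsilon>)) N"
    and Y_meas: "j < d \<Longrightarrow> Y j \<in> borel_measurable P"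
    and Y_gauss: "distr N borel (\<lambda>x. \<Sum>j<d. z j * Y j x) = distr SN borel (\<lambda>g. L2_set z {..<d} * g)"
begin

sublocale P: prob_space P by (rule prob_P)
sublocale N: prob_space N by (rule prob_N)
sublocale pr: product_prob_space "\<lambda>_::nat. P" by unfold_locales

definition lin :: "(nat \<Rightarrow> real) \<Rightarrow> 'a \<Rightarrow> real" where
  "lin z x = (\<Sum>j<d. z j * Y j x)"

abbreviation nrm :: "(nat \<Rightarrow> real) \<Rightarrow> real" where
  "nrm z \<equiv> L2_set z {..<d}"

lemma space_N: "space N = space P"
  by (rule sets_eq_imp_space_eq[OF sets_N])

lemma measurable_N: "measurable N M' = measurable P M'"
  by (rule measurable_cong_sets[OF sets_N refl])

lemma lin_meas [measurable]: "lin z \<in> borel_measurable P"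
  unfolding lin_def using Y_meas by (intro borel_measurable_sum borel_measurable_times) auto

lemma lin_add: "lin (\<lambda>j. z j + w j) x = lin z x + lin w x"
  by (simp add: lin_def sum.distrib algebra_simps)

lemma lin_diff: "lin (\<lambda>j. z j - w j) x = lin z x - lin w x"
  by (simp add: lin_def sum_subtractf algebra_simps)

lemma lin_scale: "lin (\<lambda>j. t * z j) x = t * lin z x"
  by (simp add: lin_def sum_distrib_left algebra_simps)

text \<open>
  A weighted expectation under \<open>P\<close> is a Gaussian expectation: the contaminating part disappears.
\<close>

lemma nn_integral_h:
  assumes [measurable]: "f \<in> borel_measurable P"
  shows "(\<integral>\<^sup>+x. ennreal (h x) * f x \<partial>P) = ennreal (1 - \<epsilon>) * (\<integral>\<^sup>+x. f x \<partial>N)"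
proof -
  have "(\<integral>\<^sup>+x. ennreal (h x) * f x \<partial>P) = (\<integral>\<^sup>+x. f x \<partial>density P (\<lambda>x. ennreal (h x)))"
    by (rule nn_integral_density[symmetric]) auto
  also have "\<dots> = ennreal (1 - \<epsilon>) * (\<integral>\<^sup>+x. f x \<partial>N)"
    unfolding h_density by (subst nn_integral_scale_measure) (auto simp: measurable_N)
  finally show ?thesis .
qed

lemma integral_h:
  assumes [measurable]: "A \<in> sets P"
  shows "(\<integral>x. h x * indicator A x \<partial>P) = (1 - \<epsilon>) * measure N A"
proof -
  have "ennreal (\<integral>x. h x * indicator A x \<partial>P) = (\<integral>\<^sup>+x. ennreal (h x * indicator A x) \<partial>P)"
  proof (rule nn_integral_eq_integral[symmetric])
    show "integrable P (\<lambda>x. h x * indicator A x)"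
      by (rule P.integrable_const_bound[of _ 1])
         (auto simp: indicator_def h_nonneg h_le_1)
  qed (auto simp: h_nonneg)
  also have "\<dots> = (\<integral>\<^sup>+x. ennreal (h x) * indicator A x \<partial>P)"
    by (intro nn_integral_cong) (auto simp: indicator_def)
  also have "\<dots> = ennreal (1 - \<epsilon>) * emeasure N A"
    by (subst nn_integral_h) (auto simp: sets_N)
  also have "\<dots> = ennreal ((1 - \<epsilon>) * measure N A)"
    using eps by (simp add: N.emeasure_eq_measure ennreal_mult)
  finally show ?thesis using eps
    by (subst (asm) ennreal_inj) (auto intro!: integral_nonneg_AE simp: h_nonneg)
qed

lemma lin_distr:
  assumes "A \<in> sets borel"
  shows "measure N {x \<in> space P. lin z x \<in> A} = measure SN {g. nrm z * g \<in> A}"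
proof -
  have "measure N {x \<in> space P. lin z x \<in> A} = measure (distr N borel (lin z)) A"
    using assms by (subst measure_distr) (auto simp: measurable_N space_N intro!: arg_cong[where f = "measure N"])
  also have "distr N borel (lin z) = distr SN borel (\<lambda>g. nrm z * g)"
    unfolding lin_def[abs_def] by (rule Y_gauss)
  also have "measure \<dots> A = measure SN {g. nrm z * g \<in> A}"
    using assms by (subst measure_distr) (auto intro!: arg_cong[where f = "measure SN"])
  finally show ?thesis .
qed

lemma lin_band:
  assumes z: "1 / 2 \<le> nrm z" and r: "0 \<le> r"
  shows "measure N {x \<in> space P. \<bar>\<bar>lin z x\<bar> - a\<bar> \<le> r} \<le> 8 * r"
proof -
  interpret SN: prob_space SN by (rule prob_space_SN)
  define \<rho> where "\<rho> = nrm z"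
  have \<rho>: "1 / 2 \<le> \<rho>" using z by (simp add: \<rho>_def)
  let ?I = "{(a - r) / \<rho> .. (a + r) / \<rho>}" and ?J = "{- (a + r) / \<rho> .. - (a - r) / \<rho>}"
  have "measure N {x \<in> space P. lin z x \<in> {y. \<bar>\<bar>y\<bar> - a\<bar> \<le> r}} = measure SN {g. \<rho> * g \<in> {y. \<bar>\<bar>y\<bar> - a\<bar> \<le> r}}"
    unfolding \<rho>_def by (rule lin_distr) measurable
  also have "\<dots> \<le> measure SN (?I \<union> ?J)"
  proof (intro SN.finite_measure_mono subsetI)
    fix g assume "g \<in> {g. \<rho> * g \<in> {y. \<bar>\<bar>y\<bar> - a\<bar> \<le> r}}"
    hence "\<bar>\<bar>\<rho> * g\<bar> - a\<bar> \<le> r" by simp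
    hence "(a - r \<le> \<rho> * g \<and> \<rho> * g \<le> a + r) \<or> (- (a + r) \<le> \<rho> * g \<and> \<rho> * g \<le> - (a - r))" by linarith
    thus "g \<in> ?I \<union> ?J" using \<rho> by (auto simp: field_simps)
  qed auto
  also have "\<dots> \<le> measure SN ?I + measure SN ?J"
    by (rule measure_Un_le) auto
  also have "\<dots> \<le> ((a + r) / \<rho> - (a - r) / \<rho>) + (- (a - r) / \<rho> - (- (a + r) / \<rho>))"
    using \<rho> r by (intro add_mono SN_interval_le divide_right_mono) auto
  also have "\<dots> = 4 * r / \<rho>" by (simp add: add_divide_distrib diff_divide_distrib)
  also have "\<dots> \<le> 4 * r / (1 / 2)" using \<rho> r by (intro divide_left_mono) auto
  finally show ?thesis by simp
qed

lemma lin_tail: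
  assumes r: "0 < r"
  shows "measure N {x \<in> space P. r < \<bar>lin z x\<bar>} \<le> (nrm z)\<^sup>2 / r\<^sup>2"
proof -
  interpret SN: prob_space SN by (rule prob_space_SN)
  have "measure N {x \<in> space P. lin z x \<in> {y. r < \<bar>y\<bar>}} = measure SN {g. nrm z * g \<in> {y. r < \<bar>y\<bar>}}"
    by (rule lin_distr) measurable
  also have "\<dots> \<le> (nrm z)\<^sup>2 / r\<^sup>2"
  proof (cases "nrm z = 0")
    case True thus ?thesis using r by simp
  next
    case False
    hence n: "0 < nrm z" using L2_set_nonneg[of z "{..<d}"] by linarith
    have "measure SN {g. nrm z * g \<in> {y. r < \<bar>y\<bar>}} \<le> measure SN {g. r / nrm z \<le> \<bar>g\<bar>}"
      using n by (intro SN.finite_measure_mono subsetI) (auto simp: abs_mult field_simps)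
    also have "\<dots> \<le> 1 / (r / nrm z)\<^sup>2" using r n by (intro SN_chebyshev) auto
    finally show ?thesis by (simp add: power_divide)
  qed
  finally show ?thesis by simp
qed

lemma lin_half_normal_cdf:
  assumes "nrm z = 1" shows "measure N {x \<in> space P. \<bar>lin z x\<bar> \<le> a} = half_normal_cdf a"
  using lin_distr[of "{y. \<bar>y\<bar> \<le> a}" z] assms by (simp add: half_normal_cdf_def)

text \<open>
  The class of functions whose empirical averages are controlled uniformly: weighted indicators of slabs.
  A \<open>band\<close> is a weighted neighbourhood of the boundary of a slab.
\<close>

definition hit :: "real \<Rightarrow> (nat \<Rightarrow> real) \<Rightarrow> 'a \<Rightarrow> real" where
  "hit a z x = h x * of_bool (\<bar>lin z x\<bar> \<le> a)"

definition band :: "real \<Rightarrow> real \<Rightarrow> (nat \<Rightarrow> real) \<Rightarrow> 'a \<Rightarrow> real" where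
  "band a r z x = h x * of_bool (\<bar>\<bar>lin z x\<bar> - a\<bar> \<le> r)"

lemma hit_meas [measurable]: "hit a z \<in> borel_measurable P" 
  unfolding hit_def[abs_def] by measurable

lemma band_meas [measurable]: "band a r z \<in> borel_measurable P" 
  unfolding band_def[abs_def] by measurable

lemma hit_01: "0 \<le> hit a z x" "hit a z x \<le> 1"
  by (auto simp: hit_def h_nonneg h_le_1)

lemma band_01: "0 \<le> band a r z x" "band a r z x \<le> 1"
  by (auto simp: band_def h_nonneg h_le_1)

lemma integrable_01:
  fixes f :: "'a \<Rightarrow> real"
  assumes "f \<in> borel_measurable P" "\<And>x. \<bar>f x\<bar> \<le> 1" shows "integrable P f"
  by (rule P.integrable_const_bound[of _ 1]) (use assms in auto)

lemma integral_weighted: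
  assumes "{x \<in> space P. Q x} \<in> sets P"
  shows "(\<integral>x. h x * of_bool (Q x) \<partial>P) = (1 - \<epsilon>) * measure N {x \<in> space P. Q x}"
  unfolding integral_h[OF assms, symmetric] by (intro Bochner_Integration.integral_cong) (auto simp: indicator_def)

lemma integral_hit: "(\<integral>x. hit a z x \<partial>P) = (1 - \<epsilon>) * measure N {x \<in> space P. \<bar>lin z x\<bar> \<le> a}"
  unfolding hit_def by (rule integral_weighted) measurable

lemma integral_band_le:
  assumes "1 / 2 \<le> nrm z" "0 \<le> r"
  shows "(\<integral>x. band a r z x \<partial>P) \<le> 8 * r"
proof -
  have "(\<integral>x. band a r z x \<partial>P) = (1 - \<epsilon>) * measure N {x \<in> space P. \<bar>\<bar>lin z x\<bar> - a\<bar> \<le> r}"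
    unfolding band_def by (rule integral_weighted) measurable
  also have "\<dots> \<le> 1 * (8 * r)" using eps assms by (intro mult_mono lin_band) auto
  finally show ?thesis by simp
qed

text \<open>
  Two indicators can only differ at a point near the boundary of the second slab, or where the two linear
  forms are far apart.
\<close>

lemma hit_diff_le:
  "\<bar>hit a z x - hit a w x\<bar> \<le> band a r w x + h x * of_bool (r < \<bar>lin (\<lambda>j. z j - w j) x\<bar>)"
  using h_nonneg[of x] by (auto simp: hit_def band_def lin_diff of_bool_def)

text \<open>
  The first term uses the bounded density of a normal variable that is not nearly degenerate, the
  second one Chebyshev's inequality.
\<close>

lemma integral_hit_diff:
  assumes w: "1 / 2 \<le> nrm w" and r: "0 < r"
  shows "(\<integral>x. \<bar>hit a z x - hit a w x\<bar> \<partial>P) \<le> 8 * r + (nrm (\<lambda>j. z j - w j))\<^sup>2 / r\<^sup>2"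
proof -
  let ?t = "\<lambda>x. h x * of_bool (r < \<bar>lin (\<lambda>j. z j - w j) x\<bar>)"
  have i: "integrable P (band a r w)" "integrable P ?t"
    using band_01 h_nonneg h_le_1 by (auto intro!: integrable_01 simp: of_bool_def)
  have "(\<integral>x. \<bar>hit a z x - hit a w x\<bar> \<partial>P) \<le> (\<integral>x. band a r w x + ?t x \<partial>P)"
  proof (rule integral_mono)
    show "integrable P (\<lambda>x. \<bar>hit a z x - hit a w x\<bar>)"
      using hit_01 by (intro integrable_01) (auto simp: abs_le_iff, smt+)
  qed (use i hit_diff_le in auto)
  also have "\<dots> = (\<integral>x. band a r w x \<partial>P) + (\<integral>x. ?t x \<partial>P)" using i by simp
  also have "(\<integral>x. ?t x \<partial>P) = (1 - \<epsilon>) * measure N {x \<in> space P. r < \<bar>lin (\<lambda>j. z j - w j) x\<bar>}"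
    by (rule integral_weighted) measurable
  also have "\<dots> \<le> 1 * ((nrm (\<lambda>j. z j - w j))\<^sup>2 / r\<^sup>2)" using eps r by (intro mult_mono lin_tail) auto
  finally show ?thesis using integral_band_le[OF w, of r a] r by simp
qed

text \<open>
  Convexity of the exponential gives \<open>exp (h y) \<le> 1 + h exp y\<close> for \<open>0 \<le> h \<le> 1\<close>, which moves the weight out of
  the exponent and leaves a Gaussian exponential moment.
\<close>

lemma nn_integral_exp_lin:
  assumes "nrm z \<le> 3 / 2"
  shows "(\<integral>\<^sup>+x. ennreal (exp (h x * \<bar>lin z x\<bar>)) \<partial>P) \<le> ennreal (exp 4)"
proof -
  have "(\<integral>\<^sup>+x. ennreal (exp (h x * \<bar>lin z x\<bar>)) \<partial>P) \<le> (\<integral>\<^sup>+x. 1 + ennreal (h x) * ennreal (exp \<bar>lin z x\<bar>) \<partial>P)"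
  proof (rule nn_integral_mono)
    fix x
    have "exp ((1 - h x) *\<^sub>R 0 + h x *\<^sub>R \<bar>lin z x\<bar>) \<le> (1 - h x) * exp 0 + h x * exp \<bar>lin z x\<bar>"
      by (rule convex_onD[OF exp_convex]) (auto simp: h_nonneg h_le_1)
    hence "exp (h x * \<bar>lin z x\<bar>) \<le> 1 + h x * exp \<bar>lin z x\<bar>" using h_nonneg[of x] by simp
    hence "ennreal (exp (h x * \<bar>lin z x\<bar>)) \<le> ennreal (1 + h x * exp \<bar>lin z x\<bar>)" by (rule ennreal_leI)
    thus "ennreal (exp (h x * \<bar>lin z x\<bar>)) \<le> 1 + ennreal (h x) * ennreal (exp \<bar>lin z x\<bar>)"
      using h_nonneg[of x] by (simp add: ennreal_mult)
  qed
  also have "\<dots> = 1 + (\<integral>\<^sup>+x. ennreal (h x) * ennreal (exp \<bar>lin z x\<bar>) \<partial>P)"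
    by (subst nn_integral_add) (auto simp: P.emeasure_space_1)
  also have "(\<integral>\<^sup>+x. ennreal (h x) * ennreal (exp \<bar>lin z x\<bar>) \<partial>P) = ennreal (1 - \<epsilon>) * (\<integral>\<^sup>+x. ennreal (exp \<bar>lin z x\<bar>) \<partial>N)"
    by (rule nn_integral_h) measurable
  also have "(\<integral>\<^sup>+x. ennreal (exp \<bar>lin z x\<bar>) \<partial>N) = (\<integral>\<^sup>+y. ennreal (exp \<bar>y\<bar>) \<partial>distr N borel (lin z))"
    by (subst nn_integral_distr) (auto simp: measurable_N)
  also have "distr N borel (lin z) = distr SN borel (\<lambda>g. nrm z * g)"
    unfolding lin_def[abs_def] by (rule Y_gauss)
  also have "(\<integral>\<^sup>+y. ennreal (exp \<bar>y\<bar>) \<partial>distr SN borel (\<lambda>g. nrm z * g)) = (\<integral>\<^sup>+g. ennreal (exp \<bar>nrm z * g\<bar>) \<partial>SN)"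
    by (subst nn_integral_distr) auto
  also have "1 + ennreal (1 - \<epsilon>) * \<dots> \<le> 1 + 1 * ennreal (2 * exp ((nrm z)\<^sup>2 / 2))"
    using eps by (intro add_left_mono mult_mono SN_exp_abs) auto
  also have "\<dots> = ennreal (1 + 2 * exp ((nrm z)\<^sup>2 / 2))" by simp
  also have "\<dots> \<le> ennreal (exp 4)"
  proof (rule ennreal_leI)
    have "(nrm z)\<^sup>2 \<le> (3 / 2)\<^sup>2" using assms by (intro power_mono) auto
    hence "exp ((nrm z)\<^sup>2 / 2) \<le> exp 2" by (simp add: power2_eq_square)
    moreover have "(1::real) \<le> exp 2" by simp
    ultimately have "1 + 2 * exp ((nrm z)\<^sup>2 / 2) \<le> 3 * exp 2" by linarith
    also have "\<dots> \<le> exp 2 * exp (2::real)" 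
      using exp_ge_add_one_self[of 2] by (intro mult_right_mono) auto
    also have "\<dots> = exp 4" by (simp add: exp_add[symmetric])
    finally show "1 + 2 * exp ((nrm z)\<^sup>2 / 2) \<le> exp 4" .
  qed
  finally show ?thesis .
qed

text \<open>
  Rounding down to multiples of this spacing moves a vector by at most \<open>1 / (2 * 8 ^ k)\<close> in Euclidean norm.
\<close>

definition spacing :: "nat \<Rightarrow> real" where "spacing k = 1 / (2 * sqrt d * 8 ^ k)"

definition net :: "nat \<Rightarrow> (nat \<Rightarrow> real) set" where
  "net k = (\<lambda>m j. spacing k * real_of_int (m j)) ` lattice_ball d (3 * 8 ^ k * d)"

lemma net_card: "finite (net k)" "real (card (net k)) \<le> exp (4 * real d * (real k + 1))"
proof -
  have p: "0 < (3::nat) * 8 ^ k" by simp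
  note L = lattice_ball_card[OF p, of d]
  show "finite (net k)" unfolding net_def using L(1) by simp
  have "real (card (net k)) \<le> real (card (lattice_ball d (3 * 8 ^ k * d)))"
    unfolding net_def using L(1) by (intro of_nat_mono card_image_le)
  also have "\<dots> \<le> (exp 1 * (1 + 2 * real (3 * 8 ^ k))) ^ d" by (rule L(2))
  also have "\<dots> \<le> (exp (4 * (real k + 1))) ^ d"
  proof (rule power_mono)
    have "1 + 2 * real (3 * 8 ^ k) \<le> 8 ^ (k + 1)" 
    proof -
      have a: "1 \<le> (8::real) ^ k" and b: "real (3 * 8 ^ k) = 3 * 8 ^ k" by simp_all
      show ?thesis unfolding b power_add power_one_right using a by linarith
    qed
    also have "\<dots> = 2 ^ (3 * (k + 1))" unfolding power_mult by simp
    also have "\<dots> \<le> exp 1 ^ (3 * (k + 1))" 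
      using exp_ge_add_one_self[of 1] by (intro power_mono) auto
    also have "\<dots> = exp (3 * (real k + 1))" by (simp add: exp_of_nat_mult[symmetric] algebra_simps)
    finally have "exp 1 * (1 + 2 * real (3 * 8 ^ k)) \<le> exp 1 * exp (3 * (real k + 1))" by simp
    also have "\<dots> \<le> exp (4 * (real k + 1))" by (simp add: exp_add[symmetric])
    finally show "exp 1 * (1 + 2 * real (3 * 8 ^ k)) \<le> exp (4 * (real k + 1))" .
  qed auto
  also have "\<dots> = exp (4 * real d * (real k + 1))"
    by (simp add: exp_of_nat_mult[symmetric] algebra_simps)
  finally show "real (card (net k)) \<le> exp (4 * real d * (real k + 1))" .
qed

lemma net_approx:
  assumes c: "nrm c \<le> 1" and d: "0 < d"
  shows "\<exists>z\<in>net k. nrm (\<lambda>j. c j - z j) \<le> 1 / (2 * 8 ^ k)"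
proof -
  define sp where "sp = spacing k"
  have sp: "0 < sp" using d by (simp add: sp_def spacing_def)
  define m where "m = (\<lambda>j\<in>{..<d}. \<lfloor>c j / sp\<rfloor>)"
  have fl: "\<bar>c j / sp - real_of_int \<lfloor>c j / sp\<rfloor>\<bar> \<le> 1" for j by linarith
  have sqd: "sqrt (real d) * sqrt (real d) = real d" by simp
  have "(\<Sum>j<d. \<bar>c j\<bar> * \<bar>1\<bar>) \<le> nrm c * L2_set (\<lambda>_. 1) {..<d}"
    by (rule L2_set_mult_ineq)
  also have "\<dots> \<le> 1 * sqrt d" using c by (intro mult_mono) (auto simp: L2_set_def sum_nonneg)
  finally have c1: "(\<Sum>j<d. \<bar>c j\<bar>) \<le> sqrt d" by simp
  have "real_of_int (\<Sum>j<d. \<bar>m j\<bar>) \<le> (\<Sum>j<d. \<bar>c j\<bar> / sp + 1)"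
    unfolding of_int_sum
  proof (rule sum_mono)
    fix j assume "j \<in> {..<d}"
    hence "real_of_int \<bar>m j\<bar> = \<bar>real_of_int \<lfloor>c j / sp\<rfloor>\<bar>" by (simp add: m_def)
    also have "\<dots> \<le> \<bar>c j / sp\<bar> + 1" using fl[of j] by linarith
    finally show "real_of_int \<bar>m j\<bar> \<le> \<bar>c j\<bar> / sp + 1" using sp by simp
  qed
  also have "\<dots> = (\<Sum>j<d. \<bar>c j\<bar>) / sp + d" by (simp add: sum.distrib sum_divide_distrib)
  also have "\<dots> \<le> sqrt d / sp + d" using c1 sp by (intro add_mono divide_right_mono) auto
  also have "sqrt d / sp = 2 * 8 ^ k * real d"
    by (simp add: sp_def spacing_def field_simps)
  also have "2 * 8 ^ k * real d + d \<le> 3 * 8 ^ k * real d"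
    using one_le_power[of "8::real" k] mult_right_mono[of 1 "8 ^ k" "real d"] by (simp add: mult.commute)
  finally have "real_of_int (\<Sum>j<d. \<bar>m j\<bar>) \<le> real_of_int (int (3 * 8 ^ k * d))" by simp
  hence "(\<Sum>j<d. \<bar>m j\<bar>) \<le> int (3 * 8 ^ k * d)" by (simp only: of_int_le_iff)
  hence mem: "m \<in> lattice_ball d (3 * 8 ^ k * d)" by (simp add: lattice_ball_def m_def)
  define z where "z = (\<lambda>j. sp * real_of_int (m j))"
  have "z \<in> net k" unfolding net_def z_def sp_def using mem by blast
  moreover have "nrm (\<lambda>j. c j - z j) \<le> L2_set (\<lambda>_. sp) {..<d}"
    unfolding L2_set_def
  proof (intro real_sqrt_le_mono sum_mono)
    fix j assume "j \<in> {..<d}"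
    hence "c j - z j = sp * (c j / sp - real_of_int \<lfloor>c j / sp\<rfloor>)" using sp by (simp add: z_def m_def field_simps)
    hence "\<bar>c j - z j\<bar> = sp * \<bar>c j / sp - real_of_int \<lfloor>c j / sp\<rfloor>\<bar>" using sp by (simp add: abs_mult)
    also have "\<dots> \<le> sp * 1" using sp fl[of j] by (intro mult_left_mono) auto
    finally have "\<bar>c j - z j\<bar> \<le> \<bar>sp\<bar>" using sp by simp
    thus "(c j - z j)\<^sup>2 \<le> sp\<^sup>2" by (simp add: abs_le_square_iff)
  qed
  moreover have "L2_set (\<lambda>_. sp) {..<d} = 1 / (2 * 8 ^ k)"
    using sp d by (simp add: L2_set_def real_sqrt_mult sp_def spacing_def)
  ultimately show ?thesis by auto
qed

text \<open>
  The average of \<open>h \<bar>c \<cdot> Y\<bar>\<close> is a seminorm in \<open>c\<close>.  Its supremum \<open>S\<close> over the unit ball exceeds the maximum over a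
  net of mesh \<open>1/2\<close> by at most \<open>S / 2\<close>, so a union bound over that net suffices.
\<close>

lemma uniform_abs_moment:
  assumes d: "0 < d" and n: "0 < n" and H: "0 \<le> H" and dn: "real d + H \<le> real n"
  shows "\<exists>B\<in>sets (\<Pi>\<^sub>M i\<in>{..<n}. P). measure (\<Pi>\<^sub>M i\<in>{..<n}. P) B \<le> exp (- H) \<and>
    (\<forall>X\<in>space (\<Pi>\<^sub>M i\<in>{..<n}. P) - B. \<forall>c. (\<Sum>i<n. h (X i) * \<bar>lin c (X i)\<bar>) / real n \<le> 34 * nrm c)"
proof -
  let ?PP = "\<Pi>\<^sub>M i\<in>{..<n}. P"
  interpret fp: finite_product_prob_space "\<lambda>_::nat. P" "{..<n}" by unfold_locales auto
  define T where "T = 13 * (real d + H)"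
  define Z where "Z = {z \<in> net 0. nrm z \<le> 3 / 2}"
  have Z: "finite Z" "real (card Z) \<le> exp (4 * real d)"
  proof -
    show "finite Z" using net_card(1) by (simp add: Z_def)
    have "real (card Z) \<le> real (card (net 0))" unfolding Z_def by (intro of_nat_mono card_mono net_card) auto
    thus "real (card Z) \<le> exp (4 * real d)" using net_card(2)[of 0] by simp
  qed
  define b where "b z = {X \<in> space ?PP. real n * 4 + T \<le> (\<Sum>i<n. h (X i) * \<bar>lin z (X i)\<bar>)}" for z
  have b_sets: "b z \<in> sets ?PP" for z unfolding b_def by measurable
  have bm: "measure ?PP (b z) \<le> exp (- T)" if "z \<in> Z" for z
    unfolding b_def using that nn_integral_exp_lin[of z]
    by (intro iid_exponential_markov prob_P) (auto simp: Z_def)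
  show ?thesis
  proof (intro bexI[of _ "\<Union>z\<in>Z. b z"] conjI ballI allI)
    show "(\<Union>z\<in>Z. b z) \<in> sets ?PP" using Z b_sets by auto
    have "measure ?PP (\<Union>z\<in>Z. b z) \<le> (\<Sum>z\<in>Z. measure ?PP (b z))"
      using Z b_sets by (intro fp.finite_measure_subadditive_finite) auto
    also have "\<dots> \<le> (\<Sum>z\<in>Z. exp (- T))" by (intro sum_mono bm)
    also have "\<dots> = real (card Z) * exp (- T)" by simp
    also have "\<dots> \<le> exp (4 * real d) * exp (- T)" using Z by (intro mult_right_mono) auto
    also have "\<dots> = exp (4 * real d - T)" by (simp add: exp_add[symmetric])
    also have "\<dots> \<le> exp (- H)" using H by (simp add: T_def)
    finally show "measure ?PP (\<Union>z\<in>Z. b z) \<le> exp (- H)" .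
  next
    fix X c assume X: "X \<in> space ?PP - (\<Union>z\<in>Z. b z)"
    define W where "W c = (\<Sum>i<n. h (X i) * \<bar>lin c (X i)\<bar>) / real n" for c
    have WZ: "W z \<le> 17" if "z \<in> Z" for z
    proof -
      have "(\<Sum>i<n. h (X i) * \<bar>lin z (X i)\<bar>) < real n * 4 + T" using X that by (auto simp: b_def)
      also have "\<dots> \<le> real n * 17" using dn by (simp add: T_def)
      finally show ?thesis using n by (simp add: W_def field_simps)
    qed
    have Wadd: "W (\<lambda>j. u j + v j) \<le> W u + W v" for u v
    proof -
      have "(\<Sum>i<n. h (X i) * \<bar>lin (\<lambda>j. u j + v j) (X i)\<bar>)
        \<le> (\<Sum>i<n. h (X i) * \<bar>lin u (X i)\<bar> + h (X i) * \<bar>lin v (X i)\<bar>)"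
        unfolding lin_add distrib_left[symmetric]
        by (intro sum_mono mult_left_mono h_nonneg abs_triangle_ineq)
      thus ?thesis unfolding W_def sum.distrib add_divide_distrib[symmetric]
        by (rule divide_right_mono) simp
    qed
    have Wsc: "W (\<lambda>j. t * u j) = \<bar>t\<bar> * W u" for t u
      by (simp add: W_def lin_scale abs_mult sum_distrib_left mult.left_commute sum_divide_distrib)
    define Cb where "Cb = {c. nrm c \<le> 1}"
    have ne: "Cb \<noteq> {}" by (auto simp: Cb_def L2_set_def intro!: exI[of _ "\<lambda>_. 0"])
    have bdd: "bdd_above (W ` Cb)"
    proof (rule bdd_aboveI2)
      fix c assume c: "c \<in> Cb"
      show "W c \<le> (\<Sum>i<n. h (X i) * (\<Sum>j<d. \<bar>Y j (X i)\<bar>)) / real n"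
        unfolding W_def
      proof (intro divide_right_mono sum_mono mult_left_mono h_nonneg)
        fix i
        have "\<bar>lin c (X i)\<bar> \<le> (\<Sum>j<d. \<bar>c j * Y j (X i)\<bar>)" unfolding lin_def by (rule sum_abs)
        also have "\<dots> \<le> (\<Sum>j<d. \<bar>Y j (X i)\<bar>)"
        proof (rule sum_mono)
          fix j assume "j \<in> {..<d}"
          hence "(c j)\<^sup>2 \<le> (\<Sum>j<d. (c j)\<^sup>2)" by (intro member_le_sum) auto
          hence "sqrt ((c j)\<^sup>2) \<le> nrm c" unfolding L2_set_def by (rule real_sqrt_le_mono)
          hence "\<bar>c j\<bar> \<le> 1" using c by (simp add: Cb_def)
          hence "\<bar>c j\<bar> * \<bar>Y j (X i)\<bar> \<le> 1 * \<bar>Y j (X i)\<bar>" by (intro mult_right_mono) auto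
          thus "\<bar>c j * Y j (X i)\<bar> \<le> \<bar>Y j (X i)\<bar>" by (simp add: abs_mult)
        qed
        finally show "\<bar>lin c (X i)\<bar> \<le> (\<Sum>j<d. \<bar>Y j (X i)\<bar>)" .
      qed simp
    qed
    \<comment> \<open>\<open>S\<close> is finite because the average is bounded on the ball by a sum over the coordinates.\<close>
    define S where "S = (SUP c\<in>Cb. W c)"
    have step: "W c \<le> 17 + S / 2" if c: "c \<in> Cb" for c
    proof -
      obtain z where z: "z \<in> net 0" "nrm (\<lambda>j. c j - z j) \<le> 1 / 2"
        using net_approx[of c 0] c d by (auto simp: Cb_def)
      let ?u = "\<lambda>j. c j - z j"
      have "nrm z = nrm (\<lambda>j. c j + (- 1) * ?u j)" by simp
      also have "\<dots> \<le> nrm c + nrm (\<lambda>j. (- 1) * ?u j)" by (rule L2_set_triangle_ineq)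
      also have "nrm (\<lambda>j. (- 1) * ?u j) = nrm ?u" by (simp add: L2_set_def power2_commute)
      finally have zZ: "z \<in> Z" using z c by (simp add: Z_def Cb_def)
      have nn: "nrm (\<lambda>j. 2 * ?u j) = 2 * nrm ?u" by (rule L2_set_right_distrib[symmetric]) simp
      hence "(\<lambda>j. 2 * ?u j) \<in> Cb" using z by (simp add: Cb_def)
      hence "W (\<lambda>j. 2 * ?u j) \<le> S" unfolding S_def by (intro cSUP_upper bdd)
      hence "W ?u \<le> S / 2" unfolding Wsc by simp
      moreover have "W c \<le> W z + W ?u" using Wadd[of z ?u] by simp
      ultimately show ?thesis using WZ[OF zZ] by linarith
    qed
    have "S \<le> 17 + S / 2" unfolding S_def by (rule cSUP_least[OF ne]) (use step S_def in auto)
    hence S34: "S \<le> 34" by simp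
    have "W c \<le> 34 * nrm c"
    proof (cases "nrm c = 0")
      case True
      hence "c j = 0" if "j < d" for j using that by (simp add: L2_set_eq_0_iff)
      hence "lin c x = 0" for x by (simp add: lin_def)
      thus ?thesis using True by (simp add: W_def)
    next
      case False
      hence p: "0 < nrm c" using L2_set_nonneg[of c "{..<d}"] by linarith
      define u where "u = (\<lambda>j. (1 / nrm c) * c j)"
      have "nrm u = (1 / nrm c) * nrm c" unfolding u_def using p by (intro L2_set_right_distrib[symmetric]) simp
      hence "u \<in> Cb" using p by (simp add: Cb_def)
      hence "W u \<le> 34" using cSUP_upper[OF _ bdd, of u] S34 by (simp add: S_def)
      moreover have "W u = W c / nrm c" unfolding u_def Wsc using p by simp
      ultimately show ?thesis using p by (simp add: field_simps)
    qed
    thus "(\<Sum>i<n. h (X i) * \<bar>lin c (X i)\<bar>) / real n \<le> 34 * nrm c" by (simp add: W_def)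
  qed
qed

text \<open>
  On scale \<open>k\<close> the exponent grows linearly in \<open>k\<close>, fast enough to pay for the number of pairs of net points and
  to leave a geometric series over the scales.
\<close>

lemma union_bound_level:
  assumes d: "0 < d" and H: "0 \<le> H" and C: "C \<le> exp (12 * real d * (real k + 1))"
  shows "2 * C * exp (- (13 * (real k + 1) * (real d + H))) \<le> 2 * exp (- H) * (1 / 2) ^ (k + 1)"
proof -
  have "C * exp (- (13 * (real k + 1) * (real d + H)))
     \<le> exp (12 * real d * (real k + 1)) * exp (- (13 * (real k + 1) * (real d + H)))"
    using C by (intro mult_right_mono) auto
  also have "\<dots> = exp (12 * real d * (real k + 1) - 13 * (real k + 1) * (real d + H))"
    by (simp add: exp_add[symmetric])
  also have "\<dots> \<le> exp (- H - (real k + 1))"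
  proof -
    have "(real k + 1) * 1 \<le> (real k + 1) * real d" using d by (intro mult_left_mono) auto
    moreover have "1 * H \<le> (13 * (real k + 1)) * H" using H by (intro mult_right_mono) auto
    ultimately show ?thesis by (simp add: algebra_simps)
  qed
  also have "\<dots> = exp (- H) * exp (- 1) ^ (k + 1)"
    by (simp add: exp_of_nat_mult[symmetric] exp_add[symmetric] algebra_simps del: power_Suc)
  also have "\<dots> \<le> exp (- H) * (1 / 2) ^ (k + 1)"
  proof (intro mult_left_mono power_mono)
    have "2 \<le> exp (1::real)" using exp_ge_add_one_self[of 1] by simp
    thus "exp (- 1) \<le> (1 / 2 :: real)" by (simp add: exp_minus field_simps)
  qed auto
  finally show ?thesis by simp
qed

text \<open>
  Chaining.  Write \<open>e\<^sup>2 = (d + H) / n\<close>.  On scale \<open>k\<close> the increments have second moment of order \<open>4^-k\<close>; with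
  the exponent \<open>lam = e 2^k\<close> the deviation of all increments is of order \<open>e (k + 1) 2^-k\<close>, which is summable.
  The condition \<open>lam \<le> 1\<close> stops the chain at the scale \<open>K\<close> with \<open>2^-K\<close> of order \<open>e\<close>.  There the boundary bands
  have probability of order \<open>4^-K\<close>, hence of order \<open>e\<^sup>2\<close>, and the fraction of the sample on which a unit
  vector and its net point differ by more than \<open>4^-K\<close> is, by Markov's inequality and
  \<open>uniform_abs_moment\<close>, of order \<open>8^-K / 4^-K = 2^-K\<close>, hence of order \<open>e\<close>.
\<close>

theorem uniform_hit_deviation:
  assumes d: "0 < d" and n: "0 < n" and H: "0 \<le> H" and dn: "real d + H \<le> real n"
  shows "\<exists>B\<in>sets (\<Pi>\<^sub>M i\<in>{..<n}. P). measure (\<Pi>\<^sub>M i\<in>{..<n}. P) B \<le> 5 * exp (- H) \<and>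
    (\<forall>X\<in>space (\<Pi>\<^sub>M i\<in>{..<n}. P) - B. \<forall>c. nrm c = 1 \<longrightarrow>
      \<bar>(\<Sum>i<n. h (X i) * of_bool (\<bar>lin c (X i)\<bar> \<le> a)) / real n - (1 - \<epsilon>) * half_normal_cdf a\<bar>
        \<le> 225 * sqrt ((real d + H) / real n))"
proof -
  let ?PP = "\<Pi>\<^sub>M i\<in>{..<n}. P"
  interpret fp: finite_product_prob_space "\<lambda>_::nat. P" "{..<n}" by unfold_locales auto
  define e where "e = sqrt ((real d + H) / real n)"
  have dH: "0 < real d + H" using d H by simp
  have e: "0 < e" "e \<le> 1" using dH n dn by (auto simp: e_def)
  have e2: "(real d + H) / real n = e * e" using dH n by (simp add: e_def)
  have scale: "x * (real d + H) / (real n * (e * y)) = x * e / y" for x y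
  proof -
    have "x * (real d + H) / (real n * (e * y)) = x * ((real d + H) / real n) / (e * y)" by simp
    thus ?thesis unfolding e2 using e by simp
  qed
  obtain K where K: "e * 2 ^ K \<le> 1" "1 < e * 2 ^ (K + 1)"
  proof -
    obtain m where m: "1 / e < 2 ^ m" using real_arch_pow[of 2 "1 / e"] by auto
    define m0 where "m0 = (LEAST m. 1 < e * 2 ^ m)"
    have ex: "1 < e * 2 ^ m" using m e by (simp add: field_simps)
    have a: "1 < e * 2 ^ m0" unfolding m0_def by (rule LeastI[of _ m]) (rule ex)
    have "m0 \<noteq> 0" using a e by (cases "m0 = 0") auto
    then obtain K where mK: "m0 = K + 1" by (metis Suc_eq_plus1 not0_implies_Suc)
    have "\<not> 1 < e * 2 ^ K" using not_less_Least[of K "\<lambda>m. 1 < e * 2 ^ m"] mK by (simp add: m0_def)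
    thus ?thesis using that[of K] a mK by simp
  qed
  have lam: "0 < e * 2 ^ k" "e * 2 ^ k \<le> 1" if "k \<le> K" for k
  proof -
    show "0 < e * 2 ^ k" using e by simp
    have "e * 2 ^ k \<le> e * 2 ^ K" using that e by (intro mult_left_mono power_increasing) auto
    thus "e * 2 ^ k \<le> 1" using K by simp
  qed
  have inv2K: "1 / 2 ^ K \<le> 2 * e" using K(2) by (simp add: field_simps)
  have inv4K: "1 / 4 ^ K \<le> 4 * e"
  proof -
    have "1 / 4 ^ K = (1 / 2 ^ K) * (1 / 2 ^ K :: real)" by (simp add: power_mult_distrib[symmetric])
    also have "\<dots> \<le> (2 * e) * (2 * e)" using inv2K e by (intro mult_mono) auto
    also have "\<dots> \<le> 4 * e" using e mult_left_le[of e e] by simp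
    finally show ?thesis .
  qed
  let ?T = "\<lambda>k. 13 * (real k + 1) * (real d + H)"
  let ?dev = "\<lambda>f X. (\<Sum>i<n. f (X i)) / real n - (\<integral>x. f x \<partial>P)"
  \<comment> \<open>On the coarsest net no smallness of the variance is available.\<close>
  obtain B0 where B0: "B0 \<in> sets ?PP" "measure ?PP B0 \<le> 2 * real (card (net 0)) * exp (- ?T 0)"
    "\<And>X z. X \<in> space ?PP - B0 \<Longrightarrow> z \<in> net 0 \<Longrightarrow> \<bar>?dev (hit a z) X\<bar> \<le> (e * 2 ^ 0) * 1 + ?T 0 / (real n * (e * 2 ^ 0))"
  proof -
    have "\<exists>B\<in>sets ?PP. measure ?PP B \<le> 2 * real (card (net 0)) * exp (- ?T 0) \<and>
      (\<forall>X\<in>space ?PP - B. \<forall>z\<in>net 0. \<bar>?dev (hit a z) X\<bar> \<le> (e * 2 ^ 0) * 1 + ?T 0 / (real n * (e * 2 ^ 0)))"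
    proof (rule iid_chernoff_finite[OF prob_P net_card(1) n])
      fix z
      have "(\<integral>x. (hit a z x)\<^sup>2 \<partial>P) \<le> (\<integral>x. 1 \<partial>P)"
        using hit_01[of a z] by (intro integral_mono integrable_01) (auto simp: abs_square_le_1 power_le_one)
      thus "(\<integral>x. (hit a z x)\<^sup>2 \<partial>P) \<le> 1" by (simp add: P.prob_space)
    qed (use lam[of 0] hit_01 in auto)
    thus ?thesis using that by blast
  qed
  have B0': "measure ?PP B0 \<le> exp (- H)"
  proof -
    have "real (card (net 0)) \<le> exp (12 * real d * (real 0 + 1))"
      using order.trans[OF net_card(2)[of 0], of "exp (12 * real d * (real 0 + 1))"] by simp
    from union_bound_level[OF d H this] B0(2) show ?thesis by simp
  qed
  \<comment> \<open>The condition \<open>1/2 \<le> nrm w\<close> keeps the normal density of \<open>lin w\<close> bounded.\<close>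
  define pairs where "pairs k = {(z, w) \<in> net k \<times> net (k + 1). 1 / 2 \<le> nrm w \<and> nrm (\<lambda>j. z j - w j) \<le> 1 / 8 ^ k}" for k
  have pairs: "finite (pairs k)" "real (card (pairs k)) \<le> exp (12 * real d * (real k + 1))" for k
  proof -
    have sub: "pairs k \<subseteq> net k \<times> net (k + 1)" by (auto simp: pairs_def)
    have fin: "finite (net k \<times> net (k + 1))" using net_card by auto
    show "finite (pairs k)" using sub fin by (rule finite_subset)
    have "real (card (pairs k)) \<le> real (card (net k)) * real (card (net (k + 1)))"
      using card_mono[OF fin sub] by (simp add: card_cartesian_product flip: of_nat_mult)
    also have "\<dots> \<le> exp (4 * real d * (real k + 1)) * exp (4 * real d * (real (k + 1) + 1))"
      by (intro mult_mono net_card) auto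
    also have "\<dots> \<le> exp (12 * real d * (real k + 1))"
      by (simp add: exp_add[symmetric] algebra_simps)
    finally show "real (card (pairs k)) \<le> exp (12 * real d * (real k + 1))" .
  qed
  have links: "\<exists>B\<in>sets ?PP. measure ?PP B \<le> 2 * real (card (pairs k)) * exp (- ?T k) \<and>
      (\<forall>X\<in>space ?PP - B. \<forall>zw\<in>pairs k. \<bar>?dev (\<lambda>x. hit a (fst zw) x - hit a (snd zw) x) X\<bar>
         \<le> (e * 2 ^ k) * (9 / 4 ^ k) + ?T k / (real n * (e * 2 ^ k)))" if k: "k \<le> K" for k
  proof (rule iid_chernoff_finite[OF prob_P pairs(1) n])
    fix zw assume zw: "zw \<in> pairs k"
    obtain z w where zw': "zw = (z, w)" by (cases zw)
    have le1: "\<bar>hit a z x - hit a w x\<bar> \<le> 1" for x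
      using hit_01[of a z x] hit_01[of a w x] by linarith
    have "(\<integral>x. (hit a z x - hit a w x)\<^sup>2 \<partial>P) \<le> (\<integral>x. \<bar>hit a z x - hit a w x\<bar> \<partial>P)"
    proof (intro integral_mono integrable_01)
      fix x
      have "\<bar>hit a z x - hit a w x\<bar> * \<bar>hit a z x - hit a w x\<bar> \<le> \<bar>hit a z x - hit a w x\<bar> * 1"
        using le1 by (intro mult_left_mono) auto
      thus "(hit a z x - hit a w x)\<^sup>2 \<le> \<bar>hit a z x - hit a w x\<bar>"
        by (simp add: power2_eq_square)
    qed (use le1 in \<open>auto simp: abs_square_le_1\<close>)
    also have "\<dots> \<le> 8 * (1 / 4 ^ k) + (nrm (\<lambda>j. z j - w j))\<^sup>2 / (1 / 4 ^ k)\<^sup>2"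
      using zw zw' by (intro integral_hit_diff) (auto simp: pairs_def)
    also have "\<dots> \<le> 8 * (1 / 4 ^ k) + (1 / 8 ^ k)\<^sup>2 / (1 / 4 ^ k)\<^sup>2"
      using zw zw' by (intro add_left_mono divide_right_mono power_mono) (auto simp: pairs_def L2_set_nonneg)
    also have "(1 / 8 ^ k)\<^sup>2 / (1 / 4 ^ k)\<^sup>2 = (1 / 4 ^ k :: real)" by (rule power_8_4)
    finally show "(\<integral>x. (hit a (fst zw) x - hit a (snd zw) x)\<^sup>2 \<partial>P) \<le> 9 / 4 ^ k"
      by (simp add: zw')
    show "\<bar>hit a (fst zw) x - hit a (snd zw) x\<bar> \<le> 1" for x using le1 by (simp add: zw')
  qed (use lam[OF k] in auto)
  have "\<forall>k. \<exists>B. k \<le> K \<longrightarrow> B \<in> sets ?PP \<and> measure ?PP B \<le> 2 * real (card (pairs k)) * exp (- ?T k) \<and>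
      (\<forall>X\<in>space ?PP - B. \<forall>zw\<in>pairs k. \<bar>?dev (\<lambda>x. hit a (fst zw) x - hit a (snd zw) x) X\<bar>
         \<le> (e * 2 ^ k) * (9 / 4 ^ k) + ?T k / (real n * (e * 2 ^ k)))"
    using links by blast
  from choice[OF this] obtain Bk where Bk0: "\<forall>k. k \<le> K \<longrightarrow> Bk k \<in> sets ?PP \<and> 
      measure ?PP (Bk k) \<le> 2 * real (card (pairs k)) * exp (- ?T k) \<and>
      (\<forall>X\<in>space ?PP - Bk k. \<forall>zw\<in>pairs k. \<bar>?dev (\<lambda>x. hit a (fst zw) x - hit a (snd zw) x) X\<bar>
         \<le> (e * 2 ^ k) * (9 / 4 ^ k) + ?T k / (real n * (e * 2 ^ k)))" ..
  have Bk: "\<And>k. k \<le> K \<Longrightarrow> Bk k \<in> sets ?PP"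
    "\<And>k. k \<le> K \<Longrightarrow> measure ?PP (Bk k) \<le> 2 * real (card (pairs k)) * exp (- ?T k)"
    "\<And>k X z w. k \<le> K \<Longrightarrow> X \<in> space ?PP - Bk k \<Longrightarrow> (z, w) \<in> pairs k \<Longrightarrow>
       \<bar>?dev (\<lambda>x. hit a z x - hit a w x) X\<bar> \<le> (e * 2 ^ k) * (9 / 4 ^ k) + ?T k / (real n * (e * 2 ^ k))"
  proof -
    fix k assume k: "k \<le> K"
    show "Bk k \<in> sets ?PP" "measure ?PP (Bk k) \<le> 2 * real (card (pairs k)) * exp (- ?T k)"
      using Bk0 k by blast+
    fix X z w assume X: "X \<in> space ?PP - Bk k" and zw: "(z, w) \<in> pairs k"
    from Bk0 k X have "\<forall>zw\<in>pairs k. \<bar>?dev (\<lambda>x. hit a (fst zw) x - hit a (snd zw) x) X\<bar>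
         \<le> (e * 2 ^ k) * (9 / 4 ^ k) + ?T k / (real n * (e * 2 ^ k))" by blast
    from bspec[OF this zw] show "\<bar>?dev (\<lambda>x. hit a z x - hit a w x) X\<bar>
        \<le> (e * 2 ^ k) * (9 / 4 ^ k) + ?T k / (real n * (e * 2 ^ k))" by simp
  qed
  have Bk': "measure ?PP (\<Union>k<K. Bk k) \<le> 2 * exp (- H)"
  proof -
    have "measure ?PP (\<Union>k<K. Bk k) \<le> (\<Sum>k<K. measure ?PP (Bk k))"
      using Bk(1) by (intro fp.finite_measure_subadditive_finite) auto
    also have "\<dots> \<le> (\<Sum>k<K. 2 * exp (- H) * (1 / 2) ^ (k + 1))"
    proof (rule sum_mono)
      fix k assume "k \<in> {..<K}"
      thus "measure ?PP (Bk k) \<le> 2 * exp (- H) * (1 / 2) ^ (k + 1)"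
        using Bk(2)[of k] union_bound_level[OF d H pairs(2), of k] by simp
    qed
    also have "\<dots> = 2 * exp (- H) * (\<Sum>k<K. (1 / 2) ^ (k + 1))"
      by (simp add: sum_distrib_left)
    also have "(\<Sum>k<K. (1 / 2) ^ (k + 1)) = 1 - (1 / 2 :: real) ^ K"
      by (induction K) auto
    also have "2 * exp (- H) * (1 - (1 / 2) ^ K) \<le> 2 * exp (- H) * 1"
      by (intro mult_left_mono) auto
    finally show ?thesis by simp
  qed
  \<comment> \<open>Empirical mass of the boundary bands, for passing from net points to arbitrary directions.\<close>
  define fnet where "fnet = {z \<in> net K. 1 / 2 \<le> nrm z}"
  have fnet: "finite fnet" "real (card fnet) \<le> exp (12 * real d * (real K + 1))"
  proof -
    show "finite fnet" using net_card by (simp add: fnet_def)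
    have "real (card fnet) \<le> real (card (net K))" 
      unfolding fnet_def using net_card by (intro of_nat_mono card_mono) auto
    also have "\<dots> \<le> exp (4 * real d * (real K + 1))" by (rule net_card)
    also have "\<dots> \<le> exp (12 * real d * (real K + 1))" by simp
    finally show "real (card fnet) \<le> exp (12 * real d * (real K + 1))" .
  qed
  obtain Bb where Bb: "Bb \<in> sets ?PP" "measure ?PP Bb \<le> 2 * real (card fnet) * exp (- ?T K)"
    "\<And>X z. X \<in> space ?PP - Bb \<Longrightarrow> z \<in> fnet \<Longrightarrow>
      \<bar>?dev (band a (1 / 4 ^ K) z) X\<bar> \<le> (e * 2 ^ K) * (8 * (1 / 4 ^ K)) + ?T K / (real n * (e * 2 ^ K))"
  proof -
    have "\<exists>B\<in>sets ?PP. measure ?PP B \<le> 2 * real (card fnet) * exp (- ?T K) \<and>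
      (\<forall>X\<in>space ?PP - B. \<forall>z\<in>fnet. \<bar>?dev (band a (1 / 4 ^ K) z) X\<bar>
         \<le> (e * 2 ^ K) * (8 * (1 / 4 ^ K)) + ?T K / (real n * (e * 2 ^ K)))"
    proof (rule iid_chernoff_finite[OF prob_P fnet(1) n])
      fix z assume z: "z \<in> fnet"
      have "(\<integral>x. (band a (1 / 4 ^ K) z x)\<^sup>2 \<partial>P) \<le> (\<integral>x. band a (1 / 4 ^ K) z x \<partial>P)"
        using band_01[of a "1 / 4 ^ K" z]
        by (intro integral_mono integrable_01) (auto simp: power2_eq_square mult_left_le_one_le mult_le_one)
      also have "\<dots> \<le> 8 * (1 / 4 ^ K)" using z by (intro integral_band_le) (auto simp: fnet_def)
      finally show "(\<integral>x. (band a (1 / 4 ^ K) z x)\<^sup>2 \<partial>P) \<le> 8 * (1 / 4 ^ K)" .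
    qed (use lam[of K] band_01 in auto)
    thus ?thesis using that by blast
  qed
  have Bb': "measure ?PP Bb \<le> exp (- H)"
  proof -
    have "measure ?PP Bb \<le> 2 * exp (- H) * (1 / 2) ^ (K + 1)"
      using Bb(2) union_bound_level[OF d H fnet(2)] by linarith
    also have "\<dots> \<le> 2 * exp (- H) * (1 / 2) ^ 1"
      by (intro mult_left_mono power_decreasing) auto
    finally show ?thesis by simp
  qed
  obtain BL where BL: "BL \<in> sets ?PP" "measure ?PP BL \<le> exp (- H)"
    "\<And>X c. X \<in> space ?PP - BL \<Longrightarrow> (\<Sum>i<n. h (X i) * \<bar>lin c (X i)\<bar>) / real n \<le> 34 * nrm c"
    using uniform_abs_moment[OF d n H dn] by blast
  let ?B = "B0 \<union> (\<Union>k<K. Bk k) \<union> Bb \<union> BL"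
  have U: "(\<Union>k<K. Bk k) \<in> sets ?PP" using Bk(1) by auto
  show ?thesis
    unfolding e_def[symmetric]
  proof (intro bexI[of _ ?B] conjI ballI allI impI)
    show "?B \<in> sets ?PP" using B0(1) U Bb(1) BL(1) by auto
    have "measure ?PP ?B \<le> measure ?PP B0 + measure ?PP (\<Union>k<K. Bk k) + measure ?PP Bb + measure ?PP BL"
      using B0(1) U Bb(1) BL(1) 
      by (intro order.trans[OF measure_Un_le] add_mono order.refl) auto
    thus "measure ?PP ?B \<le> 5 * exp (- H)" using B0' Bk' Bb' BL(2) by linarith
  next
    fix X c assume X: "X \<in> space ?PP - ?B" and c: "nrm c = 1"
    have "\<forall>k. \<exists>z\<in>net k. nrm (\<lambda>j. c j - z j) \<le> 1 / (2 * 8 ^ k)"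
      using net_approx[of c] c d by simp
    then obtain z where z: "\<And>k. z k \<in> net k" "\<And>k. nrm (\<lambda>j. c j - z k j) \<le> 1 / (2 * 8 ^ k)" by metis
    have z_half: "1 / 2 \<le> nrm (z k)" for k
    proof -
      have "nrm c = nrm (\<lambda>j. z k j + (c j - z k j))" by simp
      also have "\<dots> \<le> nrm (z k) + nrm (\<lambda>j. c j - z k j)" by (rule L2_set_triangle_ineq)
      finally have "1 \<le> nrm (z k) + 1 / (2 * 8 ^ k)" using z(2)[of k] c by linarith
      moreover have "1 / (2 * 8 ^ k) \<le> (1 / 2 :: real)" by (simp add: field_simps)
      ultimately show ?thesis by linarith
    qed
    have zpair: "(z k, z (k + 1)) \<in> pairs k" for k
    proof -
      have "nrm (\<lambda>j. z k j - z (k + 1) j) = nrm (\<lambda>j. (c j - z (k + 1) j) + (- 1) * (c j - z k j))" by simp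
      also have "\<dots> \<le> nrm (\<lambda>j. c j - z (k + 1) j) + nrm (\<lambda>j. (- 1) * (c j - z k j))" by (rule L2_set_triangle_ineq)
      also have "nrm (\<lambda>j. (- 1) * (c j - z k j)) = nrm (\<lambda>j. c j - z k j)" by (simp add: L2_set_def power2_commute)
      also have "nrm (\<lambda>j. c j - z (k + 1) j) + nrm (\<lambda>j. c j - z k j) \<le> 1 / (2 * 8 ^ (k + 1)) + 1 / (2 * 8 ^ k)"
        by (intro add_mono z)
      also have "\<dots> \<le> 1 / 8 ^ k" by (simp add: field_simps)
      finally show ?thesis using z z_half by (simp add: pairs_def)
    qed
    have link: "\<bar>?dev (hit a (z (Suc k))) X - ?dev (hit a (z k)) X\<bar> \<le> 22 * e * ((real k + 1) / 2 ^ k)" if k: "k < K" for k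
    proof -
      have "\<bar>?dev (\<lambda>x. hit a (z k) x - hit a (z (k + 1)) x) X\<bar> \<le> (e * 2 ^ k) * (9 / 4 ^ k) + ?T k / (real n * (e * 2 ^ k))"
        using X k zpair by (intro Bk(3)) auto
      also have "?T k / (real n * (e * 2 ^ k)) = 13 * (real k + 1) * e / 2 ^ k" by (rule scale)
      also have "(e * 2 ^ k) * (9 / 4 ^ k) = 9 * e / 2 ^ k"
        by (simp add: field_simps power_mult_distrib[symmetric])
      also have "9 * e / 2 ^ k + 13 * (real k + 1) * e / 2 ^ k = e * (9 + 13 * (real k + 1)) / 2 ^ k"
        by (simp add: add_divide_distrib[symmetric] algebra_simps)
      also have "\<dots> \<le> e * (22 * (real k + 1)) / 2 ^ k"
        using e by (intro divide_right_mono mult_left_mono) auto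
      also have "\<dots> = 22 * e * ((real k + 1) / 2 ^ k)" by simp
      also have "?dev (\<lambda>x. hit a (z k) x - hit a (z (k + 1)) x) X = ?dev (hit a (z k)) X - ?dev (hit a (z (k + 1))) X"
      proof -
        have "integrable P (hit a u)" for u using hit_01[of a u] by (intro integrable_01) auto
        thus ?thesis by (simp add: sum_subtractf diff_divide_distrib)
      qed
      finally show ?thesis by (simp add: abs_minus_commute)
    qed
    have tele: "\<bar>?dev (hit a (z m)) X - ?dev (hit a (z 0)) X\<bar> \<le> (\<Sum>k<m. 22 * e * ((real k + 1) / 2 ^ k))" if "m \<le> K" for m
      using that
    proof (induction m)
      case (Suc m)
      thus ?case using link[of m] by simp
    qed simp
    have "(\<Sum>k<K. 22 * e * ((real k + 1) / 2 ^ k)) = 22 * e * (\<Sum>k<K. (real k + 1) / 2 ^ k)"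
      by (simp add: sum_distrib_left)
    also have "\<dots> \<le> 22 * e * 4" unfolding sum_arith_geometric using e by (intro mult_left_mono) auto
    finally have t88: "\<bar>?dev (hit a (z K)) X - ?dev (hit a (z 0)) X\<bar> \<le> 88 * e" using tele[of K] by simp
    have t14: "\<bar>?dev (hit a (z 0)) X\<bar> \<le> 14 * e"
    proof -
      have "\<bar>?dev (hit a (z 0)) X\<bar> \<le> (e * 2 ^ 0) * 1 + ?T 0 / (real n * (e * 2 ^ 0))"
        using X z(1) by (intro B0(3)) auto
      thus ?thesis unfolding scale by simp
    qed
    \<comment> \<open>The chain is not continued to infinity: below scale \<open>K\<close> the crude bound \<open>hit_diff_le\<close> suffices.\<close>
    let ?u = "\<lambda>j. c j - z K j"
    define r where "r = 1 / (4::real) ^ K"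
    have r: "0 < r" "r \<le> 4 * e" using inv4K by (auto simp: r_def)
    have t53: "(\<Sum>i<n. band a r (z K) (X i)) / real n \<le> 53 * e"
    proof -
      have zf: "z K \<in> fnet" using z z_half by (simp add: fnet_def)
      have "\<bar>?dev (band a r (z K)) X\<bar> \<le> (e * 2 ^ K) * (8 * (1 / 4 ^ K)) + ?T K / (real n * (e * 2 ^ K))"
        unfolding r_def using X zf by (intro Bb(3)) auto
      also have "?T K / (real n * (e * 2 ^ K)) = 13 * (real K + 1) * e / 2 ^ K" by (rule scale)
      also have "(e * 2 ^ K) * (8 * (1 / 4 ^ K)) = 8 * e / 2 ^ K"
        by (simp add: field_simps power_mult_distrib[symmetric])
      also have "8 * e / 2 ^ K \<le> 8 * e / 1" using e by (intro divide_left_mono) auto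
      also have "13 * (real K + 1) * e / 2 ^ K \<le> 13 * e"
      proof -
        have "K + 1 \<le> 2 ^ K" using less_exp[of K] by linarith
        hence "real (K + 1) \<le> real (2 ^ K)" by (rule of_nat_mono)
        hence "13 * e * (real K + 1) \<le> 13 * e * 2 ^ K" using e by (intro mult_left_mono) auto
        thus ?thesis by (simp add: field_simps)
      qed
      finally have "\<bar>?dev (band a r (z K)) X\<bar> \<le> 21 * e" by simp
      moreover have "(\<integral>x. band a r (z K) x \<partial>P) \<le> 8 * r" using r z_half by (intro integral_band_le) auto
      ultimately show ?thesis using r by linarith
    qed
    have t34: "(\<Sum>i<n. h (X i) * of_bool (r < \<bar>lin ?u (X i)\<bar>)) / real n \<le> 34 * e"
    proof -
      have "(\<Sum>i<n. h (X i) * of_bool (r < \<bar>lin ?u (X i)\<bar>)) \<le> (\<Sum>i<n. (h (X i) * \<bar>lin ?u (X i)\<bar>) / r)"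
      proof (rule sum_mono)
        fix i
        have "h (X i) * of_bool (r < \<bar>lin ?u (X i)\<bar>) \<le> h (X i) * (\<bar>lin ?u (X i)\<bar> / r)"
          using r by (intro mult_left_mono h_nonneg) (auto simp: of_bool_def field_simps)
        thus "h (X i) * of_bool (r < \<bar>lin ?u (X i)\<bar>) \<le> (h (X i) * \<bar>lin ?u (X i)\<bar>) / r" by simp
      qed
      also have "\<dots> = (\<Sum>i<n. h (X i) * \<bar>lin ?u (X i)\<bar>) / r" by (simp add: sum_divide_distrib)
      finally have "(\<Sum>i<n. h (X i) * of_bool (r < \<bar>lin ?u (X i)\<bar>)) / real n
         \<le> (\<Sum>i<n. h (X i) * \<bar>lin ?u (X i)\<bar>) / r / real n" by (rule divide_right_mono) simp
      also have "\<dots> = (\<Sum>i<n. h (X i) * \<bar>lin ?u (X i)\<bar>) / real n / r" by simp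
      also have "\<dots> \<le> 34 * nrm ?u / r" using X r by (intro divide_right_mono BL(3)) auto
      also have "\<dots> \<le> 34 * (1 / (2 * 8 ^ K)) / r" using r by (intro divide_right_mono mult_left_mono z(2)) auto
      also have "\<dots> = 17 * (1 / 2 ^ K)"
      proof -
        have "(8::real) ^ K = 4 ^ K * 2 ^ K" by (simp add: power_mult_distrib[symmetric])
        thus ?thesis by (simp add: r_def)
      qed
      also have "\<dots> \<le> 34 * e" using inv2K by simp
      finally show ?thesis .
    qed
    have t87: "\<bar>(\<Sum>i<n. hit a c (X i)) / real n - (\<Sum>i<n. hit a (z K) (X i)) / real n\<bar> \<le> 87 * e"
    proof -
      have "\<bar>(\<Sum>i<n. hit a c (X i)) - (\<Sum>i<n. hit a (z K) (X i))\<bar> \<le> (\<Sum>i<n. \<bar>hit a c (X i) - hit a (z K) (X i)\<bar>)"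
        unfolding sum_subtractf[symmetric] by (rule sum_abs)
      also have "\<dots> \<le> (\<Sum>i<n. band a r (z K) (X i) + h (X i) * of_bool (r < \<bar>lin ?u (X i)\<bar>))"
        by (intro sum_mono hit_diff_le)
      finally have "\<bar>(\<Sum>i<n. hit a c (X i)) - (\<Sum>i<n. hit a (z K) (X i))\<bar> / real n
        \<le> (\<Sum>i<n. band a r (z K) (X i) + h (X i) * of_bool (r < \<bar>lin ?u (X i)\<bar>)) / real n"
        by (rule divide_right_mono) simp
      also have "\<dots> \<le> 53 * e + 34 * e"
        unfolding sum.distrib add_divide_distrib by (intro add_mono t53 t34)
      finally show ?thesis by (simp add: diff_divide_distrib[symmetric])
    qed
    have t36: "\<bar>(\<integral>x. hit a c x \<partial>P) - (\<integral>x. hit a (z K) x \<partial>P)\<bar> \<le> 36 * e"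
    proof -
      have int: "integrable P (hit a u)" for u using hit_01[of a u] by (intro integrable_01) auto
      have "\<bar>(\<integral>x. hit a c x \<partial>P) - (\<integral>x. hit a (z K) x \<partial>P)\<bar> = \<bar>\<integral>x. hit a c x - hit a (z K) x \<partial>P\<bar>"
        using int by simp
      also have "\<dots> \<le> (\<integral>x. \<bar>hit a c x - hit a (z K) x\<bar> \<partial>P)" by (rule integral_abs_bound)
      also have "\<dots> \<le> 8 * r + (nrm ?u)\<^sup>2 / r\<^sup>2" using z_half r by (intro integral_hit_diff) auto
      also have "\<dots> \<le> 8 * r + (1 / 8 ^ K)\<^sup>2 / r\<^sup>2"
      proof (intro add_left_mono divide_right_mono power_mono)
        have "1 / (2 * 8 ^ K) \<le> (1 / 8 ^ K :: real)" by (simp add: field_simps)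
        thus "nrm ?u \<le> 1 / 8 ^ K" using z(2)[of K] by linarith
      qed (auto simp: L2_set_nonneg)
      also have "(1 / 8 ^ K)\<^sup>2 / r\<^sup>2 = r" unfolding r_def by (rule power_8_4)
      finally show ?thesis using r by linarith
    qed
    have "(\<integral>x. hit a c x \<partial>P) = (1 - \<epsilon>) * half_normal_cdf a" unfolding integral_hit lin_half_normal_cdf[OF c] ..
    hence "\<bar>(\<Sum>i<n. hit a c (X i)) / real n - (1 - \<epsilon>) * half_normal_cdf a\<bar> \<le> 225 * e"
      using t87 t36 t88 t14 by linarith
    thus "\<bar>(\<Sum>i<n. h (X i) * of_bool (\<bar>lin c (X i)\<bar> \<le> a)) / real n - (1 - \<epsilon>) * half_normal_cdf a\<bar> \<le> 225 * e"
      by (simp add: hit_def)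
  qed
qed

end

section \<open>Quadratic forms and their square roots\<close>

text \<open>
  Matrices and vectors are read here as plain functions on indices below \<open>p\<close>, which makes sums easier to
  rearrange than the corresponding matrix products.
\<close>

definition bil :: "nat \<Rightarrow> (nat \<Rightarrow> nat \<Rightarrow> real) \<Rightarrow> (nat \<Rightarrow> real) \<Rightarrow> (nat \<Rightarrow> real) \<Rightarrow> real" where
  "bil p R u v = (\<Sum>i<p. \<Sum>j<p. u i * R i j * v j)"

lemma nonneg_quadratic_discriminant:
  fixes A B C :: real
  assumes "\<And>t. 0 \<le> A + 2 * t * B + t\<^sup>2 * C" and C: "0 \<le> C" shows "B\<^sup>2 \<le> A * C"
proof (cases "C = 0")
  case True
  have "B = 0"
  proof (rule ccontr)
    assume "B \<noteq> 0"
    hence "2 * (- (A + 1) / (2 * B)) * B = - (A + 1)" by (simp add: field_simps)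
    thus False using assms(1)[of "- (A + 1) / (2 * B)"] True by simp
  qed
  thus ?thesis using True by simp
next
  case False
  hence "C > 0" using C by simp
  moreover have "0 \<le> A - B\<^sup>2 / C"
    using assms(1)[of "- B / C"] False by (simp add: power2_eq_square)
  ultimately show ?thesis by (simp add: field_simps)
qed

lemma bil_expand:
  assumes "\<And>i j. i < p \<Longrightarrow> j < p \<Longrightarrow> R i j = R j i"
  shows "bil p R (\<lambda>i. u i + t * v i) (\<lambda>i. u i + t * v i) = bil p R u u + 2 * t * bil p R u v + t\<^sup>2 * bil p R v v"
proof -
  have "bil p R v u = (\<Sum>j<p. \<Sum>i<p. v i * R i j * u j)" unfolding bil_def by (rule sum.swap)
  also have "\<dots> = bil p R u v" unfolding bil_def using assms
    by (intro sum.cong refl) (simp add: mult.commute mult.left_commute)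
  finally have sym: "bil p R v u = bil p R u v" .
  have "bil p R (\<lambda>i. u i + t * v i) (\<lambda>i. u i + t * v i)
      = bil p R u u + t * bil p R u v + t * bil p R v u + t\<^sup>2 * bil p R v v"
    by (simp add: bil_def sum.distrib sum_distrib_left algebra_simps power2_eq_square)
  thus ?thesis unfolding sym by simp
qed

lemma bil_Cauchy_Schwarz:
  assumes sym: "\<And>i j. i < p \<Longrightarrow> j < p \<Longrightarrow> R i j = R j i" and psd: "\<And>v. 0 \<le> bil p R v v"
  shows "(bil p R u v)\<^sup>2 \<le> bil p R u u * bil p R v v"
proof (rule nonneg_quadratic_discriminant)
  fix t
  show "0 \<le> bil p R u u + 2 * t * bil p R u v + t\<^sup>2 * bil p R v v"
    using psd[of "\<lambda>i. u i + t * v i"] bil_expand[of p R u t v] sym by metis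
qed (rule psd)

lemma bil_delta: "m < p \<Longrightarrow> bil p R u (\<lambda>i. of_bool (i = m)) = (\<Sum>i<p. u i * R i m)"
  by (simp add: bil_def of_bool_def if_distrib[of "\<lambda>x. _ * x"] sum.delta cong: if_cong)

text \<open>
  One step of symmetric Gaussian elimination.  The Schur complement stays positive semidefinite by the
  Cauchy--Schwarz inequality for the form.  For a vanishing pivot the same inequality forces the whole row
  to vanish, and division by zero yields the correct \<open>V = 0\<close> there.  The last clause preserves the rows
  that have already been eliminated.
\<close>

lemma cholesky_step:
  fixes R :: "nat \<Rightarrow> nat \<Rightarrow> real"
  assumes sym: "\<And>i j. i < p \<Longrightarrow> j < p \<Longrightarrow> R i j = R j i" and psd: "\<And>v. 0 \<le> bil p R v v" and m: "m < p"
  shows "\<exists>V. (\<forall>v. 0 \<le> bil p (\<lambda>i j. R i j - V i * V j) v v) \<and> (\<forall>j<p. R m j = V m * V j) \<and> (\<forall>i<p. R i m = 0 \<longrightarrow> V i = 0)"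
proof -
  define E :: "nat \<Rightarrow> real" where "E = (\<lambda>i. of_bool (i = m))"
  have EE: "bil p R E E = R m m" unfolding E_def bil_delta[OF m] using m
    by (simp add: of_bool_def if_distrib[of "\<lambda>x. x * _"] sum.delta cong: if_cong)
  have uE: "bil p R u E = (\<Sum>i<p. u i * R i m)" for u unfolding E_def by (rule bil_delta[OF m])
  have CS: "(\<Sum>i<p. u i * R i m)\<^sup>2 \<le> bil p R u u * R m m" for u
    using bil_Cauchy_Schwarz[OF sym psd, of u E] unfolding EE unfolding uE .
  have nn: "0 \<le> R m m" using psd[of E] EE by simp
  define V where "V = (\<lambda>i. R i m / sqrt (R m m))"
  have expand: "bil p (\<lambda>i j. R i j - V i * V j) v v = bil p R v v - (\<Sum>i<p. v i * V i)\<^sup>2" for v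
    by (simp add: bil_def sum_subtractf algebra_simps power2_eq_square sum_product)
  show ?thesis
  proof (cases "R m m = 0")
    case True
    have z: "R j m = 0" if "j < p" for j
      using CS[of "\<lambda>i. of_bool (i = j)"] that True by (simp add: of_bool_def if_distrib[of "\<lambda>x. x * _"] sum.delta cong: if_cong)
    hence V0: "V j = 0" if "j < p" for j using that by (simp add: V_def)
    have "(\<Sum>i<p. v i * V i) = 0" for v by (intro sum.neutral) (auto simp: V0)
    hence "0 \<le> bil p (\<lambda>i j. R i j - V i * V j) v v" for v unfolding expand using psd[of v] by simp
    moreover have "R m j = V m * V j" if "j < p" for j
      using sym[OF m that] z[OF that] V0[OF that] by simp
    ultimately show ?thesis using V0 by (intro exI[of _ V]) blast
  next
    case False
    hence pos: "0 < R m m" using nn by simp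
    have "0 \<le> bil p (\<lambda>i j. R i j - V i * V j) v v" for v
    proof -
      have "(\<Sum>i<p. v i * V i) = (\<Sum>i<p. v i * R i m) / sqrt (R m m)" by (simp add: V_def sum_divide_distrib)
      hence "(\<Sum>i<p. v i * V i)\<^sup>2 = (\<Sum>i<p. v i * R i m)\<^sup>2 / R m m" using pos by (simp add: power_divide)
      also have "\<dots> \<le> bil p R v v" using CS[of v] pos by (simp add: field_simps)
      finally show ?thesis unfolding expand by simp
    qed
    moreover have "R m j = V m * V j" if "j < p" for j
      using pos sym[OF m that] by (simp add: V_def)
    ultimately show ?thesis by (intro exI[of _ V]) (auto simp: V_def)
  qed
qed

lemma cholesky:
  fixes R :: "nat \<Rightarrow> nat \<Rightarrow> real"
  assumes sym: "\<And>i j. i < p \<Longrightarrow> j < p \<Longrightarrow> R i j = R j i" and psd: "\<And>v. 0 \<le> bil p R v v"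
  shows "\<exists>a. \<forall>i<p. \<forall>j<p. R i j = (\<Sum>k<p. a i k * a j k)"
proof -
  have "\<exists>a. (\<forall>v. 0 \<le> bil p (\<lambda>i j. R i j - (\<Sum>k<m. a i k * a j k)) v v) \<and>
      (\<forall>i<m. \<forall>j<p. R i j = (\<Sum>k<m. a i k * a j k))" if "m \<le> p" for m
    using that
  proof (induction m)
    case 0 show ?case by (intro exI[of _ "\<lambda>_ _. 0"]) (simp add: psd)
  next
    case (Suc m)
    obtain a where a0: "(\<forall>v. 0 \<le> bil p (\<lambda>i j. R i j - (\<Sum>k<m. a i k * a j k)) v v) \<and>
      (\<forall>i<m. \<forall>j<p. R i j = (\<Sum>k<m. a i k * a j k))"
      using Suc.IH[OF Suc_leD[OF Suc.prems]] by (rule exE)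
    have a: "\<And>v. 0 \<le> bil p (\<lambda>i j. R i j - (\<Sum>k<m. a i k * a j k)) v v"
      "\<And>i j. i < m \<Longrightarrow> j < p \<Longrightarrow> R i j = (\<Sum>k<m. a i k * a j k)" using a0 by blast+
    let ?R = "\<lambda>i j. R i j - (\<Sum>k<m. a i k * a j k)"
    have m: "m < p" using Suc by simp
    obtain V where V: "\<And>v. 0 \<le> bil p (\<lambda>i j. ?R i j - V i * V j) v v" "\<And>j. j < p \<Longrightarrow> ?R m j = V m * V j"
      "\<And>i. i < p \<Longrightarrow> ?R i m = 0 \<Longrightarrow> V i = 0"
    proof -
      have "?R i j = ?R j i" if "i < p" "j < p" for i j using sym[OF that] by (simp add: mult.commute)
      from cholesky_step[of p ?R m, OF this a(1) m] show ?thesis using that by blast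
    qed
    define a' where "a' = (\<lambda>i k. if k = m then V i else a i k)"
    have s: "(\<Sum>k<Suc m. a' i k * a' j k) = (\<Sum>k<m. a i k * a j k) + V i * V j" for i j
      by (simp add: a'_def)
    show ?case
    proof (intro exI[of _ a'] conjI allI impI)
      show "0 \<le> bil p (\<lambda>i j. R i j - (\<Sum>k<Suc m. a' i k * a' j k)) v v" for v
        unfolding s using V(1)[of v] by (simp add: algebra_simps)
      fix i j assume i: "i < Suc m" and j: "j < p"
      show "R i j = (\<Sum>k<Suc m. a' i k * a' j k)"
      proof (cases "i = m")
        case True thus ?thesis unfolding s using V(2)[OF j] by simp
      next
        case False
        hence "i < m" using i by simp
        moreover hence "V i = 0" using V(3)[of i] a(2)[of i m] m by simp
        ultimately show ?thesis unfolding s using a(2) j by simp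
      qed
    qed
  qed
  from this[of p] show ?thesis by blast
qed

lemma quadratic_form_bil:
  assumes "u \<in> carrier_vec p" "v \<in> carrier_vec p" "A \<in> carrier_mat p p"
  shows "u \<bullet> (A *\<^sub>v v) = bil p (\<lambda>i j. A $$ (i, j)) (\<lambda>i. u $ i) (\<lambda>i. v $ i)"
  using assms by (auto simp: scalar_prod_def bil_def sum_distrib_left lessThan_atLeast0 mult.assoc intro!: sum.cong)

lemma psd_bil:
  assumes "psd p A"
  shows "0 \<le> bil p (\<lambda>i j. A $$ (i, j)) v v" "i < p \<Longrightarrow> j < p \<Longrightarrow> A $$ (i, j) = A $$ (j, i)"
proof -
  have A: "A \<in> carrier_mat p p" "transpose_mat A = A" using assms by (auto simp: psd_def)
  have "0 \<le> vec p v \<bullet> (A *\<^sub>v vec p v)" using assms by (auto simp: psd_def)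
  thus "0 \<le> bil p (\<lambda>i j. A $$ (i, j)) v v"
    by (subst (asm) quadratic_form_bil[OF _ _ A(1)]) (auto simp: bil_def)
  assume "i < p" "j < p"
  hence "transpose_mat A $$ (i, j) = A $$ (j, i)" using A(1) by simp
  thus "A $$ (i, j) = A $$ (j, i)" unfolding A(2) .
qed

section \<open>Gaussian vectors\<close>

text \<open>
  The chosen factor in the definition of the normal law does satisfy its specification, because a
  Cholesky factor exists, also for singular matrices.
\<close>

lemma mvn_linear_image:
  assumes "psd p \<Sigma>"
  shows "\<exists>a::nat \<Rightarrow> nat \<Rightarrow> real. (\<forall>i<p. \<forall>j<p. \<Sigma> $$ (i, j) = (\<Sum>k<p. a i k * a j k)) \<and>
     mvn p \<Sigma> = distr (\<Pi>\<^sub>M i\<in>{..<p}. SN) (Rp p) (\<lambda>z. \<lambda>i\<in>{..<p}. \<Sum>k<p. a i k * z k)"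
proof -
  have S: "\<Sigma> \<in> carrier_mat p p" using assms by (simp add: psd_def)
  define A where "A = (SOME A. A \<in> carrier_mat p p \<and> A * transpose_mat A = \<Sigma>)"
  obtain b where b: "\<And>i j. i < p \<Longrightarrow> j < p \<Longrightarrow> \<Sigma> $$ (i, j) = (\<Sum>k<p. b i k * b j k)"
    using cholesky[of p "\<lambda>i j. \<Sigma> $$ (i, j)"] psd_bil[OF assms] by blast
  have "mat p p (\<lambda>(i, k). b i k) \<in> carrier_mat p p \<and> mat p p (\<lambda>(i, k). b i k) * transpose_mat (mat p p (\<lambda>(i, k). b i k)) = \<Sigma>"
    using S by (auto simp: scalar_prod_def b lessThan_atLeast0 intro!: eq_matI)
  hence A: "A \<in> carrier_mat p p" "A * transpose_mat A = \<Sigma>"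
    unfolding A_def by (metis (mono_tags, lifting) someI)+
  show ?thesis
  proof (intro exI[of _ "\<lambda>i k. A $$ (i, k)"] conjI allI impI)
    fix i j assume "i < p" "j < p"
    thus "\<Sigma> $$ (i, j) = (\<Sum>k<p. A $$ (i, k) * A $$ (j, k))"
      using A(1) by (subst A(2)[symmetric]) (auto simp: scalar_prod_def lessThan_atLeast0)
  next
    have "(\<lambda>i\<in>{..<p}. (A *\<^sub>v vec p z) $ i) = (\<lambda>i\<in>{..<p}. \<Sum>k<p. A $$ (i, k) * z k)" for z
      using A(1) by (intro ext) (auto simp: scalar_prod_def lessThan_atLeast0 restrict_def)
    thus "mvn p \<Sigma> = distr (\<Pi>\<^sub>M i\<in>{..<p}. SN) (Rp p) (\<lambda>z. \<lambda>i\<in>{..<p}. \<Sum>k<p. A $$ (i, k) * z k)"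
      unfolding mvn_def Let_def A_def[symmetric] by simp
  qed
qed

lemma distributed_SN: "distributed SN lborel (\<lambda>x. x) std_normal_density"
proof -
  have "distr SN lborel (\<lambda>x. x) = SN" by (rule distr_id2) simp
  moreover have "(\<lambda>x. x) \<in> measurable SN lborel" by simp
  ultimately show ?thesis unfolding distributed_def by (intro conjI) (assumption | simp)+
qed

lemma distr_scaled_SN:
  assumes "0 < s" shows "distr SN borel (\<lambda>x. s * x) = density lborel (normal_density 0 s)"
proof -
  have "distributed SN lborel (\<lambda>x. s * x) (normal_density 0 s)"
    using prob_space.normal_density_affine[OF prob_space_SN distributed_SN, of s 0] assms by simp
  hence "distr SN lborel (\<lambda>x. s * x) = density lborel (normal_density 0 s)"
    unfolding distributed_def by (rule conjunct1)
  moreover have "distr SN borel (\<lambda>x. s * x) = distr SN lborel (\<lambda>x. s * x)" by (rule distr_cong) simp_all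
  ultimately show ?thesis by simp
qed

text \<open>
  The sum rule for independent normal variables requires positive variances, so the zero
  coefficients are removed first.
\<close>

lemma gaussian_linear_form:
  fixes w :: "nat \<Rightarrow> real"
  shows "distr (\<Pi>\<^sub>M i\<in>{..<p}. SN) borel (\<lambda>z. \<Sum>k<p. w k * z k) = distr SN borel (\<lambda>g. L2_set w {..<p} * g)"
proof -
  interpret SN: prob_space SN by (rule prob_space_SN)
  interpret pr: product_prob_space "\<lambda>_::nat. SN" by unfold_locales
  interpret fp: finite_product_prob_space "\<lambda>_::nat. SN" "{..<p}" by unfold_locales auto
  let ?PP = "\<Pi>\<^sub>M i\<in>{..<p}. SN"
  define I where "I = {k. k < p \<and> w k \<noteq> 0}"
  have sumI: "(\<Sum>k<p. w k * z k) = (\<Sum>k\<in>I. w k * z k)" for z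
    unfolding I_def by (intro sum.mono_neutral_right) auto
  have L2I: "L2_set w {..<p} = sqrt (\<Sum>k\<in>I. \<bar>w k\<bar>\<^sup>2)"
    unfolding I_def L2_set_def by (intro arg_cong[where f = sqrt] sum.mono_neutral_cong_right) auto
  show ?thesis
  proof (cases "I = {}")
    case True
    have "distr ?PP borel (\<lambda>_. 0::real) = return borel 0" by (rule fp.distr_const) simp
    moreover have "distr SN borel (\<lambda>_. 0::real) = return borel 0" by (rule SN.distr_const) simp
    ultimately show ?thesis unfolding sumI L2I True by simp
  next
    case False
    have fin: "finite I" by (simp add: I_def)
    have Ip: "i < p" if "i \<in> I" for i using that by (simp add: I_def)
    have comp: "distr ?PP SN (\<lambda>z. z i) = SN" if "i \<in> I" for i
      using Ip[OF that] by (intro distr_PiM_component prob_space_SN) auto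
    have d1: "distributed ?PP lborel (\<lambda>z. z i) std_normal_density" if "i \<in> I" for i
    proof -
      have "distr ?PP lborel (\<lambda>z. z i) = distr ?PP SN (\<lambda>z. z i)" by (rule distr_cong) simp_all
      hence "distr ?PP lborel (\<lambda>z. z i) = SN" using comp[OF that] by simp
      moreover have "(\<lambda>z. z i) \<in> measurable ?PP SN"
        using Ip[OF that] by (intro measurable_component_singleton) simp
      hence "(\<lambda>z. z i) \<in> measurable ?PP lborel" by (simp cong: measurable_cong_sets)
      ultimately show ?thesis unfolding distributed_def by (intro conjI) (assumption | simp)+
    qed
    have d2: "distributed ?PP lborel (\<lambda>z. w i * z i) (normal_density 0 \<bar>w i\<bar>)" if "i \<in> I" for i
      using fp.normal_density_affine[OF d1[OF that], of "w i" 0] that by (simp add: I_def)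
    have ind: "fp.indep_vars (\<lambda>_. borel) (\<lambda>i z. w i * z i) I"
    proof -
      have "fp.indep_vars (\<lambda>_. SN) (\<lambda>i z. z i) I"
      proof (subst fp.indep_vars_iff_distr_eq_PiM'[OF False])
        show "(\<lambda>z. z i) \<in> measurable ?PP SN" if "i \<in> I" for i
          using Ip[OF that] by (intro measurable_component_singleton) auto
        have "distr ?PP (\<Pi>\<^sub>M i\<in>I. SN) (\<lambda>x. restrict x I) = (\<Pi>\<^sub>M i\<in>I. SN)"
        proof -
          have "I \<subseteq> {..<p}" using Ip by auto
          from fp.distr_PiM_restrict_finite[OF fin this] show ?thesis .
        qed
        also have "\<dots> = (\<Pi>\<^sub>M i\<in>I. distr ?PP SN (\<lambda>z. z i))" using comp by (intro PiM_cong) auto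
        finally show "distr ?PP (\<Pi>\<^sub>M i\<in>I. SN) (\<lambda>x. \<lambda>i\<in>I. x i) = (\<Pi>\<^sub>M i\<in>I. distr ?PP SN (\<lambda>z. z i))" .
      qed
      thus ?thesis by (rule fp.indep_vars_compose2) auto
    qed
    have "distributed ?PP lborel (\<lambda>z. \<Sum>i\<in>I. w i * z i) (normal_density (\<Sum>i\<in>I. 0) (sqrt (\<Sum>i\<in>I. \<bar>w i\<bar>\<^sup>2)))"
      by (rule fp.sum_indep_normal[OF fin False ind _ d2]) (auto simp: I_def)
    hence "distr ?PP lborel (\<lambda>z. \<Sum>i\<in>I. w i * z i) = density lborel (normal_density 0 (sqrt (\<Sum>i\<in>I. \<bar>w i\<bar>\<^sup>2)))"
      unfolding distributed_def by simp
    moreover have "distr ?PP lborel (\<lambda>z. \<Sum>i\<in>I. w i * z i) = distr ?PP borel (\<lambda>z. \<Sum>i\<in>I. w i * z i)"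
      by (rule distr_cong) simp_all
    moreover have "0 < sqrt (\<Sum>i\<in>I. \<bar>w i\<bar>\<^sup>2)"
      using fin False by (auto intro!: sum_pos simp: I_def)
    ultimately show ?thesis unfolding sumI L2I by (simp add: distr_scaled_SN)
  qed
qed

lemma prob_space_linear_image:
  fixes a :: "nat \<Rightarrow> nat \<Rightarrow> real" and p :: nat
  shows "prob_space (distr (\<Pi>\<^sub>M i\<in>{..<p}. SN) (Rp p) (\<lambda>z. \<lambda>i\<in>{..<p}. \<Sum>k<p. a i k * z k))"
    "sets (distr (\<Pi>\<^sub>M i\<in>{..<p}. SN) (Rp p) (\<lambda>z. \<lambda>i\<in>{..<p}. \<Sum>k<p. a i k * z k)) = sets (Rp p)"
proof -
  interpret SN: prob_space SN by (rule prob_space_SN)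
  interpret fpS: finite_product_prob_space "\<lambda>_::nat. SN" "{..<p}" by unfold_locales auto
  have "(\<lambda>z. z k) \<in> borel_measurable (\<Pi>\<^sub>M i\<in>{..<p}. SN)" if "k < p" for k
    using measurable_component_singleton[of k "{..<p}" "\<lambda>_. SN"] that by (simp cong: measurable_cong_sets)
  thus "prob_space (distr (\<Pi>\<^sub>M i\<in>{..<p}. SN) (Rp p) (\<lambda>z. \<lambda>i\<in>{..<p}. \<Sum>k<p. a i k * z k))" unfolding Rp_def
    by (intro fpS.prob_space_distr measurable_restrict borel_measurable_sum borel_measurable_times borel_measurable_const) auto
qed simp

section \<open>Orthonormal coordinates\<close>

text \<open>
  Gram--Schmidt with explicit coefficients: the vectors \<open>q\<^sub>k = \<Sum>\<^sub>j B\<^sub>k\<^sub>j a\<^sub>j\<close> are orthonormal and \<open>a\<^sub>j = \<Sum>\<^sub>k C\<^sub>j\<^sub>k q\<^sub>k\<close>.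
  Both coefficient matrices are recorded because they are later applied to the coordinates of a random
  vector in place of the vectors \<open>a\<^sub>j\<close>.  A vector that depends on the previous ones adds nothing, so the
  number of basis vectors can be smaller than the number of given vectors.
\<close>

lemma gram_schmidt_coordinates:
  fixes a :: "'j \<Rightarrow> nat \<Rightarrow> real"
  assumes "finite J"
  shows "\<exists>m B C. m \<le> card J \<and>
    (\<forall>k<m. \<forall>l<m. (\<Sum>i<p. (\<Sum>j\<in>J. B k j * a j i) * (\<Sum>j\<in>J. B l j * a j i)) = of_bool (k = l)) \<and>
    (\<forall>j\<in>J. \<forall>i<p. a j i = (\<Sum>k<m. C j k * (\<Sum>j\<in>J. B k j * a j i)))"
  using assms
proof (induction J)
  case empty
  show ?case by (intro exI[of _ 0] exI[of _ "\<lambda>_ _. 0"]) auto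
next
  case (insert j0 J)
  then obtain m :: nat and B :: "nat \<Rightarrow> 'j \<Rightarrow> real" and C :: "'j \<Rightarrow> nat \<Rightarrow> real" where m: "m \<le> card J"
    and orth: "\<And>k l. k < m \<Longrightarrow> l < m \<Longrightarrow> (\<Sum>i<p. (\<Sum>j\<in>J. B k j * a j i) * (\<Sum>j\<in>J. B l j * a j i)) = of_bool (k = l)"
    and span: "\<And>j i. j \<in> J \<Longrightarrow> i < p \<Longrightarrow> a j i = (\<Sum>k<m. C j k * (\<Sum>j\<in>J. B k j * a j i))"
    by blast
  define q where "q k i = (\<Sum>j\<in>J. B k j * a j i)" for k i
  define c where "c k = (\<Sum>i<p. a j0 i * q k i)" for k
  define r where "r i = a j0 i - (\<Sum>k<m. c k * q k i)" for i
  define \<rho> where "\<rho> = (\<Sum>i<p. (r i)\<^sup>2)"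
  have orth': "(\<Sum>i<p. q k i * q l i) = of_bool (k = l)" if "k < m" "l < m" for k l
    unfolding q_def by (rule orth[OF that])
  have rq: "(\<Sum>i<p. r i * q l i) = 0" if l: "l < m" for l
  proof -
    have "(\<Sum>i<p. r i * q l i) = c l - (\<Sum>i<p. \<Sum>k<m. c k * (q k i * q l i))"
      by (simp add: r_def c_def left_diff_distrib sum_subtractf sum_distrib_right mult.assoc)
    also have "(\<Sum>i<p. \<Sum>k<m. c k * (q k i * q l i)) = (\<Sum>k<m. c k * (\<Sum>i<p. q k i * q l i))"
      by (subst sum.swap) (simp add: sum_distrib_left)
    also have "\<dots> = (\<Sum>k<m. c k * of_bool (k = l))" using orth' l by (intro sum.cong) auto
    also have "\<dots> = c l" using l by (simp add: of_bool_def if_distrib[of "\<lambda>x. _ * x"] sum.delta cong: if_cong)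
    finally show ?thesis by simp
  qed
  have j0: "j0 \<notin> J" "finite J" using insert by auto
  show ?case
  proof (cases "\<rho> = 0")
    case True
    have r0: "r i = 0" if "i < p" for i
      using True that by (simp add: \<rho>_def sum_nonneg_eq_0_iff)
    define B' where "B' k j = (if j = j0 then 0 else B k j)" for k j
    define C' where "C' j k = (if j = j0 then c k else C j k)" for j k
    have q': "(\<Sum>j\<in>insert j0 J. B' k j * a j i) = q k i" for k i
      using j0 by (auto simp: B'_def q_def intro!: sum.cong)
    show ?thesis
    proof (intro exI[of _ m] exI[of _ B'] exI[of _ C'] conjI allI impI ballI)
      show "m \<le> card (insert j0 J)" using m j0 by simp
      fix k l assume "k < m" "l < m"
      thus "(\<Sum>i<p. (\<Sum>j\<in>insert j0 J. B' k j * a j i) * (\<Sum>j\<in>insert j0 J. B' l j * a j i)) = of_bool (k = l)"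
        unfolding q' by (rule orth')
    next
      fix j i assume j: "j \<in> insert j0 J" and i: "i < p"
      show "a j i = (\<Sum>k<m. C' j k * (\<Sum>j\<in>insert j0 J. B' k j * a j i))"
        unfolding q'
      proof (cases "j = j0")
        case True thus "a j i = (\<Sum>k<m. C' j k * q k i)" using r0[OF i] by (simp add: r_def C'_def)
      next
        case False thus "a j i = (\<Sum>k<m. C' j k * q k i)" using span[of j i] i j by (simp add: C'_def q_def)
      qed
    qed
  next
    case False
    hence \<rho>: "0 < \<rho>" by (simp add: \<rho>_def less_le sum_nonneg)
    define s where "s = sqrt \<rho>"
    have s: "0 < s" "s * s = \<rho>" using \<rho> by (auto simp: s_def)
    define B' where "B' k j = (if k = m then (if j = j0 then 1 / s else - (\<Sum>k<m. c k * B k j) / s)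
        else if j = j0 then 0 else B k j)" for k j
    define C' where "C' j k = (if j = j0 then if k = m then s else c k else if k = m then 0 else C j k)" for j k
    define q' where "q' k i = (\<Sum>j\<in>insert j0 J. B' k j * a j i)" for k i
    have q1: "q' k i = q k i" if "k < m" for k i
      using j0 that unfolding q'_def by (auto simp: B'_def q_def intro!: sum.cong)
    have q2: "q' m i = r i / s" for i
    proof -
      have "(\<Sum>j\<in>J. B' m j * a j i) = (\<Sum>j\<in>J. - (\<Sum>k<m. c k * B k j) / s * a j i)"
        using j0 by (intro sum.cong) (auto simp: B'_def)
      also have "\<dots> = - (\<Sum>j\<in>J. \<Sum>k<m. c k * (B k j * a j i)) / s"
        by (simp add: sum_distrib_right sum_divide_distrib sum_negf mult.assoc)
      also have "(\<Sum>j\<in>J. \<Sum>k<m. c k * (B k j * a j i)) = (\<Sum>k<m. c k * q k i)"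
        by (subst sum.swap) (simp add: q_def sum_distrib_left)
      finally have "(\<Sum>j\<in>J. B' m j * a j i) = - (\<Sum>k<m. c k * q k i) / s" .
      thus ?thesis using j0 by (simp add: q'_def B'_def r_def diff_divide_distrib)
    qed
    show ?thesis
    proof (intro exI[of _ "Suc m"] exI[of _ B'] exI[of _ C'] conjI allI impI ballI)
      show "Suc m \<le> card (insert j0 J)" using m j0 by simp
      fix k l assume k: "k < Suc m" and l: "l < Suc m"
      have mm: "(\<Sum>i<p. q' m i * q' m i) = 1"
        using s \<rho> by (simp add: q2 sum_divide_distrib[symmetric] \<rho>_def power2_eq_square)
      have lm: "(\<Sum>i<p. q' m i * q' l i) = 0" "(\<Sum>i<p. q' l i * q' m i) = 0" if "l < m" for l
        using rq[OF that] that by (simp_all add: q1 q2 sum_divide_distrib[symmetric] mult.commute)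
      have "(\<Sum>i<p. q' k i * q' l i) = of_bool (k = l)"
      proof (cases "k = m"; cases "l = m")
        assume "k \<noteq> m" "l \<noteq> m" thus ?thesis using k l orth'[of k l] by (simp add: q1)
      qed (use k l mm lm in auto)
      thus "(\<Sum>i<p. (\<Sum>j\<in>insert j0 J. B' k j * a j i) * (\<Sum>j\<in>insert j0 J. B' l j * a j i)) = of_bool (k = l)"
        by (simp add: q'_def)
    next
      fix j i assume j: "j \<in> insert j0 J" and i: "i < p"
      have "(\<Sum>k<Suc m. C' j k * q' k i) = (\<Sum>k<m. C' j k * q k i) + C' j m * (r i / s)"
        by (simp add: q2) (auto intro!: sum.cong simp: q1)
      also have "\<dots> = a j i"
      proof (cases "j = j0")
        case True thus ?thesis using s by (simp add: C'_def r_def)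
      next
        case False thus ?thesis using span[of j i] i j by (simp add: C'_def q_def)
      qed
      finally show "a j i = (\<Sum>k<Suc m. C' j k * (\<Sum>j\<in>insert j0 J. B' k j * a j i))" by (simp add: q'_def)
    qed
  qed
qed

section \<open>A mixture component as a weight\<close>

text \<open>
  The Radon--Nikodym density of \<open>c N\<close> with respect to \<open>P\<close> is at most \<open>1\<close> almost everywhere because \<open>c N \<le> P\<close>.  It
  can be changed on null sets, so it may be taken to vanish outside any set of full \<open>N\<close>-measure.
\<close>

lemma dominated_component_density:
  fixes P N :: "'a measure"
  assumes P: "prob_space P" and N: "prob_space N" and sets_N: "sets N = sets P"
    and dom: "\<And>A. A \<in> sets P \<Longrightarrow> ennreal c * emeasure N A \<le> emeasure P A" and c: "0 \<le> c"
    and G: "G \<in> sets P" "emeasure N G = 1"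
  shows "\<exists>h :: 'a \<Rightarrow> real. h \<in> borel_measurable P \<and> (\<forall>x. 0 \<le> h x \<and> h x \<le> 1) \<and> (\<forall>x. x \<notin> G \<longrightarrow> h x = 0) \<and>
    density P (\<lambda>x. ennreal (h x)) = scale_measure (ennreal c) N"
proof -
  interpret P: prob_space P by fact
  interpret N: prob_space N by fact
  have spN: "space N = space P" by (rule sets_eq_imp_space_eq[OF sets_N])
  let ?N = "scale_measure (ennreal c) N"
  have "finite_measure ?N"
    by (rule finite_measureI) (simp add: space_scale_measure N.emeasure_space_1)
  moreover have "sets ?N = sets P" using sets_N by simp
  moreover have "absolutely_continuous P ?N"
    unfolding absolutely_continuous_def
  proof
    fix A assume "A \<in> null_sets P"
    thus "A \<in> null_sets ?N" using dom[of A] sets_N by (auto simp: null_sets_def)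
  qed
  ultimately obtain f where f [measurable]: "f \<in> borel_measurable P" and fN: "density P f = ?N"
    using P.Radon_Nikodym_finite_measure[of ?N] by blast
  have fA: "(\<integral>\<^sup>+x. f x * indicator A x \<partial>P) = ennreal c * emeasure N A" if "A \<in> sets P" for A
    using fN emeasure_density[of f P A] that f by simp
  have f1: "AE x in P. f x \<le> 1"
  proof -
    define A where "A = {x \<in> space P. 1 < f x}"
    have A [measurable]: "A \<in> sets P" unfolding A_def by measurable
    have "(\<integral>\<^sup>+x. (f x - 1) * indicator A x \<partial>P) + emeasure P A = (\<integral>\<^sup>+x. (f x - 1) * indicator A x + indicator A x \<partial>P)"
      by (subst nn_integral_add) auto
    also have "\<dots> = (\<integral>\<^sup>+x. f x * indicator A x \<partial>P)"
      by (intro nn_integral_cong) (auto simp: indicator_def A_def diff_add_cancel_ennreal less_imp_le)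
    also have "\<dots> = ennreal c * emeasure N A" by (rule fA) fact
    also have "\<dots> \<le> emeasure P A" by (rule dom) fact
    finally have "(\<integral>\<^sup>+x. (f x - 1) * indicator A x \<partial>P) + emeasure P A \<le> 0 + emeasure P A" by simp
    hence "(\<integral>\<^sup>+x. (f x - 1) * indicator A x \<partial>P) = 0"
      by (cases "\<integral>\<^sup>+x. (f x - 1) * indicator A x \<partial>P")
         (auto simp: P.emeasure_eq_measure top_unique simp flip: ennreal_plus)
    hence "AE x in P. (f x - 1) * indicator A x = 0"
      by (subst (asm) nn_integral_0_iff_AE) auto
    with AE_space show ?thesis
    proof eventually_elim
      case (elim x)
      show ?case
      proof (rule ccontr)
        assume n: "\<not> f x \<le> 1"
        hence "f x - 1 = 0" using elim by (simp add: A_def)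
        thus False using n by (simp add: diff_eq_0_iff_ennreal)
      qed
    qed
  qed
  define h where "h x = (if x \<in> G then enn2real (min 1 (f x)) else 0)" for x
  have [measurable]: "G \<in> sets P" by fact
  have hm [measurable]: "h \<in> borel_measurable P" unfolding h_def by measurable
  have h_en: "ennreal (h x) = min 1 (f x) * indicator G x" for x
    by (auto simp: h_def indicator_def less_top[symmetric] ennreal_enn2real_if min_def top_unique)
  have h01: "0 \<le> h x \<and> h x \<le> 1" for x
  proof -
    have "ennreal (h x) \<le> 1" unfolding h_en by (auto simp: indicator_def)
    thus ?thesis by (simp add: h_def)
  qed
  have "density P (\<lambda>x. ennreal (h x)) = ?N"
  proof (rule measure_eqI)
    fix A assume "A \<in> sets (density P (\<lambda>x. ennreal (h x)))"
    hence A [measurable]: "A \<in> sets P" by simp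
    have "emeasure (density P (\<lambda>x. ennreal (h x))) A = (\<integral>\<^sup>+x. ennreal (h x) * indicator A x \<partial>P)"
      by (rule emeasure_density) auto
    also have "\<dots> = (\<integral>\<^sup>+x. f x * indicator (A \<inter> G) x \<partial>P)"
      using f1 by (intro nn_integral_cong_AE) (auto simp: h_en indicator_def min_def elim!: eventually_mono)
    also have "\<dots> = ennreal c * emeasure N (A \<inter> G)" by (rule fA) auto
    also have "emeasure N (A \<inter> G) = emeasure N A"
    proof (rule emeasure_eq_AE)
      have "AE x in N. x \<in> G" using G sets_N by (intro N.AE_prob_1) (simp add: measure_def)
      thus "AE x in N. x \<in> A \<inter> G \<longleftrightarrow> x \<in> A" by eventually_elim auto
    qed (auto simp: sets_N)
    finally show "emeasure (density P (\<lambda>x. ennreal (h x))) A = emeasure ?N A" by simp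
  qed (simp add: sets_N)
  thus ?thesis using hm h01 by (intro exI[of _ h]) (auto simp: h_def)
qed

section \<open>Singular values and the operator norm\<close>

definition sq_norm :: "nat \<Rightarrow> (nat \<Rightarrow> real) \<Rightarrow> real" where
  "sq_norm p v = (\<Sum>i<p. (v i)\<^sup>2)"

text \<open>
  A closed subset of a product of compact intervals, in the product topology on all functions; the
  coordinates from \<open>p\<close> on are set to \<open>0\<close>.
\<close>

lemma compact_unit_sphere_functions:
  "compact {v :: nat \<Rightarrow> real. sq_norm p v = 1 \<and> (\<forall>i\<ge>p. v i = 0)}"
proof -
  let ?S = "\<lambda>i. if i < p then {-1..1::real} else {0}"
  have "compactin (product_topology (\<lambda>i. euclidean) UNIV) (Pi\<^sub>E UNIV ?S)"
    by (subst compactin_PiE) (auto simp: compactin_euclidean_iff)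
  hence c: "compact (Pi\<^sub>E UNIV ?S)" by (simp add: euclidean_product_topology compactin_euclidean_iff)
  have cont: "continuous_on UNIV (sq_norm p)"
    unfolding sq_norm_def[abs_def] by (intro continuous_intros continuous_on_product_coordinates)
  have "closed {v. sq_norm p v = 1}"
    by (intro closed_Collect_eq cont continuous_on_const)
  hence "compact (Pi\<^sub>E UNIV ?S \<inter> {v. sq_norm p v = 1})" using c by (intro compact_Int_closed)
  also have "Pi\<^sub>E UNIV ?S \<inter> {v. sq_norm p v = 1} = {v. sq_norm p v = 1 \<and> (\<forall>i\<ge>p. v i = 0)}"
  proof (intro equalityI subsetI)
    fix v assume "v \<in> {v. sq_norm p v = 1 \<and> (\<forall>i\<ge>p. v i = 0)}"
    hence v: "sq_norm p v = 1" "\<And>i. i \<ge> p \<Longrightarrow> v i = 0" by auto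
    have "v i \<in> ?S i" for i
    proof (cases "i < p")
      case True
      hence "(v i)\<^sup>2 \<le> sq_norm p v" unfolding sq_norm_def by (intro member_le_sum) auto
      hence "\<bar>v i\<bar> \<le> 1" using v(1) by (simp add: abs_square_le_1)
      thus ?thesis using True by auto
    qed (use v(2) in auto)
    thus "v \<in> Pi\<^sub>E UNIV ?S \<inter> {v. sq_norm p v = 1}" using v(1) by auto
  next
    fix v assume v: "v \<in> Pi\<^sub>E UNIV ?S \<inter> {v. sq_norm p v = 1}"
    hence "v i \<in> ?S i" for i by (simp add: PiE_iff)
    hence "v i = 0" if "i \<ge> p" for i using that by (metis not_less singletonD)
    thus "v \<in> {v. sq_norm p v = 1 \<and> (\<forall>i\<ge>p. v i = 0)}" using v by simp
  qed
  finally show ?thesis .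
qed

lemma finite_eigenvalues:
  fixes A :: "real mat"
  assumes "A \<in> carrier_mat p p" shows "finite {k. eigenvalue A k}"
proof -
  have "char_poly A \<noteq> 0" using degree_monic_char_poly[OF assms] by auto
  hence "finite {k. poly (char_poly A) k = 0}" by (rule poly_roots_finite)
  thus ?thesis using eigenvalue_root_char_poly[OF assms] by simp
qed

text \<open>
  A maximiser \<open>u\<close> of \<open>\<bar>A v\<bar>\<^sup>2\<close> on the unit sphere is an eigenvector of \<open>A\<^sup>T A\<close>: if \<open>lam\<close> is the maximum, then the form
  \<open>F = lam I - A\<^sup>T A\<close> is positive semidefinite and vanishes at \<open>u\<close>, so \<open>F u = 0\<close> by the Cauchy--Schwarz
  inequality for \<open>F\<close>.  Hence \<open>sqrt lam\<close> is one of the finitely many singular values.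
\<close>

lemma norm_le_s_max:
  assumes A: "A \<in> carrier_mat p p" and p: "0 < p"
  shows "0 \<le> s_max A" "(\<Sum>i<p. (\<Sum>j<p. A $$ (i, j) * v j)\<^sup>2) \<le> (s_max A)\<^sup>2 * sq_norm p v"
proof -
  define Q where "Q v = (\<Sum>i<p. (\<Sum>j<p. A $$ (i, j) * v j)\<^sup>2)" for v
  let ?K = "{v :: nat \<Rightarrow> real. sq_norm p v = 1 \<and> (\<forall>i\<ge>p. v i = 0)}"
  have ne: "?K \<noteq> {}"
  proof -
    have "sq_norm p (\<lambda>i. of_bool (i = 0)) = 1"
      using p by (simp add: sq_norm_def of_bool_def if_distrib[of "\<lambda>x. x\<^sup>2"] sum.delta cong: if_cong)
    thus ?thesis using p by (intro ex_in_conv[THEN iffD1] exI[of _ "\<lambda>i. of_bool (i = 0)"]) auto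
  qed
  have "continuous_on ?K Q"
    unfolding Q_def[abs_def]
    by (rule continuous_on_subset[of UNIV]) (intro continuous_intros continuous_on_product_coordinates, simp)
  then obtain u where u: "sq_norm p u = 1" "\<And>v. v \<in> ?K \<Longrightarrow> Q v \<le> Q u"
    using continuous_attains_sup[OF compact_unit_sphere_functions[of p] ne, of Q] by auto
  define lam where "lam = Q u"
  have l0: "0 \<le> lam" by (simp add: lam_def Q_def sum_nonneg)
  have Qle: "Q v \<le> lam * sq_norm p v" for v
  proof (cases "sq_norm p v = 0")
    case True
    hence "v j = 0" if "j < p" for j using that by (simp add: sq_norm_def sum_nonneg_eq_0_iff)
    thus ?thesis using True by (simp add: Q_def)
  next
    case False
    hence pos: "0 < sq_norm p v" by (simp add: sq_norm_def less_le sum_nonneg)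
    define t where "t = 1 / sqrt (sq_norm p v)"
    have t2: "t\<^sup>2 = 1 / sq_norm p v" using pos by (simp add: t_def power_divide)
    define w where "w = (\<lambda>i. if i < p then t * v i else 0)"
    have "sq_norm p w = t\<^sup>2 * sq_norm p v" by (simp add: sq_norm_def w_def power_mult_distrib sum_distrib_left)
    hence "w \<in> ?K" using pos by (simp add: w_def t2)
    hence "Q w \<le> lam" using u(2) by (simp add: lam_def)
    moreover have "Q w = t\<^sup>2 * Q v"
    proof -
      have "(\<Sum>j<p. A $$ (i, j) * w j) = t * (\<Sum>j<p. A $$ (i, j) * v j)" for i
        by (simp add: w_def sum_distrib_left mult.left_commute)
      thus ?thesis by (simp only: Q_def power_mult_distrib sum_distrib_left[symmetric])
    qed
    ultimately show ?thesis using pos by (simp add: t2 field_simps)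
  qed
  define F where "F i j = lam * of_bool (i = j) - (\<Sum>k<p. A $$ (k, i) * A $$ (k, j))" for i j
  have Fmul: "(\<Sum>j<p. F i j * v j) = lam * v i - (\<Sum>k<p. A $$ (k, i) * (\<Sum>j<p. A $$ (k, j) * v j))" if "i < p" for i v
  proof -
    have "(\<Sum>j<p. F i j * v j) = (\<Sum>j<p. lam * of_bool (i = j) * v j) - (\<Sum>j<p. (\<Sum>k<p. A $$ (k, i) * A $$ (k, j)) * v j)"
      by (simp add: F_def left_diff_distrib sum_subtractf)
    also have "(\<Sum>j<p. lam * of_bool (i = j) * v j) = (\<Sum>j<p. if i = j then lam * v j else 0)"
      by (intro sum.cong) auto
    also have "\<dots> = lam * v i" using that by (simp add: sum.delta')
    also have "(\<Sum>j<p. (\<Sum>k<p. A $$ (k, i) * A $$ (k, j)) * v j) = (\<Sum>j<p. \<Sum>k<p. A $$ (k, i) * (A $$ (k, j) * v j))"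
      by (simp add: sum_distrib_right mult.assoc)
    also have "\<dots> = (\<Sum>k<p. A $$ (k, i) * (\<Sum>j<p. A $$ (k, j) * v j))"
      by (subst sum.swap) (simp add: sum_distrib_left)
    finally show ?thesis .
  qed
  have bilF: "bil p F w v = (\<Sum>i<p. w i * (\<Sum>j<p. F i j * v j))" for w v
    by (simp add: bil_def sum_distrib_left mult.assoc)
  have bilFF: "bil p F v v = lam * sq_norm p v - Q v" for v
  proof -
    have "bil p F v v = (\<Sum>i<p. v i * (lam * v i - (\<Sum>k<p. A $$ (k, i) * (\<Sum>j<p. A $$ (k, j) * v j))))"
      unfolding bilF by (intro sum.cong refl) (simp add: Fmul)
    also have "\<dots> = lam * sq_norm p v - (\<Sum>i<p. \<Sum>k<p. (A $$ (k, i) * v i) * (\<Sum>j<p. A $$ (k, j) * v j))"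
      by (simp add: right_diff_distrib sum_subtractf sq_norm_def sum_distrib_left power2_eq_square mult.left_commute mult.assoc)
    also have "(\<Sum>i<p. \<Sum>k<p. (A $$ (k, i) * v i) * (\<Sum>j<p. A $$ (k, j) * v j)) = Q v"
      by (subst sum.swap) (simp add: Q_def sum_distrib_right[symmetric] power2_eq_square)
    finally show ?thesis .
  qed
  have Fsym: "F i j = F j i" for i j by (auto simp: F_def mult.commute)
  have Fu: "(\<Sum>j<p. F i j * u j) = 0" if "i < p" for i
  proof -
    have "(bil p F (\<lambda>k. of_bool (k = i)) u)\<^sup>2 \<le> bil p F (\<lambda>k. of_bool (k = i)) (\<lambda>k. of_bool (k = i)) * bil p F u u"
    proof (rule bil_Cauchy_Schwarz)
      show "F i j = F j i" for i j by (rule Fsym)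
      show "0 \<le> bil p F v v" for v unfolding bilFF using Qle[of v] by simp
    qed
    also have "bil p F u u = 0" unfolding bilFF u(1) by (simp add: lam_def)
    finally have "bil p F (\<lambda>k. of_bool (k = i)) u = 0" by simp
    thus ?thesis unfolding bilF using that by (simp add: of_bool_def if_distrib[of "\<lambda>x. x * _"] sum.delta cong: if_cong)
  qed
  have AA: "transpose_mat A * A \<in> carrier_mat p p" using A by simp
  have "eigenvector (transpose_mat A * A) (vec p u) lam"
    unfolding eigenvector_def
  proof (intro conjI)
    show "vec p u \<in> carrier_vec (dim_row (transpose_mat A * A))" using A by simp
    show "vec p u \<noteq> 0\<^sub>v (dim_row (transpose_mat A * A))"
    proof
      assume z: "vec p u = 0\<^sub>v (dim_row (transpose_mat A * A))"
      have "u i = 0" if "i < p" for i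
      proof -
        have "vec p u $ i = 0\<^sub>v (dim_row (transpose_mat A * A)) $ i" unfolding z ..
        thus ?thesis using that A by simp
      qed
      hence "sq_norm p u = 0" by (simp add: sq_norm_def)
      thus False using u(1) by simp
    qed
    show "(transpose_mat A * A) *\<^sub>v vec p u = lam \<cdot>\<^sub>v vec p u"
    proof (rule eq_vecI)
      fix i assume "i < dim_vec (lam \<cdot>\<^sub>v vec p u)"
      hence i: "i < p" by simp
      have "((transpose_mat A * A) *\<^sub>v vec p u) $ i = (transpose_mat A *\<^sub>v (A *\<^sub>v vec p u)) $ i"
        using A by (subst assoc_mult_mat_vec[of _ p p _ p]) auto
      also have "\<dots> = (\<Sum>k<p. A $$ (k, i) * (\<Sum>j<p. A $$ (k, j) * u j))"
        using A i by (simp add: scalar_prod_def lessThan_atLeast0)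
      also have "\<dots> = lam * u i" using Fu[OF i] Fmul[OF i, of u] by simp
      finally show "((transpose_mat A * A) *\<^sub>v vec p u) $ i = (lam \<cdot>\<^sub>v vec p u) $ i" using i by simp
    qed (use A in simp)
  qed
  hence ev: "eigenvalue (transpose_mat A * A) ((sqrt lam)\<^sup>2)" using l0 by (auto simp: eigenvalue_def)
  let ?E = "{\<sigma>. 0 \<le> \<sigma> \<and> eigenvalue (transpose_mat A * A) (\<sigma>\<^sup>2)}"
  have "finite ?E"
  proof (rule finite_subset)
    show "?E \<subseteq> sqrt ` {k. eigenvalue (transpose_mat A * A) k}"
    proof
      fix \<sigma> assume "\<sigma> \<in> ?E"
      hence "\<sigma> = sqrt (\<sigma>\<^sup>2)" "eigenvalue (transpose_mat A * A) (\<sigma>\<^sup>2)" by auto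
      thus "\<sigma> \<in> sqrt ` {k. eigenvalue (transpose_mat A * A) k}" by blast
    qed
    show "finite (sqrt ` {k. eigenvalue (transpose_mat A * A) k})" using finite_eigenvalues[OF AA] by simp
  qed
  hence le: "sqrt lam \<le> s_max A" unfolding s_max_def using ev l0 by (intro Max_ge) auto
  show "0 \<le> s_max A" using le l0 real_sqrt_ge_zero[of lam] by linarith
  have "lam = (sqrt lam)\<^sup>2" using l0 by simp
  also have "\<dots> \<le> (s_max A)\<^sup>2" using le l0 by (intro power_mono) auto
  finally have "lam * sq_norm p v \<le> (s_max A)\<^sup>2 * sq_norm p v" by (intro mult_right_mono) (auto simp: sq_norm_def sum_nonneg)
  thus "(\<Sum>i<p. (\<Sum>j<p. A $$ (i, j) * v j)\<^sup>2) \<le> (s_max A)\<^sup>2 * sq_norm p v" using Qle[of v] by (simp add: Q_def)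
qed

lemma quadratic_form_le_s_max:
  assumes A: "A \<in> carrier_mat p p" and p: "0 < p"
  shows "bil p (\<lambda>i j. A $$ (i, j)) v v \<le> s_max A * sq_norm p v"
proof -
  have "bil p (\<lambda>i j. A $$ (i, j)) v v = (\<Sum>i<p. v i * (\<Sum>j<p. A $$ (i, j) * v j))"
    by (simp add: bil_def sum_distrib_left mult.assoc)
  also have "\<dots> \<le> (\<Sum>i<p. \<bar>v i\<bar> * \<bar>\<Sum>j<p. A $$ (i, j) * v j\<bar>)"
    by (intro sum_mono) (simp add: abs_mult[symmetric])
  also have "\<dots> \<le> L2_set v {..<p} * L2_set (\<lambda>i. \<Sum>j<p. A $$ (i, j) * v j) {..<p}"
    by (rule L2_set_mult_ineq)
  also have "\<dots> \<le> L2_set v {..<p} * sqrt ((s_max A)\<^sup>2 * sq_norm p v)"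
    unfolding L2_set_def[of "\<lambda>i. \<Sum>j<p. A $$ (i, j) * v j"]
    by (intro mult_left_mono real_sqrt_le_mono norm_le_s_max[OF A p]) (rule L2_set_nonneg)
  also have "\<dots> = s_max A * sq_norm p v"
    using norm_le_s_max(1)[OF A p] by (simp add: L2_set_def sq_norm_def real_sqrt_mult sum_nonneg)
  finally show ?thesis .
qed

lemma l2_norm_sq_norm: "v \<in> carrier_vec p \<Longrightarrow> l2_norm v = sqrt (sq_norm p (\<lambda>i. v $ i))"
  by (auto simp: l2_norm_def scalar_prod_def sq_norm_def lessThan_atLeast0 power2_eq_square)

text \<open>
  Polarisation: for \<open>w = D u\<close> and \<open>t = \<bar>w\<bar>\<close>, the values of the form at \<open>w + t u\<close> and \<open>w - t u\<close> differ by \<open>4 t\<^sup>3\<close>, while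
  their bounds add up to \<open>4 \<kappa> t\<^sup>2\<close>.
\<close>

lemma op_norm_le_quadratic_form:
  assumes D: "D \<in> carrier_mat p p" and sym: "\<And>i j. i < p \<Longrightarrow> j < p \<Longrightarrow> D $$ (i, j) = D $$ (j, i)"
    and p: "0 < p" and \<kappa>: "\<And>v. \<bar>bil p (\<lambda>i j. D $$ (i, j)) v v\<bar> \<le> \<kappa> * sq_norm p v"
  shows "op_norm p D \<le> \<kappa>" "0 \<le> op_norm p D"
proof -
  let ?b = "bil p (\<lambda>i j. D $$ (i, j))"
  have bound: "l2_norm (D *\<^sub>v u) \<le> \<kappa>" if u: "u \<in> unit_sphere p" for u
  proof -
    have uc: "u \<in> carrier_vec p" and u1: "l2_norm u = 1" using u by (auto simp: unit_sphere_def)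
    have su: "sq_norm p (\<lambda>i. u $ i) = 1" using u1 l2_norm_sq_norm[OF uc] by simp
    define w where "w = (\<lambda>i. (D *\<^sub>v u) $ i)"
    define t where "t = l2_norm (D *\<^sub>v u)"
    have wc: "D *\<^sub>v u \<in> carrier_vec p" using D uc by simp
    have sw: "sq_norm p w = t\<^sup>2"
      using l2_norm_sq_norm[OF wc] by (simp add: t_def w_def sq_norm_def sum_nonneg)
    have t0: "0 \<le> t" unfolding t_def l2_norm_sq_norm[OF wc] by (simp add: sq_norm_def sum_nonneg)
    have bwu: "?b w (\<lambda>i. u $ i) = t\<^sup>2"
    proof -
      have "?b w (\<lambda>i. u $ i) = (\<Sum>i<p. w i * (\<Sum>j<p. D $$ (i, j) * u $ j))"
        by (simp add: bil_def sum_distrib_left mult.assoc)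
      also have "\<dots> = sq_norm p w" unfolding sq_norm_def
        using D uc by (intro sum.cong) (auto simp: w_def scalar_prod_def lessThan_atLeast0 power2_eq_square)
      finally show ?thesis using sw by simp
    qed
    have e1: "?b (\<lambda>i. w i + t * u $ i) (\<lambda>i. w i + t * u $ i) = ?b w w + 2 * t * ?b w (\<lambda>i. u $ i) + t\<^sup>2 * ?b (\<lambda>i. u $ i) (\<lambda>i. u $ i)"
      by (rule bil_expand) (rule sym)
    have e2: "?b (\<lambda>i. w i + (- t) * u $ i) (\<lambda>i. w i + (- t) * u $ i) = ?b w w + 2 * (- t) * ?b w (\<lambda>i. u $ i) + (- t)\<^sup>2 * ?b (\<lambda>i. u $ i) (\<lambda>i. u $ i)"
      by (rule bil_expand) (rule sym)
    have s: "sq_norm p (\<lambda>i. w i + t * u $ i) + sq_norm p (\<lambda>i. w i + (- t) * u $ i) = 2 * sq_norm p w + 2 * (t\<^sup>2 * sq_norm p (\<lambda>i. u $ i))"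
      by (simp add: sq_norm_def sum.distrib[symmetric] sum_distrib_left power2_eq_square algebra_simps)
    have "4 * t * t\<^sup>2 = ?b (\<lambda>i. w i + t * u $ i) (\<lambda>i. w i + t * u $ i) - ?b (\<lambda>i. w i + (- t) * u $ i) (\<lambda>i. w i + (- t) * u $ i)"
      unfolding e1 e2 bwu by simp
    also have "\<dots> \<le> \<kappa> * sq_norm p (\<lambda>i. w i + t * u $ i) + \<kappa> * sq_norm p (\<lambda>i. w i + (- t) * u $ i)"
      using \<kappa>[of "\<lambda>i. w i + t * u $ i"] \<kappa>[of "\<lambda>i. w i + (- t) * u $ i"] by linarith
    also have "\<dots> = \<kappa> * (4 * t\<^sup>2)" unfolding distrib_left[symmetric] s sw su by simp
    finally have le: "t * t\<^sup>2 \<le> \<kappa> * t\<^sup>2" by simp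
    show ?thesis
    proof (cases "t = 0")
      case True
      have "0 \<le> \<bar>?b (\<lambda>i. u $ i) (\<lambda>i. u $ i)\<bar>" by simp
      also have "\<dots> \<le> \<kappa>" using \<kappa>[of "\<lambda>i. u $ i"] su by simp
      finally show ?thesis using True by (simp add: t_def)
    next
      case False
      hence "0 < t\<^sup>2" by simp
      thus ?thesis using le by (simp add: t_def)
    qed
  qed
  have e: "unit_vec p 0 \<in> unit_sphere p"
    using p by (simp add: unit_sphere_def l2_norm_def)
  show "op_norm p D \<le> \<kappa>" unfolding op_norm_def using bound e by (intro cSUP_least) auto
  have "0 \<le> l2_norm (D *\<^sub>v unit_vec p 0)"
    unfolding l2_norm_sq_norm[OF mult_mat_vec_carrier[OF D unit_vec_carrier]] by (simp add: sq_norm_def sum_nonneg)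
  also have "\<dots> \<le> op_norm p D" unfolding op_norm_def
    using bound e by (intro cSUP_upper bdd_aboveI2[of _ _ \<kappa>]) auto
  finally show "0 \<le> op_norm p D" .
qed

text \<open>
  The form splits into its restriction to a block of size \<open>2 s\<close> and a diagonal remainder, and the diagonal
  entries are the values at unit vectors, which are sparse.
\<close>

lemma sparse_quadratic_form:
  assumes T: "T \<subseteq> {..<p}" "card T \<le> 2 * s" and s: "1 \<le> s" "2 * s \<le> p"
    and D: "D \<in> carrier_mat p p" and off: "\<And>i j. i < p \<Longrightarrow> j < p \<Longrightarrow> i \<noteq> j \<Longrightarrow> i \<notin> T \<or> j \<notin> T \<Longrightarrow> D $$ (i, j) = 0"
    and \<kappa>: "\<And>u. u \<in> U_sparse p s \<Longrightarrow> \<bar>bil p (\<lambda>i j. D $$ (i, j)) (\<lambda>i. u $ i) (\<lambda>i. u $ i)\<bar> \<le> \<kappa>"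
  shows "\<bar>bil p (\<lambda>i j. D $$ (i, j)) v v\<bar> \<le> \<kappa> * sq_norm p v"
proof -
  let ?b = "bil p (\<lambda>i j. D $$ (i, j))"
  obtain S where S: "T \<subseteq> S" "S \<subseteq> {..<p}" "card S = 2 * s"
    using exists_subset_between[of T "2 * s" "{..<p}"] T s by auto
  have hom: "\<bar>?b w w\<bar> \<le> \<kappa> * sq_norm p w" if R: "R \<subseteq> {..<p}" "card R = 2 * s" "\<And>i. i < p \<Longrightarrow> i \<notin> R \<Longrightarrow> w i = 0" for R w
  proof (cases "sq_norm p w = 0")
    case True
    hence "w i = 0" if "i < p" for i using that by (simp add: sq_norm_def sum_nonneg_eq_0_iff)
    thus ?thesis using True by (simp add: bil_def)
  next
    case False
    hence pos: "0 < sq_norm p w" by (simp add: sq_norm_def less_le sum_nonneg)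
    define t where "t = 1 / sqrt (sq_norm p w)"
    have t2: "t\<^sup>2 = 1 / sq_norm p w" using pos by (simp add: t_def power_divide)
    define u where "u = vec p (\<lambda>i. t * w i)"
    have "sq_norm p (\<lambda>i. u $ i) = t\<^sup>2 * sq_norm p w" by (simp add: sq_norm_def u_def power_mult_distrib sum_distrib_left)
    hence "sq_norm p (\<lambda>i. u $ i) = 1" using pos by (simp add: t2)
    hence "u \<in> V_supp p R" using R(3) by (auto simp: V_supp_def unit_sphere_def l2_norm_sq_norm[of _ p] u_def)
    hence "u \<in> U_sparse p s" using R by (auto simp: U_sparse_def)
    hence "\<bar>?b (\<lambda>i. u $ i) (\<lambda>i. u $ i)\<bar> \<le> \<kappa>" by (rule \<kappa>)
    moreover have "?b (\<lambda>i. u $ i) (\<lambda>i. u $ i) = t\<^sup>2 * ?b w w"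
      by (simp add: bil_def u_def sum_distrib_left power2_eq_square mult_ac)
    ultimately show ?thesis using pos by (simp add: t2 abs_mult field_simps)
  qed
  define w where "w = (\<lambda>i. if i \<in> S then v i else 0)"
  have hw: "\<bar>?b w w\<bar> \<le> \<kappa> * sq_norm p w" by (rule hom[of S]) (use S in \<open>auto simp: w_def\<close>)
  have diag: "\<bar>D $$ (i, i)\<bar> \<le> \<kappa>" if i: "i < p" for i
  proof -
    obtain R where R: "{i} \<subseteq> R" "R \<subseteq> {..<p}" "card R = 2 * s"
      using exists_subset_between[of "{i}" "2 * s" "{..<p}"] i s by auto
    have "\<bar>?b (\<lambda>k. of_bool (k = i)) (\<lambda>k. of_bool (k = i))\<bar> \<le> \<kappa> * sq_norm p (\<lambda>k. of_bool (k = i))"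
      by (rule hom[of R]) (use R in auto)
    moreover have "sq_norm p (\<lambda>k. of_bool (k = i)) = 1"
      using i by (simp add: sq_norm_def of_bool_def if_distrib[of "\<lambda>x. x\<^sup>2"] sum.delta cong: if_cong)
    moreover have "?b (\<lambda>k. of_bool (k = i)) (\<lambda>k. of_bool (k = i)) = D $$ (i, i)"
      unfolding bil_delta[OF i] using i by (simp add: of_bool_def if_distrib[of "\<lambda>x. x * _"] sum.delta cong: if_cong)
    ultimately show ?thesis by simp
  qed
  have "?b v v = (\<Sum>i<p. \<Sum>j<p. w i * D $$ (i, j) * w j + (if i = j then (if i \<in> S then 0 else D $$ (i, i) * (v i)\<^sup>2) else 0))"
    unfolding bil_def
  proof (intro sum.cong refl)
    fix i j assume "i \<in> {..<p}" "j \<in> {..<p}"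
    hence ij: "i < p" "j < p" by auto
    show "v i * D $$ (i, j) * v j = w i * D $$ (i, j) * w j + (if i = j then (if i \<in> S then 0 else D $$ (i, i) * (v i)\<^sup>2) else 0)"
      using off[OF ij] S(1) by (auto simp: w_def power2_eq_square)
  qed
  also have "\<dots> = ?b w w + (\<Sum>i<p. if i \<in> S then 0 else D $$ (i, i) * (v i)\<^sup>2)"
    by (simp add: sum.distrib bil_def sum.delta')
  finally have split: "?b v v = ?b w w + (\<Sum>i<p. if i \<in> S then 0 else D $$ (i, i) * (v i)\<^sup>2)" .
  have "\<bar>\<Sum>i<p. if i \<in> S then 0 else D $$ (i, i) * (v i)\<^sup>2\<bar> \<le> (\<Sum>i<p. if i \<in> S then 0 else \<kappa> * (v i)\<^sup>2)"
  proof (rule order.trans[OF sum_abs sum_mono])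
    fix i assume "i \<in> {..<p}"
    thus "\<bar>if i \<in> S then 0 else D $$ (i, i) * (v i)\<^sup>2\<bar> \<le> (if i \<in> S then 0 else \<kappa> * (v i)\<^sup>2)"
      using diag[of i] by (auto simp: abs_mult mult_right_mono)
  qed
  moreover have "\<kappa> * sq_norm p w + (\<Sum>i<p. if i \<in> S then 0 else \<kappa> * (v i)\<^sup>2) = \<kappa> * sq_norm p v"
    unfolding sq_norm_def sum_distrib_left sum.distrib[symmetric] by (intro sum.cong) (auto simp: w_def)
  ultimately show ?thesis using split hw by linarith
qed

section \<open>Deviations over sparse directions\<close>

lemma sum_supported:
  fixes p :: nat
  assumes "S \<subseteq> {..<p}" "\<And>i. i < p \<Longrightarrow> i \<notin> S \<Longrightarrow> u i = 0"
  shows "(\<Sum>i<p. u i * f i) = (\<Sum>i\<in>S. u i * (f i :: real))"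
  using assms by (intro sum.mono_neutral_right) auto

text \<open>
  Here \<open>N\<close> is the law of \<open>x = a z\<close> with standard normal \<open>z\<close>.  Orthonormalising the rows \<open>a\<^sub>j\<close> with \<open>j \<in> S\<close> gives
  independent standard normal variables \<open>Y k\<close>, which are linear combinations of the coordinates of \<open>x\<close>
  itself.  Conversely, the coordinates in \<open>S\<close> are linear combinations of the \<open>Y k\<close>; this holds on the range
  of \<open>a\<close>, so the exceptional set is the same null set for all \<open>u\<close>.
\<close>

lemma gaussian_frame:
  fixes a :: "nat \<Rightarrow> nat \<Rightarrow> real" and p :: nat
  defines "N \<equiv> distr (\<Pi>\<^sub>M i\<in>{..<p}. SN) (Rp p) (\<lambda>z. \<lambda>i\<in>{..<p}. \<Sum>k<p. a i k * z k)"
  assumes S: "S \<subseteq> {..<p}"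
  shows "\<exists>m Y c G. m \<le> card S \<and> (\<forall>k. Y k \<in> borel_measurable (Rp p)) \<and>
    (\<forall>z. distr N borel (\<lambda>x. \<Sum>k<m. z k * Y k x) = distr SN borel (\<lambda>g. L2_set z {..<m} * g)) \<and>
    G \<in> sets (Rp p) \<and> emeasure N G = 1 \<and>
    (\<forall>u. (\<forall>i<p. i \<notin> S \<longrightarrow> u i = 0) \<longrightarrow>
      L2_set (c u) {..<m} = L2_set (\<lambda>k. \<Sum>i<p. u i * a i k) {..<p} \<and>
      (\<forall>x\<in>G. (\<Sum>i<p. u i * x i) = (\<Sum>k<m. c u k * Y k x)))"
proof -
  have finS: "finite S" using S by (rule finite_subset) simp
  have Sp: "j < p" if "j \<in> S" for j using that S by auto
  obtain m :: nat and B :: "nat \<Rightarrow> nat \<Rightarrow> real" and C :: "nat \<Rightarrow> nat \<Rightarrow> real" where m: "m \<le> card S"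
    and orth: "\<forall>k<m. \<forall>l<m. (\<Sum>i<p. (\<Sum>j\<in>S. B k j * a j i) * (\<Sum>j\<in>S. B l j * a j i)) = of_bool (k = l)"
    and span: "\<forall>j\<in>S. \<forall>i<p. a j i = (\<Sum>k<m. C j k * (\<Sum>j\<in>S. B k j * a j i))"
    using gram_schmidt_coordinates[OF finS, where p = p and a = a] by blast
  define q where "q k i = (\<Sum>j\<in>S. B k j * a j i)" for k i
  define Y where "Y k x = (\<Sum>j\<in>S. B k j * x j)" for k and x :: "nat \<Rightarrow> real"
  define c where "c u k = (\<Sum>j\<in>S. u j * C j k)" for u :: "nat \<Rightarrow> real" and k
  define G where "G = {x \<in> space (Rp p). \<forall>j\<in>S. x j = (\<Sum>k<m. C j k * Y k x)}"
  define A where "A z = (\<lambda>i\<in>{..<p}. \<Sum>k<p. a i k * z k)" for z :: "nat \<Rightarrow> real"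
  let ?PP = "\<Pi>\<^sub>M i\<in>{..<p}. SN"
  have coord [measurable]: "(\<lambda>x. x j) \<in> borel_measurable (Rp p)" if "j \<in> S" for j
    unfolding Rp_def using Sp[OF that] by (intro measurable_component_singleton) simp
  have coord': "(\<lambda>z. z k) \<in> borel_measurable ?PP" if "k < p" for k
    using measurable_component_singleton[of k "{..<p}" "\<lambda>_. SN"] that by (simp cong: measurable_cong_sets)
  have A_meas: "A \<in> measurable ?PP (Rp p)"
    unfolding Rp_def A_def[abs_def]
    by (intro measurable_restrict borel_measurable_sum borel_measurable_times borel_measurable_const coord') auto
  have Y_meas: "Y k \<in> borel_measurable (Rp p)" for k
    unfolding Y_def[abs_def] by (intro borel_measurable_sum borel_measurable_times borel_measurable_const coord)
  have N_A: "N = distr ?PP (Rp p) A" unfolding N_def A_def[abs_def] ..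
  have AY: "Y k (A z) = (\<Sum>i<p. q k i * z i)" for k z
  proof -
    have "Y k (A z) = (\<Sum>j\<in>S. \<Sum>i<p. B k j * a j i * z i)"
      unfolding Y_def using Sp by (intro sum.cong) (auto simp: A_def sum_distrib_left mult.assoc)
    also have "\<dots> = (\<Sum>i<p. q k i * z i)"
      by (subst sum.swap) (simp add: q_def sum_distrib_right)
    finally show ?thesis .
  qed
  have orthL2: "L2_set (\<lambda>i. \<Sum>k<m. z k * q k i) {..<p} = L2_set z {..<m}" for z
  proof -
    have "(\<Sum>i<p. (\<Sum>k<m. z k * q k i)\<^sup>2) = (\<Sum>i<p. \<Sum>k<m. \<Sum>l<m. z k * z l * (q k i * q l i))"
      by (simp add: power2_eq_square sum_product mult_ac)
    also have "\<dots> = (\<Sum>k<m. \<Sum>i<p. \<Sum>l<m. z k * z l * (q k i * q l i))" by (rule sum.swap)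
    also have "\<dots> = (\<Sum>k<m. \<Sum>l<m. \<Sum>i<p. z k * z l * (q k i * q l i))" by (intro sum.cong refl sum.swap)
    also have "\<dots> = (\<Sum>k<m. \<Sum>l<m. z k * z l * of_bool (k = l))"
      unfolding sum_distrib_left[symmetric] using orth by (intro sum.cong refl) (simp add: q_def)
    also have "\<dots> = (\<Sum>k<m. \<Sum>l<m. if k = l then z k * z l else 0)" by (intro sum.cong refl) simp
    also have "\<dots> = (\<Sum>k<m. (z k)\<^sup>2)" by (simp add: sum.delta' power2_eq_square)
    finally show ?thesis by (simp add: L2_set_def)
  qed
  have G_meas: "G \<in> sets (Rp p)"
  proof -
    have "{x \<in> space (Rp p). x j = (\<Sum>k<m. C j k * Y k x)} \<in> sets (Rp p)" if "j \<in> S" for j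
      using coord[OF that, measurable] Y_meas[measurable] by measurable
    thus ?thesis unfolding G_def using finS by (intro sets.sets_Collect_finite_All) auto
  qed
  have AG: "A z \<in> G" for z
  proof -
    have "A z j = (\<Sum>k<m. C j k * Y k (A z))" if j: "j \<in> S" for j
    proof -
      have "A z j = (\<Sum>i<p. a j i * z i)" using Sp[OF j] by (simp add: A_def)
      also have "\<dots> = (\<Sum>i<p. (\<Sum>k<m. C j k * q k i) * z i)"
        using span j by (intro sum.cong refl) (simp add: q_def)
      also have "\<dots> = (\<Sum>i<p. \<Sum>k<m. C j k * (q k i * z i))" by (simp add: sum_distrib_right mult.assoc)
      also have "\<dots> = (\<Sum>k<m. C j k * Y k (A z))" by (subst sum.swap) (simp add: AY sum_distrib_left)
      finally show ?thesis .
    qed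
    moreover have "A z \<in> space (Rp p)" by (simp add: A_def Rp_def space_PiM)
    ultimately show ?thesis by (simp add: G_def)
  qed
  interpret fp: finite_product_prob_space "\<lambda>_::nat. SN" "{..<p}"
  proof -
    interpret SN: prob_space SN by (rule prob_space_SN)
    show "finite_product_prob_space (\<lambda>_::nat. SN) {..<p}" by unfold_locales auto
  qed
  have "emeasure N G = emeasure ?PP (A -` G \<inter> space ?PP)" unfolding N_A by (rule emeasure_distr[OF A_meas G_meas])
  also have "A -` G \<inter> space ?PP = space ?PP" using AG by auto
  finally have G1: "emeasure N G = 1" by (simp add: fp.emeasure_space_1)
  have gauss: "distr N borel (\<lambda>x. \<Sum>k<m. z k * Y k x) = distr SN borel (\<lambda>g. L2_set z {..<m} * g)" for z
  proof -
    have "distr N borel (\<lambda>x. \<Sum>k<m. z k * Y k x) = distr ?PP borel ((\<lambda>x. \<Sum>k<m. z k * Y k x) \<circ> A)"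
      unfolding N_A using Y_meas by (intro distr_distr A_meas borel_measurable_sum borel_measurable_times) auto
    also have "(\<lambda>x. \<Sum>k<m. z k * Y k x) \<circ> A = (\<lambda>y. \<Sum>i<p. (\<Sum>k<m. z k * q k i) * y i)"
    proof
      fix y
      have "((\<lambda>x. \<Sum>k<m. z k * Y k x) \<circ> A) y = (\<Sum>k<m. \<Sum>i<p. z k * q k i * y i)"
        by (simp add: AY sum_distrib_left mult.assoc)
      also have "\<dots> = (\<Sum>i<p. (\<Sum>k<m. z k * q k i) * y i)" by (subst sum.swap) (simp add: sum_distrib_right)
      finally show "((\<lambda>x. \<Sum>k<m. z k * Y k x) \<circ> A) y = (\<Sum>i<p. (\<Sum>k<m. z k * q k i) * y i)" .
    qed
    also have "distr ?PP borel (\<lambda>y. \<Sum>i<p. (\<Sum>k<m. z k * q k i) * y i) = distr SN borel (\<lambda>g. L2_set z {..<m} * g)"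
      unfolding gaussian_linear_form orthL2 ..
    finally show ?thesis .
  qed
  have repr: "L2_set (c u) {..<m} = L2_set (\<lambda>k. \<Sum>i<p. u i * a i k) {..<p} \<and>
      (\<forall>x\<in>G. (\<Sum>i<p. u i * x i) = (\<Sum>k<m. c u k * Y k x))" if u: "\<forall>i<p. i \<notin> S \<longrightarrow> u i = 0" for u
  proof (intro conjI ballI)
    have "(\<Sum>i<p. u i * a i l) = (\<Sum>k<m. c u k * q k l)" if l: "l < p" for l
    proof -
      have "(\<Sum>i<p. u i * a i l) = (\<Sum>j\<in>S. u j * a j l)" using S u by (intro sum_supported) auto
      also have "\<dots> = (\<Sum>j\<in>S. u j * (\<Sum>k<m. C j k * q k l))"
        using span l by (intro sum.cong refl) (simp add: q_def)
      also have "\<dots> = (\<Sum>j\<in>S. \<Sum>k<m. (u j * C j k) * q k l)" by (simp add: sum_distrib_left mult.assoc)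
      also have "\<dots> = (\<Sum>k<m. c u k * q k l)" by (subst sum.swap) (simp add: c_def sum_distrib_right)
      finally show ?thesis .
    qed
    hence "L2_set (\<lambda>k. \<Sum>i<p. u i * a i k) {..<p} = L2_set (\<lambda>l. \<Sum>k<m. c u k * q k l) {..<p}"
      by (intro L2_set_cong) auto
    thus "L2_set (c u) {..<m} = L2_set (\<lambda>k. \<Sum>i<p. u i * a i k) {..<p}" unfolding orthL2 by simp
  next
    fix x assume x: "x \<in> G"
    have "(\<Sum>i<p. u i * x i) = (\<Sum>j\<in>S. u j * x j)" using S u by (intro sum_supported) auto
    also have "\<dots> = (\<Sum>j\<in>S. u j * (\<Sum>k<m. C j k * Y k x))"
      using x by (intro sum.cong refl) (simp add: G_def)
    also have "\<dots> = (\<Sum>j\<in>S. \<Sum>k<m. (u j * C j k) * Y k x)" by (simp add: sum_distrib_left mult.assoc)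
    also have "\<dots> = (\<Sum>k<m. c u k * Y k x)" by (subst sum.swap) (simp add: c_def sum_distrib_right)
    finally show "(\<Sum>i<p. u i * x i) = (\<Sum>k<m. c u k * Y k x)" .
  qed
  show ?thesis
    using m Y_meas gauss G_meas G1 repr
    by (intro exI[of _ m] exI[of _ Y] exI[of _ c] exI[of _ G]) blast
qed

text \<open>
  The weight \<open>h\<close> is made to vanish off the intersection of the full-measure sets of all frames.  Every sample
  point with positive weight therefore respects the degeneracies of the covariance matrix exactly, in
  all sparse directions at once.  The deviation bound follows from the one on the unit sphere by rescaling
  and a union bound over the supports.
\<close>

lemma sparse_hit_deviation:
  fixes a :: "nat \<Rightarrow> nat \<Rightarrow> real" and P :: "(nat \<Rightarrow> real) measure" and p n r :: nat and \<epsilon> H :: real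
  defines "N \<equiv> distr (\<Pi>\<^sub>M i\<in>{..<p}. SN) (Rp p) (\<lambda>z. \<lambda>i\<in>{..<p}. \<Sum>k<p. a i k * z k)"
  assumes P: "prob_space P" "sets P = sets (Rp p)" and eps: "0 \<le> \<epsilon>" "\<epsilon> \<le> 1"
    and dom: "\<And>B. B \<in> sets P \<Longrightarrow> ennreal (1 - \<epsilon>) * emeasure N B \<le> emeasure P B"
    and n: "0 < n" and H: "0 \<le> H" and rH: "real r + H \<le> real n" and r: "0 < r"
  defines "e \<equiv> sqrt ((real r + H) / real n)"
  shows "\<exists>h::(nat \<Rightarrow> real) \<Rightarrow> real. (\<forall>x. 0 \<le> h x \<and> h x \<le> 1) \<and>
    (\<forall>x u S. S \<subseteq> {..<p} \<longrightarrow> card S = r \<longrightarrow> (\<forall>i<p. i \<notin> S \<longrightarrow> u i = 0) \<longrightarrow> h x \<noteq> 0 \<longrightarrow>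
       L2_set (\<lambda>k. \<Sum>i<p. u i * a i k) {..<p} = 0 \<longrightarrow> (\<Sum>i<p. u i * x i) = 0) \<and>
    (\<exists>B\<in>sets (\<Pi>\<^sub>M i\<in>{..<n}. P). measure (\<Pi>\<^sub>M i\<in>{..<n}. P) B \<le> 2 * exp (- H) \<and>
      (\<forall>X\<in>space (\<Pi>\<^sub>M i\<in>{..<n}. P) - B. \<bar>(\<Sum>i<n. h (X i)) / real n - (1 - \<epsilon>)\<bar> \<le> 225 * e)) \<and>
    (\<forall>t. \<exists>B\<in>sets (\<Pi>\<^sub>M i\<in>{..<n}. P). measure (\<Pi>\<^sub>M i\<in>{..<n}. P) B \<le> real (p choose r) * (5 * exp (- H)) \<and>
      (\<forall>X\<in>space (\<Pi>\<^sub>M i\<in>{..<n}. P) - B. \<forall>u S. S \<subseteq> {..<p} \<longrightarrow> card S = r \<longrightarrow> (\<forall>i<p. i \<notin> S \<longrightarrow> u i = 0) \<longrightarrow>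
        0 < L2_set (\<lambda>k. \<Sum>i<p. u i * a i k) {..<p} \<longrightarrow>
        \<bar>(\<Sum>i<n. h (X i) * of_bool (\<bar>\<Sum>j<p. u j * X i j\<bar> \<le> t * L2_set (\<lambda>k. \<Sum>i<p. u i * a i k) {..<p})) / real n
           - (1 - \<epsilon>) * half_normal_cdf t\<bar> \<le> 225 * e))"
proof -
  let ?PP = "\<Pi>\<^sub>M i\<in>{..<n}. P"
  let ?\<sigma> = "\<lambda>u. L2_set (\<lambda>k. \<Sum>i<p. u i * a i k) {..<p}"
  let ?supp = "\<lambda>u S. \<forall>i<p. i \<notin> S \<longrightarrow> u i = 0"
  interpret P: prob_space P by fact
  interpret prP: product_prob_space "\<lambda>_::nat. P" by unfold_locales
  interpret fp: finite_product_prob_space "\<lambda>_::nat. P" "{..<n}" by unfold_locales auto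
  have prob_N: "prob_space N" unfolding N_def by (rule prob_space_linear_image)
  interpret N: prob_space N by (rule prob_N)
  have sets_N: "sets N = sets P" using P(2) by (simp add: N_def)
  have meas_RP: "borel_measurable (Rp p) = borel_measurable P" using P(2) by (intro measurable_cong_sets) auto
  define SS where "SS = {S. S \<subseteq> {..<p} \<and> card S = r}"
  have SS: "finite SS" "card SS = p choose r"
    using n_subsets[of "{..<p}" r] by (auto simp: SS_def)
  define Frame where "Frame S m Y c G \<longleftrightarrow> m \<le> card S \<and> (\<forall>k. Y k \<in> borel_measurable (Rp p)) \<and>
    (\<forall>z. distr N borel (\<lambda>x. \<Sum>k<m. z k * Y k x) = distr SN borel (\<lambda>g. L2_set z {..<m} * g)) \<and>
    G \<in> sets (Rp p) \<and> emeasure N G = 1 \<and>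
    (\<forall>u. ?supp u S \<longrightarrow> L2_set (c u) {..<m} = ?\<sigma> u \<and>
      (\<forall>x\<in>G. (\<Sum>i<p. u i * x i) = (\<Sum>k<m. c u k * Y k x)))"
    for S and m :: nat and Y :: "nat \<Rightarrow> (nat \<Rightarrow> real) \<Rightarrow> real"
      and c :: "(nat \<Rightarrow> real) \<Rightarrow> nat \<Rightarrow> real" and G :: "(nat \<Rightarrow> real) set"
  have "\<exists>m Y c G. Frame S m Y c G" if "S \<in> SS" for S
    unfolding Frame_def by (rule gaussian_frame[where p = p and a = a, folded N_def]) (use that in \<open>simp add: SS_def\<close>)
  hence "\<exists>m Y c G. \<forall>S\<in>SS. Frame S (m S) (Y S) (c S) (G S)" by metis
  then obtain m Y c G where fr0: "\<forall>S\<in>SS. Frame S (m S) (Y S) (c S) (G S)" by (elim exE)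
  note F = bspec[OF fr0, unfolded Frame_def]
  note fr = F[THEN conjunct1]
    F[THEN conjunct2, THEN conjunct1]
    F[THEN conjunct2, THEN conjunct2, THEN conjunct1]
    F[THEN conjunct2, THEN conjunct2, THEN conjunct2, THEN conjunct1]
    F[THEN conjunct2, THEN conjunct2, THEN conjunct2, THEN conjunct2, THEN conjunct1]
    F[THEN conjunct2, THEN conjunct2, THEN conjunct2, THEN conjunct2, THEN conjunct2]
  have m: "m S \<le> r" if "S \<in> SS" for S using fr(1)[OF that] that by (simp add: SS_def)
  have Y: "Y S k \<in> borel_measurable P" if "S \<in> SS" for S k using fr(2)[OF that] unfolding meas_RP by blast
  have gauss: "distr N borel (\<lambda>x. \<Sum>k<m S. z k * Y S k x) = distr SN borel (\<lambda>g. L2_set z {..<m S} * g)"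
    if "S \<in> SS" for S z by (rule fr(3)[OF that, rule_format])
  have G: "G S \<in> sets P" "emeasure N (G S) = 1" if "S \<in> SS" for S using fr(4,5)[OF that] P(2) by auto
  have cL: "L2_set (c S u) {..<m S} = ?\<sigma> u" if "S \<in> SS" "?supp u S" for S u
    using fr(6)[OF that(1)] that(2) by blast
  have cx: "(\<Sum>i<p. u i * x i) = (\<Sum>k<m S. c S u k * Y S k x)" if "S \<in> SS" "?supp u S" "x \<in> G S" for S u x
    using fr(6)[OF that(1)] that(2,3) by blast
  define G0 where "G0 = space P \<inter> (\<Inter>S\<in>SS. G S)"
  have G0s: "G0 \<in> sets P" unfolding G0_def using G(1) SS(1) by (cases "SS = {}") auto
  have "AE x in N. x \<in> G0"
  proof -
    have "AE x in N. \<forall>S\<in>SS. x \<in> G S"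
      using G sets_N SS(1) by (intro AE_finite_allI N.AE_prob_1) (auto simp: measure_def)
    with AE_space show ?thesis by eventually_elim (auto simp: G0_def sets_eq_imp_space_eq[OF sets_N])
  qed
  hence "N.prob G0 = 1" using G0s sets_N by (subst N.prob_eq_1) auto
  hence G01: "emeasure N G0 = 1" by (simp add: N.emeasure_eq_measure)
  obtain h :: "(nat \<Rightarrow> real) \<Rightarrow> real" where h: "h \<in> borel_measurable P" "\<forall>x. 0 \<le> h x \<and> h x \<le> 1" "\<forall>x. x \<notin> G0 \<longrightarrow> h x = 0"
    "density P (\<lambda>x. ennreal (h x)) = scale_measure (ennreal (1 - \<epsilon>)) N"
    using dominated_component_density[OF P(1) prob_N sets_N dom _ G0s G01] eps by auto
  have hG: "x \<in> G S" if "h x \<noteq> 0" "S \<in> SS" for x S using h(3) that by (auto simp: G0_def)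
  have wg: "weighted_gaussian P N h \<epsilon> (m S) (Y S)" if S: "S \<in> SS" for S
    by unfold_locales (use h eps Y[OF S] gauss[OF S] sets_N in auto)
  have e0: "0 < e" using r H n by (simp add: e_def)
  have e2: "(real r + H) / real n = e * e" using r H n by (simp add: e_def)
  have e1: "e \<le> 1" using rH n by (simp add: e_def)
  have ker: "(\<Sum>i<p. u i * x i) = 0" if "S \<subseteq> {..<p}" "card S = r" "?supp u S" "h x \<noteq> 0" "?\<sigma> u = 0" for x u S
  proof -
    have S: "S \<in> SS" using that by (simp add: SS_def)
    have "c S u k = 0" if "k < m S" for k
      using cL[OF S \<open>?supp u S\<close>] \<open>?\<sigma> u = 0\<close> that by (simp add: L2_set_eq_0_iff)
    thus ?thesis using cx[OF S \<open>?supp u S\<close> hG[OF \<open>h x \<noteq> 0\<close> S]] by simp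
  qed
  have tot: "\<exists>B\<in>sets ?PP. measure ?PP B \<le> 2 * exp (- H) \<and>
      (\<forall>X\<in>space ?PP - B. \<bar>(\<Sum>i<n. h (X i)) / real n - (1 - \<epsilon>)\<bar> \<le> 225 * e)"
  proof -
    have hint: "integrable P h" by (rule P.integrable_const_bound[of _ 1]) (use h in auto)
    have "ennreal (\<integral>x. h x \<partial>P) = (\<integral>\<^sup>+x. ennreal (h x) \<partial>P)"
      using hint h by (intro nn_integral_eq_integral[symmetric]) auto
    also have "\<dots> = emeasure (density P (\<lambda>x. ennreal (h x))) (space P)"
      using h by (subst emeasure_density) (auto intro!: nn_integral_cong)
    also have "\<dots> = ennreal (1 - \<epsilon>)" unfolding h(4)
      using N.emeasure_space_1 sets_eq_imp_space_eq[OF sets_N] by simp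
    finally have inth: "(\<integral>x. h x \<partial>P) = 1 - \<epsilon>"
      using eps h by (subst (asm) ennreal_inj) (auto intro: integral_nonneg_AE)
    obtain B where B: "B \<in> sets ?PP" "measure ?PP B \<le> 2 * real (card {()}) * exp (- H)"
      "\<forall>X\<in>space ?PP - B. \<forall>z\<in>{()}. \<bar>(\<Sum>i<n. h (X i)) / real n - (\<integral>x. h x \<partial>P)\<bar> \<le> e * 1 + H / (real n * e)"
    proof -
    have "\<exists>B\<in>sets ?PP. measure ?PP B \<le> 2 * real (card {()}) * exp (- H) \<and>
      (\<forall>X\<in>space ?PP - B. \<forall>z\<in>{()}. \<bar>(\<Sum>i<n. h (X i)) / real n - (\<integral>x. h x \<partial>P)\<bar> \<le> e * 1 + H / (real n * e))"
    proof (rule iid_chernoff_finite[OF P(1) _ n])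
      have "(\<integral>x. (h x)\<^sup>2 \<partial>P) \<le> (\<integral>x. 1 \<partial>P)"
        using h(1,2) by (intro integral_mono P.integrable_const_bound[of _ 1]) (auto simp: power_le_one)
      thus "(\<integral>x. (h x)\<^sup>2 \<partial>P) \<le> 1" by (simp add: P.prob_space)
    qed (use h e0 e1 in auto)
    thus ?thesis using that by blast
    qed
    have le: "e * 1 + H / (real n * e) \<le> 225 * e"
    proof -
      have "H / real n \<le> e * e" unfolding e2[symmetric] by (intro divide_right_mono) auto
      hence "H / real n / e \<le> e * e / e" using e0 by (intro divide_right_mono) auto
      hence "H / real n / e \<le> e" using e0 by simp
      thus ?thesis using e0 by simp
    qed
    show ?thesis
    proof (intro bexI[of _ B] conjI ballI)
      show "measure ?PP B \<le> 2 * exp (- H)" using B(2) by simp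
      fix X assume "X \<in> space ?PP - B"
      with B(3) have "\<bar>(\<Sum>i<n. h (X i)) / real n - (1 - \<epsilon>)\<bar> \<le> e * 1 + H / (real n * e)"
        unfolding inth by blast
      thus "\<bar>(\<Sum>i<n. h (X i)) / real n - (1 - \<epsilon>)\<bar> \<le> 225 * e" using le by linarith
    qed (rule B(1))
  qed
  have dev: "\<exists>B\<in>sets ?PP. measure ?PP B \<le> real (p choose r) * (5 * exp (- H)) \<and>
      (\<forall>X\<in>space ?PP - B. \<forall>u S. S \<subseteq> {..<p} \<longrightarrow> card S = r \<longrightarrow> ?supp u S \<longrightarrow> 0 < ?\<sigma> u \<longrightarrow>
        \<bar>(\<Sum>i<n. h (X i) * of_bool (\<bar>\<Sum>j<p. u j * X i j\<bar> \<le> t * ?\<sigma> u)) / real n - (1 - \<epsilon>) * half_normal_cdf t\<bar> \<le> 225 * e)" for t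
  proof -
    have one: "\<exists>B\<in>sets ?PP. measure ?PP B \<le> 5 * exp (- H) \<and>
      (\<forall>X\<in>space ?PP - B. \<forall>u. ?supp u S \<longrightarrow> 0 < ?\<sigma> u \<longrightarrow>
        \<bar>(\<Sum>i<n. h (X i) * of_bool (\<bar>\<Sum>j<p. u j * X i j\<bar> \<le> t * ?\<sigma> u)) / real n - (1 - \<epsilon>) * half_normal_cdf t\<bar> \<le> 225 * e)"
      if S: "S \<in> SS" for S
    proof (cases "m S = 0")
      case True
      hence "?\<sigma> u = 0" if "?supp u S" for u using cL[OF S that] by (simp add: L2_set_def)
      thus ?thesis by (intro bexI[of _ "{}"]) auto
    next
      case False
      interpret W: weighted_gaussian P N h \<epsilon> "m S" "Y S" by (rule wg[OF S])
      have mH: "real (m S) + H \<le> real n" using m[OF S] rH by linarith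
      have me: "sqrt ((real (m S) + H) / real n) \<le> e"
        unfolding e_def using m[OF S] by (intro real_sqrt_le_mono divide_right_mono) auto
      obtain B where B: "B \<in> sets ?PP" "measure ?PP B \<le> 5 * exp (- H)"
        "\<forall>X\<in>space ?PP - B. \<forall>c. L2_set c {..<m S} = 1 \<longrightarrow>
          \<bar>(\<Sum>i<n. h (X i) * of_bool (\<bar>W.lin c (X i)\<bar> \<le> t)) / real n - (1 - \<epsilon>) * half_normal_cdf t\<bar>
            \<le> 225 * sqrt ((real (m S) + H) / real n)"
        using W.uniform_hit_deviation[OF _ n H mH, of t] False by blast
      show ?thesis
      proof (intro bexI[of _ B] conjI ballI allI impI B(1,2))
        fix X u assume X: "X \<in> space ?PP - B" and u: "?supp u S" and pos: "0 < ?\<sigma> u"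
        define c' where "c' = (\<lambda>k. (1 / ?\<sigma> u) * c S u k)"
        have "L2_set c' {..<m S} = (1 / ?\<sigma> u) * L2_set (c S u) {..<m S}"
          unfolding c'_def using pos by (intro L2_set_right_distrib[symmetric]) simp
        hence n1: "L2_set c' {..<m S} = 1" using cL[OF S u] pos by simp
        have eq: "h x * of_bool (\<bar>\<Sum>j<p. u j * x j\<bar> \<le> t * ?\<sigma> u) = h x * of_bool (\<bar>W.lin c' x\<bar> \<le> t)" for x
        proof (cases "h x = 0")
          case False
          have "W.lin c' x = (1 / ?\<sigma> u) * W.lin (c S u) x" unfolding c'_def by (rule W.lin_scale)
          also have "W.lin (c S u) x = (\<Sum>j<p. u j * x j)" unfolding W.lin_def using cx[OF S u hG[OF False S]] by simp
          finally have "\<bar>W.lin c' x\<bar> = \<bar>\<Sum>j<p. u j * x j\<bar> / ?\<sigma> u" using pos by (simp add: abs_mult)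
          thus ?thesis using pos by (simp add: pos_divide_le_eq)
        qed simp
        show "\<bar>(\<Sum>i<n. h (X i) * of_bool (\<bar>\<Sum>j<p. u j * X i j\<bar> \<le> t * ?\<sigma> u)) / real n - (1 - \<epsilon>) * half_normal_cdf t\<bar> \<le> 225 * e"
        proof -
          have "\<bar>(\<Sum>i<n. h (X i) * of_bool (\<bar>W.lin c' (X i)\<bar> \<le> t)) / real n - (1 - \<epsilon>) * half_normal_cdf t\<bar>
            \<le> 225 * sqrt ((real (m S) + H) / real n)" using B(3) X n1 by blast
          thus ?thesis unfolding eq using me by linarith
        qed
      qed
    qed
    have "\<forall>S. \<exists>B. S \<in> SS \<longrightarrow> B \<in> sets ?PP \<and> measure ?PP B \<le> 5 * exp (- H) \<and>
      (\<forall>X\<in>space ?PP - B. \<forall>u. ?supp u S \<longrightarrow> 0 < ?\<sigma> u \<longrightarrow>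
        \<bar>(\<Sum>i<n. h (X i) * of_bool (\<bar>\<Sum>j<p. u j * X i j\<bar> \<le> t * ?\<sigma> u)) / real n - (1 - \<epsilon>) * half_normal_cdf t\<bar> \<le> 225 * e)"
      using one by blast
    from choice[OF this] obtain B where B: "\<forall>S. S \<in> SS \<longrightarrow> B S \<in> sets ?PP \<and> measure ?PP (B S) \<le> 5 * exp (- H) \<and>
      (\<forall>X\<in>space ?PP - B S. \<forall>u. ?supp u S \<longrightarrow> 0 < ?\<sigma> u \<longrightarrow>
        \<bar>(\<Sum>i<n. h (X i) * of_bool (\<bar>\<Sum>j<p. u j * X i j\<bar> \<le> t * ?\<sigma> u)) / real n - (1 - \<epsilon>) * half_normal_cdf t\<bar> \<le> 225 * e)" ..
    show ?thesis
    proof (intro bexI[of _ "\<Union>S\<in>SS. B S"] conjI ballI allI impI)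
      show "(\<Union>S\<in>SS. B S) \<in> sets ?PP" using B SS(1) by auto
      have "measure ?PP (\<Union>S\<in>SS. B S) \<le> (\<Sum>S\<in>SS. measure ?PP (B S))"
        using B SS(1) by (intro fp.finite_measure_subadditive_finite) auto
      also have "\<dots> \<le> (\<Sum>S\<in>SS. 5 * exp (- H))" using B by (intro sum_mono) auto
      also have "\<dots> = real (p choose r) * (5 * exp (- H))" using SS(2) by simp
      finally show "measure ?PP (\<Union>S\<in>SS. B S) \<le> real (p choose r) * (5 * exp (- H))" .
    next
      fix X u S assume X: "X \<in> space ?PP - (\<Union>S\<in>SS. B S)" and S: "S \<subseteq> {..<p}" "card S = r"
        and u: "?supp u S" "0 < ?\<sigma> u"
      have "S \<in> SS" using S by (simp add: SS_def)
      moreover have "X \<in> space ?PP - B S" using X \<open>S \<in> SS\<close> by blast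
      ultimately show "\<bar>(\<Sum>i<n. h (X i) * of_bool (\<bar>\<Sum>j<p. u j * X i j\<bar> \<le> t * ?\<sigma> u)) / real n - (1 - \<epsilon>) * half_normal_cdf t\<bar> \<le> 225 * e"
        using B u by blast
    qed
  qed
  show ?thesis
    using h(2) ker tot dev by (intro exI[of _ h] conjI) blast+
qed

section \<open>From depth to quadratic forms\<close>

text \<open>
  Both frequencies are bounded below by weighted ones: \<open>h\<close> times an indicator is at most the
  indicator, and the complement of the slab has weighted frequency close to \<open>(1 - \<epsilon>) - (1 - \<epsilon>) / 2\<close>.  The
  sample enters through the projections \<open>t i\<close> and the weights \<open>w i\<close> only.
\<close>

lemma depth_of_scaled_truth:
  fixes w t :: "nat \<Rightarrow> real"
  assumes n: "0 < n" and w: "\<And>i. 0 \<le> w i \<and> w i \<le> 1" and \<sigma>: "0 \<le> \<sigma>" and eps: "0 \<le> \<epsilon>" "\<epsilon> < 1 / 5"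
    and tot: "\<bar>(\<Sum>i<n. w i) / real n - (1 - \<epsilon>)\<bar> \<le> \<kappa>"
    and hit: "0 < \<sigma> \<Longrightarrow> \<bar>(\<Sum>i<n. w i * of_bool (\<bar>t i\<bar> \<le> sqrt depth_beta * \<sigma>)) / real n - (1 - \<epsilon>) * half_normal_cdf (sqrt depth_beta)\<bar> \<le> \<kappa>"
    and ker: "\<And>i. i < n \<Longrightarrow> \<sigma> = 0 \<Longrightarrow> w i \<noteq> 0 \<Longrightarrow> t i = 0"
  shows "(1 - \<epsilon>) / 2 - 2 * \<kappa> \<le> (\<Sum>i<n. of_bool (\<bar>t i\<bar>\<^sup>2 \<le> depth_beta * \<sigma>\<^sup>2)) / real n"
    "(1 - \<epsilon>) / 2 - 2 * \<kappa> \<le> (\<Sum>i<n. of_bool (\<bar>t i\<bar>\<^sup>2 \<ge> depth_beta * \<sigma>\<^sup>2)) / real n"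
proof -
  have k0: "0 \<le> \<kappa>" using tot by linarith
  have sq: "depth_beta * \<sigma>\<^sup>2 = (sqrt depth_beta * \<sigma>)\<^sup>2" using depth_beta_pos by (simp add: power_mult_distrib)
  have pos: "0 \<le> sqrt depth_beta * \<sigma>" using depth_beta_pos \<sigma> by simp
  have le_iff: "\<bar>t i\<bar>\<^sup>2 \<le> depth_beta * \<sigma>\<^sup>2 \<longleftrightarrow> \<bar>t i\<bar> \<le> sqrt depth_beta * \<sigma>" for i
    unfolding sq using pos by (intro power_mono_iff) auto
  have avg: "(\<Sum>i<n. f i) / real n \<le> (\<Sum>i<n. g i) / real n" if "\<And>i. i < n \<Longrightarrow> f i \<le> g i" for f g :: "nat \<Rightarrow> real"
    using that by (intro divide_right_mono sum_mono) auto
  show "(1 - \<epsilon>) / 2 - 2 * \<kappa> \<le> (\<Sum>i<n. of_bool (\<bar>t i\<bar>\<^sup>2 \<le> depth_beta * \<sigma>\<^sup>2)) / real n"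
  proof (cases "\<sigma> = 0")
    case True
    have "(\<Sum>i<n. w i) / real n \<le> (\<Sum>i<n. of_bool (\<bar>t i\<bar>\<^sup>2 \<le> depth_beta * \<sigma>\<^sup>2)) / real n"
    proof (rule avg)
      fix i assume "i < n"
      thus "w i \<le> of_bool (\<bar>t i\<bar>\<^sup>2 \<le> depth_beta * \<sigma>\<^sup>2)"
        using ker[of i] w[of i] True by (cases "w i = 0") auto
    qed
    thus ?thesis using tot k0 eps by argo
  next
    case False
    have "(\<Sum>i<n. w i * of_bool (\<bar>t i\<bar> \<le> sqrt depth_beta * \<sigma>)) / real n
       \<le> (\<Sum>i<n. of_bool (\<bar>t i\<bar>\<^sup>2 \<le> depth_beta * \<sigma>\<^sup>2)) / real n"
      unfolding le_iff by (rule avg) (use w in \<open>auto simp: of_bool_def\<close>)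
    thus ?thesis using hit False \<sigma> k0 unfolding depth_beta_half_normal_cdf by argo
  qed
  show "(1 - \<epsilon>) / 2 - 2 * \<kappa> \<le> (\<Sum>i<n. of_bool (\<bar>t i\<bar>\<^sup>2 \<ge> depth_beta * \<sigma>\<^sup>2)) / real n"
  proof (cases "\<sigma> = 0")
    case True
    hence "(\<Sum>i<n. of_bool (\<bar>t i\<bar>\<^sup>2 \<ge> depth_beta * \<sigma>\<^sup>2)) / real n = (1::real)" using n by simp
    thus ?thesis using k0 eps by argo
  next
    case False
    have "(\<Sum>i<n. w i - w i * of_bool (\<bar>t i\<bar> \<le> sqrt depth_beta * \<sigma>)) / real n
       \<le> (\<Sum>i<n. of_bool (\<bar>t i\<bar>\<^sup>2 \<ge> depth_beta * \<sigma>\<^sup>2)) / real n"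
    proof (rule avg)
      fix i
      show "w i - w i * of_bool (\<bar>t i\<bar> \<le> sqrt depth_beta * \<sigma>) \<le> of_bool (\<bar>t i\<bar>\<^sup>2 \<ge> depth_beta * \<sigma>\<^sup>2)"
        using w[of i] le_iff[of i] by (cases "\<bar>t i\<bar>\<^sup>2 \<le> depth_beta * \<sigma>\<^sup>2") (auto simp: of_bool_def)
    qed
    hence "(\<Sum>i<n. w i) / real n - (\<Sum>i<n. w i * of_bool (\<bar>t i\<bar> \<le> sqrt depth_beta * \<sigma>)) / real n
       \<le> (\<Sum>i<n. of_bool (\<bar>t i\<bar>\<^sup>2 \<ge> depth_beta * \<sigma>\<^sup>2)) / real n"
      by (simp add: sum_subtractf diff_divide_distrib)
    thus ?thesis using hit False \<sigma> k0 tot unfolding depth_beta_half_normal_cdf by argo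
  qed
qed

text \<open>
  If \<open>\<gamma>\<close> were below \<open>(lo \<sigma>)\<^sup>2\<close> or above \<open>(hi \<sigma>)\<^sup>2\<close>, then one of the two frequencies at \<open>\<gamma>\<close> would be too small.
  The constant \<open>5/4\<close> in \<open>\<Delta>\<close> is \<open>1 / (1 - \<epsilon>)\<close> at \<open>\<epsilon> = 1/5\<close>, and the two bounds \<open>\<epsilon> < 1/5\<close> and \<open>\<kappa> \<le> 1/50\<close> give
  \<open>\<Delta> \<le> 3/8\<close>.  Cutting the upper threshold off at \<open>4\<close> is harmless since the probability there is still at
  least \<open>15/16 > 1/2 + 3/8\<close>.  For \<open>\<sigma> = 0\<close> all points of positive weight have projection \<open>0\<close>, so a positive
  \<open>\<gamma>\<close> would leave only the contaminated fraction above it.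
\<close>

lemma deep_direction_bound:
  fixes w t :: "nat \<Rightarrow> real" and \<epsilon> \<kappa> :: real
  defines "\<Delta> \<equiv> 5 / 4 * (\<epsilon> + 5 * \<kappa>)"
  defines "\<eta> \<equiv> 2 * \<Delta> / std_normal_density 4"
  defines "lo \<equiv> max 0 (sqrt depth_beta - \<eta>)" and "hi \<equiv> min 4 (sqrt depth_beta + \<eta>)"
  assumes n: "0 < n" and w: "\<And>i. 0 \<le> w i \<and> w i \<le> 1" and \<sigma>: "0 \<le> \<sigma>" and \<gamma>: "0 \<le> \<gamma>"
    and eps: "0 \<le> \<epsilon>" "\<epsilon> < 1 / 5" and \<kappa>: "0 < \<kappa>" "\<kappa> \<le> 1 / 50"
    and tot: "\<bar>(\<Sum>i<n. w i) / real n - (1 - \<epsilon>)\<bar> \<le> \<kappa>"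
    and hit: "\<And>a. a \<in> {lo, hi} \<Longrightarrow> 0 < \<sigma> \<Longrightarrow>
      \<bar>(\<Sum>i<n. w i * of_bool (\<bar>t i\<bar> \<le> a * \<sigma>)) / real n - (1 - \<epsilon>) * half_normal_cdf a\<bar> \<le> \<kappa>"
    and ker: "\<And>i. i < n \<Longrightarrow> \<sigma> = 0 \<Longrightarrow> w i \<noteq> 0 \<Longrightarrow> t i = 0"
    and deep1: "(1 - \<epsilon>) / 2 - 2 * \<kappa> \<le> (\<Sum>i<n. of_bool (\<bar>t i\<bar>\<^sup>2 \<le> \<gamma>)) / real n"
    and deep2: "(1 - \<epsilon>) / 2 - 2 * \<kappa> \<le> (\<Sum>i<n. of_bool (\<bar>t i\<bar>\<^sup>2 \<ge> \<gamma>)) / real n"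
  shows "\<bar>\<gamma> - depth_beta * \<sigma>\<^sup>2\<bar> \<le> 8 * \<eta> * \<sigma>\<^sup>2"
proof -
  define b where "b = sqrt depth_beta"
  have b: "0 < b" "b < 4" "half_normal_cdf b = 1 / 2" "b\<^sup>2 = depth_beta"
    using depth_beta_pos depth_beta_less depth_beta_half_normal_cdf by (auto simp: b_def)
  have phi: "0 < std_normal_density 4" by (rule normal_density_pos) simp
  have D: "0 < \<Delta>" "\<Delta> \<le> 3 / 8" using eps \<kappa> by (auto simp: \<Delta>_def)
  have eta: "0 < \<eta>" "std_normal_density 4 * \<eta> = 2 * \<Delta>" using D phi by (auto simp: \<eta>_def)
  have lo: "0 \<le> lo" "lo \<le> b" and hi: "b \<le> hi" "hi \<le> 4" using b eta by (auto simp: lo_def hi_def b_def)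
  have avg: "(\<Sum>i<n. f i) / real n \<le> (\<Sum>i<n. g i) / real n" if "\<And>i. i < n \<Longrightarrow> f i \<le> g i" for f g :: "nat \<Rightarrow> real"
    using that by (intro divide_right_mono sum_mono) auto
  have avg1: "(\<Sum>i<n. 1 - f i) / real n = 1 - (\<Sum>i<n. f i) / real n" for f :: "nat \<Rightarrow> real"
    using n by (simp add: sum_subtractf diff_divide_distrib)
  have lower: "lo\<^sup>2 * \<sigma>\<^sup>2 \<le> \<gamma>"
  proof (rule ccontr)
    assume "\<not> lo\<^sup>2 * \<sigma>\<^sup>2 \<le> \<gamma>"
    hence v: "\<gamma> < (lo * \<sigma>)\<^sup>2" by (simp add: power_mult_distrib)
    hence "lo * \<sigma> \<noteq> 0" using \<gamma> by auto
    hence pos: "0 < \<sigma>" "0 < lo" using \<sigma> lo(1) by auto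
    have "(\<Sum>i<n. of_bool (\<bar>t i\<bar>\<^sup>2 \<le> \<gamma>)) / real n \<le> (\<Sum>i<n. (1 - w i) + w i * of_bool (\<bar>t i\<bar> \<le> lo * \<sigma>)) / real n"
    proof (rule avg)
      fix i
      have "\<bar>t i\<bar> \<le> lo * \<sigma>" if "\<bar>t i\<bar>\<^sup>2 \<le> \<gamma>"
        using that v pos by (intro power2_le_imp_le[of "\<bar>t i\<bar>"]) auto
      thus "of_bool (\<bar>t i\<bar>\<^sup>2 \<le> \<gamma>) \<le> (1 - w i) + w i * of_bool (\<bar>t i\<bar> \<le> lo * \<sigma>)"
        using w[of i] by (auto simp: of_bool_def)
    qed
    also have "\<dots> = 1 - (\<Sum>i<n. w i) / real n + (\<Sum>i<n. w i * of_bool (\<bar>t i\<bar> \<le> lo * \<sigma>)) / real n"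
      unfolding sum.distrib add_divide_distrib avg1 ..
    finally have "(1 - \<epsilon>) / 2 - 2 * \<kappa> \<le> \<epsilon> + \<kappa> + ((1 - \<epsilon>) * half_normal_cdf lo + \<kappa>)"
      using deep1 tot hit[OF insertI1 pos(1)] by linarith
    hence up: "(1 - \<epsilon>) * (1 / 2 - half_normal_cdf lo) \<le> \<epsilon> + 4 * \<kappa>" by (simp add: algebra_simps)
    have g: "std_normal_density 4 * (b - lo) \<le> 1 / 2 - half_normal_cdf lo"
      using half_normal_cdf_diff_ge[of lo b] lo b by simp
    have "b - lo = \<eta>" using pos(2) by (simp add: lo_def b_def max_def split: if_splits)
    hence g2: "2 * \<Delta> \<le> 1 / 2 - half_normal_cdf lo" using g eta(2) by simp
    hence "4 / 5 * (2 * \<Delta>) \<le> 4 / 5 * (1 / 2 - half_normal_cdf lo)" by (rule mult_left_mono) simp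
    also have "\<dots> \<le> (1 - \<epsilon>) * (1 / 2 - half_normal_cdf lo)"
      using eps g2 D by (intro mult_right_mono) auto
    also note up
    finally have "4 / 5 * (2 * \<Delta>) \<le> \<epsilon> + 4 * \<kappa>" .
    thus False using eps \<kappa> by (simp add: \<Delta>_def)
  qed
  have upper: "\<gamma> \<le> hi\<^sup>2 * \<sigma>\<^sup>2"
  proof (rule ccontr)
    assume "\<not> \<gamma> \<le> hi\<^sup>2 * \<sigma>\<^sup>2"
    hence v: "(hi * \<sigma>)\<^sup>2 < \<gamma>" by (simp add: power_mult_distrib)
    show False
    proof (cases "\<sigma> = 0")
      case True
      have "(\<Sum>i<n. of_bool (\<bar>t i\<bar>\<^sup>2 \<ge> \<gamma>)) / real n \<le> (\<Sum>i<n. 1 - w i) / real n"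
      proof (rule avg)
        fix i assume i: "i < n"
        show "of_bool (\<bar>t i\<bar>\<^sup>2 \<ge> \<gamma>) \<le> 1 - w i"
          using ker[OF i True] w[of i] v True by (cases "w i = 0") auto
      qed
      hence "(1 - \<epsilon>) / 2 - 2 * \<kappa> \<le> \<epsilon> + \<kappa>" unfolding avg1 using deep2 tot by linarith
      thus False using eps \<kappa> by argo
    next
      case False
      hence pos: "0 < \<sigma>" using \<sigma> by simp
      have "(\<Sum>i<n. of_bool (\<bar>t i\<bar>\<^sup>2 \<ge> \<gamma>)) / real n \<le> (\<Sum>i<n. 1 - w i * of_bool (\<bar>t i\<bar> \<le> hi * \<sigma>)) / real n"
      proof (rule avg)
        fix i
        have "\<bar>t i\<bar>\<^sup>2 < \<gamma>" if "\<bar>t i\<bar> \<le> hi * \<sigma>"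
          using power_mono[OF that, of 2] v by simp
        thus "of_bool (\<bar>t i\<bar>\<^sup>2 \<ge> \<gamma>) \<le> 1 - w i * of_bool (\<bar>t i\<bar> \<le> hi * \<sigma>)"
          using w[of i] by (auto simp: of_bool_def)
      qed
      hence "(1 - \<epsilon>) / 2 - 2 * \<kappa> \<le> 1 - ((1 - \<epsilon>) * half_normal_cdf hi - \<kappa>)"
        unfolding avg1 using deep2 hit[OF insertI2[OF singletonI] pos] by linarith
      moreover have "(1 - \<epsilon>) * (half_normal_cdf hi - 1 / 2) = (1 - \<epsilon>) * half_normal_cdf hi - (1 - \<epsilon>) / 2"
        by (simp add: right_diff_distrib)
      ultimately have *: "(1 - \<epsilon>) * (half_normal_cdf hi - 1 / 2) \<le> \<epsilon> + 3 * \<kappa>" by argo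
      have big: "\<Delta> < half_normal_cdf hi - 1 / 2"
      proof (cases "hi = 4")
        case True
        have "1 - 1 / 4\<^sup>2 \<le> half_normal_cdf 4" by (rule half_normal_cdf_ge_cheb) simp
        thus ?thesis using D True by simp
      next
        case False
        hence "hi = b + \<eta>" by (simp add: hi_def b_def min_def split: if_splits)
        hence "2 * \<Delta> \<le> half_normal_cdf hi - 1 / 2" using half_normal_cdf_diff_ge[of b hi] b hi eta by simp
        thus ?thesis using D by simp
      qed
      have "4 / 5 * \<Delta> < 4 / 5 * (half_normal_cdf hi - 1 / 2)" using big by simp
      also have "\<dots> \<le> (1 - \<epsilon>) * (half_normal_cdf hi - 1 / 2)"
        using eps big D by (intro mult_right_mono) auto
      also note *
      finally have "4 / 5 * \<Delta> < \<epsilon> + 3 * \<kappa>" .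
      thus False using \<kappa> by (simp add: \<Delta>_def)
    qed
  qed
  have "depth_beta - lo\<^sup>2 \<le> 8 * \<eta>"
  proof -
    have "depth_beta - lo\<^sup>2 = (b - lo) * (b + lo)" unfolding b(4)[symmetric] by (simp add: power2_eq_square algebra_simps)
    also have "\<dots> \<le> \<eta> * 8" using lo b eta by (intro mult_mono) (auto simp: lo_def b_def)
    finally show ?thesis by simp
  qed
  hence "(depth_beta - lo\<^sup>2) * \<sigma>\<^sup>2 \<le> 8 * \<eta> * \<sigma>\<^sup>2" by (rule mult_right_mono) simp
  moreover have "hi\<^sup>2 - depth_beta \<le> 8 * \<eta>"
  proof -
    have "hi\<^sup>2 - depth_beta = (hi - b) * (hi + b)" unfolding b(4)[symmetric] by (simp add: power2_eq_square algebra_simps)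
    also have "\<dots> \<le> \<eta> * 8" using hi b eta by (intro mult_mono) (auto simp: hi_def b_def)
    finally show ?thesis by simp
  qed
  hence "(hi\<^sup>2 - depth_beta) * \<sigma>\<^sup>2 \<le> 8 * \<eta> * \<sigma>\<^sup>2" by (rule mult_right_mono) simp
  ultimately show ?thesis using lower upper by (simp add: left_diff_distrib abs_le_iff)
qed

section \<open>Counting supports\<close>

text \<open>
  A single term of the binomial expansion of \<open>(1 + k / p)^p \<le> exp k\<close>.
\<close>

lemma ln_choose_le:
  assumes k: "1 \<le> k" "k \<le> p"
  shows "ln (real (p choose k)) \<le> real k * ln (exp 1 * real p / real k)"
proof -
  define x where "x = real k / real p"
  have x: "0 < x" using k by (simp add: x_def)
  have "real (p choose k) * x ^ k = real (p choose k) * x ^ k * 1 ^ (p - k)" by simp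
  also have "\<dots> \<le> (\<Sum>j\<le>p. real (p choose j) * x ^ j * 1 ^ (p - j))"
    using k x by (intro member_le_sum[where f = "\<lambda>j. real (p choose j) * x ^ j * 1 ^ (p - j)"]) auto
  also have "\<dots> = (x + 1) ^ p" by (rule binomial_ring[symmetric])
  also have "\<dots> \<le> exp x ^ p" using x exp_ge_add_one_self[of x] by (intro power_mono) (simp_all add: add.commute)
  also have "\<dots> = exp (real k)" using k by (simp add: exp_of_nat_mult[symmetric] x_def)
  finally have le: "real (p choose k) * x ^ k \<le> exp (real k)" .
  have pc: "0 < real (p choose k)" using k by simp
  have "ln (real (p choose k)) + real k * ln x = ln (real (p choose k) * x ^ k)"
    using pc x by (simp add: ln_mult ln_realpow)
  also have "\<dots> \<le> ln (exp (real k))" using le pc x by (subst ln_le_cancel_iff) auto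
  also have "\<dots> = real k" by simp
  finally have "ln (real (p choose k)) \<le> real k * (1 - ln x)" by (simp add: algebra_simps)
  also have "1 - ln x = ln (exp 1 * real p / real k)"
    using k by (simp add: x_def ln_mult ln_div)
  finally show ?thesis .
qed

section \<open>The contaminated law\<close>

lemma contaminated_law:
  assumes N: "prob_space (mvn p \<Sigma>)" "sets (mvn p \<Sigma>) = sets (Rp p)"
    and Q: "prob_space Q" "sets Q = sets (Rp p)" and eps: "0 \<le> \<epsilon>" "\<epsilon> \<le> 1"
  shows "sets (contaminated p \<epsilon> \<Sigma> Q) = sets (Rp p)"
    "B \<in> sets (Rp p) \<Longrightarrow> emeasure (contaminated p \<epsilon> \<Sigma> Q) B = ennreal (1 - \<epsilon>) * emeasure (mvn p \<Sigma>) B + ennreal \<epsilon> * emeasure Q B"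
    "prob_space (contaminated p \<epsilon> \<Sigma> Q)"
proof -
  let ?P = "contaminated p \<epsilon> \<Sigma> Q"
  let ?\<mu> = "\<lambda>B. ennreal (1 - \<epsilon>) * emeasure (mvn p \<Sigma>) B + ennreal \<epsilon> * emeasure Q B"
  show s: "sets ?P = sets (Rp p)" unfolding contaminated_def by (rule sets.sets_measure_of_eq)
  have e: "emeasure ?P B = ?\<mu> B" if "B \<in> sets (Rp p)" for B
  proof (rule emeasure_measure_of[OF contaminated_def])
    show "sets (Rp p) \<subseteq> Pow (space (Rp p))" by (rule sets.space_closed)
    show "positive (sets ?P) ?\<mu>" by (simp add: positive_def)
    show "B \<in> sets ?P" using that s by simp
    show "countably_additive (sets ?P) ?\<mu>"
    proof (rule countably_additiveI)
      fix A :: "nat \<Rightarrow> (nat \<Rightarrow> real) set"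
      assume A: "range A \<subseteq> sets ?P" "disjoint_family A"
      have "(\<Sum>i. ?\<mu> (A i)) = (\<Sum>i. ennreal (1 - \<epsilon>) * emeasure (mvn p \<Sigma>) (A i)) + (\<Sum>i. ennreal \<epsilon> * emeasure Q (A i))"
        by (intro suminf_add[symmetric] summableI)
      also have "\<dots> = ennreal (1 - \<epsilon>) * (\<Sum>i. emeasure (mvn p \<Sigma>) (A i)) + ennreal \<epsilon> * (\<Sum>i. emeasure Q (A i))"
        by (simp only: ennreal_suminf_cmult)
      also have "(\<Sum>i. emeasure (mvn p \<Sigma>) (A i)) = emeasure (mvn p \<Sigma>) (\<Union>i. A i)"
        using A s N(2) by (intro suminf_emeasure) auto
      also have "(\<Sum>i. emeasure Q (A i)) = emeasure Q (\<Union>i. A i)"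
        using A s Q(2) by (intro suminf_emeasure) auto
      finally show "(\<Sum>i. ?\<mu> (A i)) = ?\<mu> (\<Union>i. A i)" .
    qed
  qed
  thus "B \<in> sets (Rp p) \<Longrightarrow> emeasure ?P B = ?\<mu> B" .
  have sp: "space ?P = space (Rp p)" by (rule sets_eq_imp_space_eq[OF s])
  show "prob_space ?P"
  proof (rule prob_spaceI)
    have "emeasure ?P (space ?P) = ennreal (1 - \<epsilon>) * 1 + ennreal \<epsilon> * 1"
      unfolding sp using e[of "space (Rp p)"] prob_space.emeasure_space_1[OF N(1)] prob_space.emeasure_space_1[OF Q(1)]
      by (simp add: sets_eq_imp_space_eq[OF N(2)] sets_eq_imp_space_eq[OF Q(2)])
    also have "\<dots> = 1" using eps by (simp flip: ennreal_plus)
    finally show "emeasure ?P (space ?P) = 1" .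
  qed
qed

section \<open>Sparse matrices and sparse directions\<close>

lemma U_sparse_nonempty:
  assumes "1 \<le> s" "2 * s \<le> p" shows "U_sparse p s \<noteq> {}"
proof -
  obtain S where S: "{0} \<subseteq> S" "S \<subseteq> {..<p}" "card S = 2 * s"
    using exists_subset_between[of "{0}" "2 * s" "{..<p}"] assms by auto
  have "unit_vec p 0 \<in> V_supp p S"
    using S assms by (auto simp: V_supp_def unit_sphere_def l2_norm_def)
  thus ?thesis using S by (auto simp: U_sparse_def)
qed

lemma U_sparseD:
  assumes "u \<in> U_sparse p s"
  shows "u \<in> carrier_vec p" "sq_norm p (\<lambda>i. u $ i) = 1"
    "\<exists>S. S \<subseteq> {..<p} \<and> card S = 2 * s \<and> (\<forall>i<p. i \<notin> S \<longrightarrow> u $ i = 0)"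
proof -
  show c: "u \<in> carrier_vec p" using assms by (auto simp: U_sparse_def V_supp_def unit_sphere_def)
  have "l2_norm u = 1" using assms by (auto simp: U_sparse_def V_supp_def unit_sphere_def)
  thus "sq_norm p (\<lambda>i. u $ i) = 1" using l2_norm_sq_norm[OF c] by simp
  show "\<exists>S. S \<subseteq> {..<p} \<and> card S = 2 * s \<and> (\<forall>i<p. i \<notin> S \<longrightarrow> u $ i = 0)"
    using assms by (auto simp: U_sparse_def V_supp_def)
qed

lemma F_sparse_scale:
  assumes S: "\<Sigma> \<in> F_sparse p s" and c: "0 \<le> c" shows "c \<cdot>\<^sub>m \<Sigma> \<in> F_sparse p s"
proof -
  have psd: "psd p \<Sigma>" and G: "\<Sigma> - mat_diag p (\<lambda>i. \<Sigma> $$ (i, i)) \<in> G_sparse p s"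
    using S by (auto simp: F_sparse_def)
  have C: "\<Sigma> \<in> carrier_mat p p" "transpose_mat \<Sigma> = \<Sigma>" using psd by (auto simp: psd_def)
  have "psd p (c \<cdot>\<^sub>m \<Sigma>)"
    unfolding psd_def
  proof (intro conjI ballI)
    show "c \<cdot>\<^sub>m \<Sigma> \<in> carrier_mat p p" using C by simp
    have "\<Sigma> $$ (i, j) = \<Sigma> $$ (j, i)" if "i < p" "j < p" for i j using psd_bil(2)[OF psd that] .
    thus "transpose_mat (c \<cdot>\<^sub>m \<Sigma>) = c \<cdot>\<^sub>m \<Sigma>" using C(1) by (intro eq_matI) auto
    fix v :: "real vec" assume v: "v \<in> carrier_vec p"
    have "v \<bullet> (c \<cdot>\<^sub>m \<Sigma> *\<^sub>v v) = c * (v \<bullet> (\<Sigma> *\<^sub>v v))"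
      using C v by (subst (1 2) quadratic_form_bil) (auto simp: bil_def sum_distrib_left mult_ac intro!: sum.cong)
    thus "0 \<le> v \<bullet> (c \<cdot>\<^sub>m \<Sigma> *\<^sub>v v)" using psd v c by (simp add: psd_def)
  qed
  moreover have "c \<cdot>\<^sub>m \<Sigma> - mat_diag p (\<lambda>i. (c \<cdot>\<^sub>m \<Sigma>) $$ (i, i)) \<in> G_sparse p s"
  proof -
    obtain T where T: "T \<subseteq> {..<p}" "card T \<le> s" "\<Sigma> - mat_diag p (\<lambda>i. \<Sigma> $$ (i, i)) \<in> G_supp p T"
      using G by (auto simp: G_sparse_def)
    have "c \<cdot>\<^sub>m \<Sigma> - mat_diag p (\<lambda>i. (c \<cdot>\<^sub>m \<Sigma>) $$ (i, i)) \<in> G_supp p T"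
      unfolding G_supp_def
    proof (intro CollectI conjI allI impI)
      show "c \<cdot>\<^sub>m \<Sigma> - mat_diag p (\<lambda>i. (c \<cdot>\<^sub>m \<Sigma>) $$ (i, i)) \<in> carrier_mat p p"
        by (intro minus_carrier_mat) (simp add: mat_diag_def)
      fix i j assume ij: "i < p" "j < p" "i \<notin> T \<or> j \<notin> T"
      have "(\<Sigma> - mat_diag p (\<lambda>i. \<Sigma> $$ (i, i))) $$ (i, j) = 0"
        using T(3) ij by (simp add: G_supp_def)
      hence "\<Sigma> $$ (i, j) - (if i = j then \<Sigma> $$ (j, j) else 0) = 0"
        using C(1) ij by (simp add: mat_diag_def)
      thus "(c \<cdot>\<^sub>m \<Sigma> - mat_diag p (\<lambda>i. (c \<cdot>\<^sub>m \<Sigma>) $$ (i, i))) $$ (i, j) = 0"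
        using C(1) ij by (cases "i = j") (simp_all add: mat_diag_def)
    qed
    thus ?thesis using T by (auto simp: G_sparse_def)
  qed
  ultimately show ?thesis by (simp add: F_sparse_def)
qed

lemma F_sparse_support:
  assumes "\<Gamma> \<in> F_sparse p s"
  shows "psd p \<Gamma>" "\<exists>T. T \<subseteq> {..<p} \<and> card T \<le> s \<and> (\<forall>i<p. \<forall>j<p. i \<noteq> j \<longrightarrow> i \<notin> T \<or> j \<notin> T \<longrightarrow> \<Gamma> $$ (i, j) = 0)"
proof -
  show psd: "psd p \<Gamma>" using assms by (simp add: F_sparse_def)
  have C: "\<Gamma> \<in> carrier_mat p p" using psd by (simp add: psd_def)
  obtain T where T: "T \<subseteq> {..<p}" "card T \<le> s" "\<Gamma> - mat_diag p (\<lambda>i. \<Gamma> $$ (i, i)) \<in> G_supp p T"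
    using assms unfolding G_sparse_def F_sparse_def by blast
  have "\<Gamma> $$ (i, j) = 0" if "i < p" "j < p" "i \<noteq> j" "i \<notin> T \<or> j \<notin> T" for i j
  proof -
    have "(\<Gamma> - mat_diag p (\<lambda>i. \<Gamma> $$ (i, i))) $$ (i, j) = 0" using T(3) that by (simp add: G_supp_def)
    thus ?thesis using that C by (simp add: mat_diag_def)
  qed
  thus "\<exists>T. T \<subseteq> {..<p} \<and> card T \<le> s \<and> (\<forall>i<p. \<forall>j<p. i \<noteq> j \<longrightarrow> i \<notin> T \<or> j \<notin> T \<longrightarrow> \<Gamma> $$ (i, j) = 0)"
    using T by blast
qed

lemma matrix_depth_le:
  assumes "u \<in> U"
  shows "matrix_depth p n U \<Gamma> X \<le> (\<Sum>i<n. of_bool (\<bar>u \<bullet> vec p (X i)\<bar>\<^sup>2 \<le> u \<bullet> (\<Gamma> *\<^sub>v u))) / real n"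
    "matrix_depth p n U \<Gamma> X \<le> (\<Sum>i<n. of_bool (\<bar>u \<bullet> vec p (X i)\<bar>\<^sup>2 \<ge> u \<bullet> (\<Gamma> *\<^sub>v u))) / real n"
proof -
  let ?f = "\<lambda>u. min ((\<Sum>i<n. of_bool (\<bar>u \<bullet> vec p (X i)\<bar>\<^sup>2 \<le> u \<bullet> (\<Gamma> *\<^sub>v u))) / real n)
         ((\<Sum>i<n. of_bool (\<bar>u \<bullet> vec p (X i)\<bar>\<^sup>2 \<ge> u \<bullet> (\<Gamma> *\<^sub>v u))) / real n)"
  have "matrix_depth p n U \<Gamma> X \<le> ?f u" unfolding matrix_depth_def
    using assms by (intro cINF_lower bdd_belowI2[of _ 0]) (auto intro!: divide_nonneg_nonneg sum_nonneg)
  thus "matrix_depth p n U \<Gamma> X \<le> (\<Sum>i<n. of_bool (\<bar>u \<bullet> vec p (X i)\<bar>\<^sup>2 \<le> u \<bullet> (\<Gamma> *\<^sub>v u))) / real n"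
    "matrix_depth p n U \<Gamma> X \<le> (\<Sum>i<n. of_bool (\<bar>u \<bullet> vec p (X i)\<bar>\<^sup>2 \<ge> u \<bullet> (\<Gamma> *\<^sub>v u))) / real n"
    by auto
qed

section \<open>The error bound\<close>

text \<open>
  The exponent \<open>H\<close> pays for the union bound over supports and for the four exceptional events below; the
  summand \<open>4\<close> absorbs the numerical factor \<open>17 = 3 * 5 + 2\<close>, as \<open>17 \<le> 2 exp 4\<close>.  Since \<open>s \<ge> 1\<close> and \<open>p \<ge> s\<close>, everything is
  of the order of \<open>L + l\<close>.
\<close>

lemma sample_size_budget:
  fixes L l \<delta> :: real and N s p :: nat
  assumes s: "1 \<le> s" "2 * s \<le> p" and \<delta>: "0 < \<delta>" "\<delta> < 1 / 2"
  defines "L \<equiv> real s * ln (exp 1 * real p / real s)" and "l \<equiv> ln (1 / \<delta>)"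
  defines "N \<equiv> p choose (2 * s)"
  defines "H \<equiv> l + ln (real N) + 4"
  shows "0 \<le> H" "real (2 * s) + H \<le> 8 * (L + l)" "3 * (real N * (5 * exp (- H))) + 2 * exp (- H) \<le> 2 * \<delta>"
    "0 \<le> L" "0 \<le> l"
proof -
  have N1: "1 \<le> real N" using s by (simp add: N_def Suc_leI)
  have l0: "0 < l" using \<delta> by (simp add: l_def)
  have ps: "1 \<le> real p / real s" using s by simp
  have "ln (exp 1 * real p / real s) = 1 + ln (real p / real s)"
    using s by (simp add: ln_mult ln_div)
  hence ln1: "1 \<le> ln (exp 1 * real p / real s)" using ps by simp
  have Ls: "real s \<le> L" unfolding L_def using ln1 mult_left_mono[of 1 "ln (exp 1 * real p / real s)" "real s"] by simp
  have "ln (real N) \<le> real (2 * s) * ln (exp 1 * real p / real (2 * s))"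
    unfolding N_def using s by (intro ln_choose_le) auto
  also have "\<dots> \<le> real (2 * s) * ln (exp 1 * real p / real s)"
    using s by (intro mult_left_mono) (auto simp: divide_simps)
  finally have lnN: "ln (real N) \<le> 2 * L" by (simp add: L_def)
  show "0 \<le> H" using l0 N1 by (simp add: H_def)
  show "0 \<le> L" "0 \<le> l" using Ls l0 by auto
  have "1 \<le> L" using Ls s by linarith
  thus "real (2 * s) + H \<le> 8 * (L + l)" using Ls lnN l0 by (simp add: H_def)
  have eH: "exp (- H) = \<delta> / real N * exp (- 4)"
    using \<delta> N1 by (simp add: H_def l_def exp_diff exp_minus exp_add ln_div field_simps)
  have "16 \<le> exp (4::real)"
  proof -
    have "(2::real) ^ 4 \<le> exp 1 ^ 4" using exp_ge_add_one_self[of 1] by (intro power_mono) auto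
    also have "\<dots> = exp 4" by (simp add: exp_of_nat_mult[symmetric])
    finally show ?thesis by simp
  qed
  hence e4: "exp (- 4) \<le> 1 / (16::real)" by (simp add: exp_minus field_simps)
  have "3 * (real N * (5 * exp (- H))) + 2 * exp (- H) \<le> 17 * (real N * exp (- H))"
    using mult_right_mono[OF N1, of "exp (- H)"] by simp
  also have "real N * exp (- H) = \<delta> * exp (- 4)" unfolding eH using N1 by simp
  also have "17 * (\<delta> * exp (- 4)) \<le> 17 * (\<delta> * (1 / 16))" using e4 \<delta> by (intro mult_left_mono) auto
  also have "\<dots> \<le> 2 * \<delta>" using \<delta> by simp
  finally show "3 * (real N * (5 * exp (- H))) + 2 * exp (- H) \<le> 2 * \<delta>" .
qed

lemma deviation_squared_bound:
  fixes e \<epsilon> a b :: real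
  assumes "e\<^sup>2 \<le> 8 * (a + b)" "0 \<le> a" "0 \<le> b" "0 \<le> e"
  shows "(5 / 4 * (\<epsilon> + 5 * (225 * e)))\<^sup>2 \<le> 40000000 * (max a (\<epsilon>\<^sup>2) + b)"
proof -
  have "(5 / 4 * (\<epsilon> + 5 * (225 * e)))\<^sup>2 = 25 / 16 * (\<epsilon> + 1125 * e)\<^sup>2" by (simp add: power2_eq_square algebra_simps)
  also have "(\<epsilon> + 1125 * e)\<^sup>2 \<le> 2 * \<epsilon>\<^sup>2 + 2 * (1125 * e)\<^sup>2"
  proof -
    have "0 \<le> (\<epsilon> - 1125 * e)\<^sup>2" by simp
    thus ?thesis by (simp add: power2_eq_square algebra_simps)
  qed
  also have "\<dots> = 2 * \<epsilon>\<^sup>2 + 2531250 * e\<^sup>2" by (simp add: power2_eq_square)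
  also have "25 / 16 * \<dots> \<le> 25 / 16 * (2 * max a (\<epsilon>\<^sup>2) + 2531250 * (8 * (max a (\<epsilon>\<^sup>2) + b)))"
    using assms by (intro mult_left_mono add_mono) auto
  also have "\<dots> \<le> 40000000 * (max a (\<epsilon>\<^sup>2) + b)"
    using assms(2,3) max.cobounded1[of a "\<epsilon>\<^sup>2"] by simp
  finally show ?thesis by simp
qed

text \<open>
  Four exceptional events are removed: one for the average weight, and one for each of the thresholds
  \<open>sqrt \<beta>\<close> (which gives the depth of \<open>\<beta> \<Sigma>\<close>), \<open>lo\<close> and \<open>hi\<close> (which control the maximiser).  On their complement the
  argument is deterministic.
\<close>

theorem theorem3p6:
  fixes M :: real
  assumes "M > 0"
  shows "\<exists>C > 0. \<exists>C1 > 0.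
    \<forall>(p::nat) (s::nat) (n::nat) (\<epsilon>::real) (\<delta>::real)
      (\<Gamma>_hat :: (nat \<Rightarrow> nat \<Rightarrow> real) \<Rightarrow> real mat).
      1 \<le> s \<longrightarrow> 2 * s \<le> p \<longrightarrow> 1 \<le> n \<longrightarrow>
      0 \<le> \<epsilon> \<longrightarrow> \<epsilon> < 1 / 5 \<longrightarrow>
      0 < \<delta> \<longrightarrow> \<delta> < 1 / 2 \<longrightarrow>
      C1 * ((real s * ln (exp 1 * real p / real s) + ln (1 / \<delta>)) / real n) < 1 \<longrightarrow>
      (\<forall>X \<in> space (\<Pi>\<^sub>M i \<in> {..<n}. Rp p).
         is_arg_max (\<lambda>\<Gamma>. matrix_depth p n (U_sparse p s) \<Gamma> X) (\<lambda>\<Gamma>. \<Gamma> \<in> F_sparse p s) (\<Gamma>_hat X)) \<longrightarrow>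
      (\<forall>Q \<Sigma>. prob_space Q \<longrightarrow> sets Q = sets (Rp p) \<longrightarrow>
         \<Sigma> \<in> F_sparse_bounded p s M \<longrightarrow> \<Sigma> \<noteq> 0\<^sub>m p p \<longrightarrow>
         prob_at_least (sample_law p n \<epsilon> \<Sigma> Q) (1 - 2 * \<delta>)
           {X \<in> space (sample_law p n \<epsilon> \<Sigma> Q).
              (op_norm p ((1 / depth_beta) \<cdot>\<^sub>m \<Gamma>_hat X - \<Sigma>))\<^sup>2
              \<le> C * (max (real s * ln (exp 1 * real p / real s) / real n) (\<epsilon>\<^sup>2)
                      + ln (1 / \<delta>) / real n)})"
proof -
  define \<phi> where "\<phi> = std_normal_density 4"
  have phi: "0 < \<phi>" unfolding \<phi>_def by (rule normal_density_pos) simp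
  \<comment> \<open>\<open>16 = 8 * 2\<close> from \<open>deep_direction_bound\<close>; the division by \<open>\<beta>\<close> passes from \<open>\<Gamma>\<close> to \<open>\<Gamma> / \<beta>\<close>.\<close>
  define K1 where "K1 = 16 * M / (\<phi> * depth_beta)"
  have K1: "0 < K1" using phi depth_beta_pos assms by (simp add: K1_def)
  define C where "C = 40000000 * K1\<^sup>2"
  define C1 where "C1 = (10000000000::real)"
  have main: "prob_at_least (sample_law p n \<epsilon> \<Sigma> Q) (1 - 2 * \<delta>)
           {X \<in> space (sample_law p n \<epsilon> \<Sigma> Q).
              (op_norm p ((1 / depth_beta) \<cdot>\<^sub>m \<Gamma>_hat X - \<Sigma>))\<^sup>2
              \<le> C * (max (real s * ln (exp 1 * real p / real s) / real n) (\<epsilon>\<^sup>2)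
                      + ln (1 / \<delta>) / real n)}"
    if s: "1 \<le> s" "2 * s \<le> p" and n: "1 \<le> n" and eps: "0 \<le> \<epsilon>" "\<epsilon> < 1 / 5" and \<delta>: "0 < \<delta>" "\<delta> < 1 / 2"
      and small: "C1 * ((real s * ln (exp 1 * real p / real s) + ln (1 / \<delta>)) / real n) < 1"
      and argmax: "\<forall>X \<in> space (\<Pi>\<^sub>M i \<in> {..<n}. Rp p).
         is_arg_max (\<lambda>\<Gamma>. matrix_depth p n (U_sparse p s) \<Gamma> X) (\<lambda>\<Gamma>. \<Gamma> \<in> F_sparse p s) (\<Gamma>_hat X)"
      and Q: "prob_space Q" "sets Q = sets (Rp p)" and \<Sigma>: "\<Sigma> \<in> F_sparse_bounded p s M"
    for p s n :: nat and \<epsilon> \<delta> :: real and \<Gamma>_hat Q \<Sigma>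
  proof -
    define L where "L = real s * ln (exp 1 * real p / real s)"
    define l where "l = ln (1 / \<delta>)"
    define H where "H = l + ln (real (p choose (2 * s))) + 4"
    define e where "e = sqrt ((real (2 * s) + H) / real n)"
    define \<kappa> where "\<kappa> = 225 * e"
    note budget = sample_size_budget[OF s \<delta>, folded L_def l_def, folded H_def]
    have n0: "0 < n" using n by simp
    have p0: "0 < p" using s by simp
    have "10000000000 * ((L + l) / real n) < 1" using small unfolding C1_def L_def l_def .
    hence small': "(L + l) / real n < 1 / 10000000000" by linarith
    have e_sq: "e\<^sup>2 = (real (2 * s) + H) / real n" using budget(1) by (simp add: e_def)
    have e_le: "e\<^sup>2 \<le> 8 * (L / real n + l / real n)"
    proof -
      have "e\<^sup>2 \<le> 8 * (L + l) / real n" unfolding e_sq using budget(2) by (intro divide_right_mono) auto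
      thus ?thesis by (simp add: add_divide_distrib)
    qed
    \<comment> \<open>\<open>11250 = 225 * 50\<close>, so that the sampling error \<open>\<kappa> = 225 e\<close> is at most \<open>1/50\<close>.\<close>
    have e_small: "e\<^sup>2 < (1 / 11250)\<^sup>2"
    proof -
      have "e\<^sup>2 \<le> 8 * ((L + l) / real n)" using e_le by (simp add: add_divide_distrib)
      also have "\<dots> < 8 * (1 / 10000000000)" using small' by (rule mult_strict_left_mono) simp
      also have "\<dots> \<le> (1 / 11250)\<^sup>2" by (simp add: power2_eq_square)
      finally show ?thesis .
    qed
    have e0: "0 < e" using s budget(1) n0 by (simp add: e_def)
    have kap: "0 < \<kappa>" "\<kappa> \<le> 1 / 50"
    proof -
      have "e < 1 / 11250" using e_small by (rule power2_less_imp_less) simp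
      thus "0 < \<kappa>" "\<kappa> \<le> 1 / 50" using e0 by (auto simp: \<kappa>_def)
    qed
    have sH: "real (2 * s) + H \<le> real n"
    proof -
      have "(1 / 11250)\<^sup>2 \<le> (1::real)" by (simp add: power2_eq_square)
      hence "(real (2 * s) + H) / real n \<le> 1" using e_small unfolding e_sq by linarith
      thus ?thesis using n0 by simp
    qed
    have SF: "\<Sigma> \<in> F_sparse p s" and psdS: "psd p \<Sigma>" and SM: "s_max \<Sigma> \<le> M"
      using \<Sigma> by (auto simp: F_sparse_bounded_def F_bounded_def)
    have SC: "\<Sigma> \<in> carrier_mat p p" using psdS by (simp add: psd_def)
    obtain a :: "nat \<Rightarrow> nat \<Rightarrow> real" where a: "\<forall>i<p. \<forall>j<p. \<Sigma> $$ (i, j) = (\<Sum>k<p. a i k * a j k)"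
      and mvn: "mvn p \<Sigma> = distr (\<Pi>\<^sub>M i\<in>{..<p}. SN) (Rp p) (\<lambda>z. \<lambda>i\<in>{..<p}. \<Sum>k<p. a i k * z k)"
      using mvn_linear_image[OF psdS] by blast
    define \<sigma> where "\<sigma> u = L2_set (\<lambda>k. \<Sum>i<p. u i * a i k) {..<p}" for u :: "nat \<Rightarrow> real"
    have \<sigma>0: "0 \<le> \<sigma> u" for u by (simp add: \<sigma>_def L2_set_nonneg)
    have \<sigma>_sq: "(\<sigma> u)\<^sup>2 = bil p (\<lambda>i j. \<Sigma> $$ (i, j)) u u" for u
    proof -
      have "(\<sigma> u)\<^sup>2 = (\<Sum>k<p. (\<Sum>i<p. u i * a i k)\<^sup>2)" by (simp add: \<sigma>_def L2_set_def sum_nonneg)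
      also have "\<dots> = (\<Sum>k<p. \<Sum>i<p. \<Sum>j<p. u i * (a i k * a j k) * u j)"
        by (simp add: power2_eq_square sum_product mult_ac)
      also have "\<dots> = (\<Sum>i<p. \<Sum>k<p. \<Sum>j<p. u i * (a i k * a j k) * u j)" by (rule sum.swap)
      also have "\<dots> = (\<Sum>i<p. \<Sum>j<p. \<Sum>k<p. u i * (a i k * a j k) * u j)" by (intro sum.cong refl sum.swap)
      also have "\<dots> = bil p (\<lambda>i j. \<Sigma> $$ (i, j)) u u"
        unfolding bil_def sum_distrib_left[symmetric] sum_distrib_right[symmetric] using a by (intro sum.cong refl) simp
      finally show ?thesis .
    qed
    have probN: "prob_space (mvn p \<Sigma>)" "sets (mvn p \<Sigma>) = sets (Rp p)"
      using prob_space_linear_image[of p a] unfolding mvn by auto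
    define P where "P = contaminated p \<epsilon> \<Sigma> Q"
    have eps1: "\<epsilon> \<le> 1" using eps by simp
    note law = contaminated_law[OF probN Q eps(1) eps1, folded P_def]
    have dom: "ennreal (1 - \<epsilon>) * emeasure (mvn p \<Sigma>) B \<le> emeasure P B" if "B \<in> sets P" for B
      using law(2)[of B] law(1) that by simp
    let ?PP = "\<Pi>\<^sub>M i\<in>{..<n}. P"
    have SL: "sample_law p n \<epsilon> \<Sigma> Q = ?PP" by (simp add: sample_law_def P_def)
    interpret P: prob_space P by (rule law(3))
    interpret prP: product_prob_space "\<lambda>_::nat. P" by unfold_locales
    interpret fp: finite_product_prob_space "\<lambda>_::nat. P" "{..<n}" by unfold_locales auto
    have spPP: "space ?PP = space (\<Pi>\<^sub>M i\<in>{..<n}. Rp p)"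
      by (intro sets_eq_imp_space_eq sets_PiM_cong) (auto simp: law(1))
    have s2: "0 < 2 * s" using s by simp
    obtain h :: "(nat \<Rightarrow> real) \<Rightarrow> real" where h01: "\<forall>x. 0 \<le> h x \<and> h x \<le> 1"
      and hker: "\<forall>x u S. S \<subseteq> {..<p} \<longrightarrow> card S = 2 * s \<longrightarrow> (\<forall>i<p. i \<notin> S \<longrightarrow> u i = 0) \<longrightarrow> h x \<noteq> 0 \<longrightarrow>
         \<sigma> u = 0 \<longrightarrow> (\<Sum>i<p. u i * x i) = 0"
      and htot: "\<exists>B\<in>sets ?PP. measure ?PP B \<le> 2 * exp (- H) \<and>
        (\<forall>X\<in>space ?PP - B. \<bar>(\<Sum>i<n. h (X i)) / real n - (1 - \<epsilon>)\<bar> \<le> \<kappa>)"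
      and hhit: "\<forall>t. \<exists>B\<in>sets ?PP. measure ?PP B \<le> real (p choose (2 * s)) * (5 * exp (- H)) \<and>
        (\<forall>X\<in>space ?PP - B. \<forall>u S. S \<subseteq> {..<p} \<longrightarrow> card S = 2 * s \<longrightarrow> (\<forall>i<p. i \<notin> S \<longrightarrow> u i = 0) \<longrightarrow>
          0 < \<sigma> u \<longrightarrow>
          \<bar>(\<Sum>i<n. h (X i) * of_bool (\<bar>\<Sum>j<p. u j * X i j\<bar> \<le> t * \<sigma> u)) / real n
             - (1 - \<epsilon>) * half_normal_cdf t\<bar> \<le> \<kappa>)"
      using sparse_hit_deviation[OF law(3) law(1) eps(1) eps1 dom[unfolded mvn] n0 budget(1) sH s2,
          folded e_def, folded \<kappa>_def, folded \<sigma>_def] by blast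
    define \<Delta> where "\<Delta> = 5 / 4 * (\<epsilon> + 5 * \<kappa>)"
    define \<eta> where "\<eta> = 2 * \<Delta> / \<phi>"
    define lo where "lo = max 0 (sqrt depth_beta - \<eta>)"
    define hi where "hi = min 4 (sqrt depth_beta + \<eta>)"
    obtain B0 where B0: "B0 \<in> sets ?PP" "measure ?PP B0 \<le> 2 * exp (- H)"
      "\<forall>X\<in>space ?PP - B0. \<bar>(\<Sum>i<n. h (X i)) / real n - (1 - \<epsilon>)\<bar> \<le> \<kappa>" using htot by blast
    obtain B where B: "\<forall>t. B t \<in> sets ?PP \<and> measure ?PP (B t) \<le> real (p choose (2 * s)) * (5 * exp (- H)) \<and>
        (\<forall>X\<in>space ?PP - B t. \<forall>u S. S \<subseteq> {..<p} \<longrightarrow> card S = 2 * s \<longrightarrow> (\<forall>i<p. i \<notin> S \<longrightarrow> u i = 0) \<longrightarrow>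
          0 < \<sigma> u \<longrightarrow>
          \<bar>(\<Sum>i<n. h (X i) * of_bool (\<bar>\<Sum>j<p. u j * X i j\<bar> \<le> t * \<sigma> u)) / real n
             - (1 - \<epsilon>) * half_normal_cdf t\<bar> \<le> \<kappa>)"
      using choice[OF hhit[unfolded Bex_def]] by blast
    \<comment> \<open>The thresholds depend on \<open>\<epsilon>\<close> and \<open>\<kappa>\<close> but not on the direction, so three of them suffice.\<close>
    define bad where "bad = B0 \<union> (B (sqrt depth_beta) \<union> (B lo \<union> B hi))"
    have bad_sets: "bad \<in> sets ?PP" using B0(1) B by (auto simp: bad_def)
    have "measure ?PP bad \<le> measure ?PP B0 + (measure ?PP (B (sqrt depth_beta)) + (measure ?PP (B lo) + measure ?PP (B hi)))"
      unfolding bad_def using B0(1) B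
      by (intro order.trans[OF measure_Un_le] add_mono order.refl) auto
    also have "\<dots> \<le> 2 * exp (- H) + (real (p choose (2 * s)) * (5 * exp (- H)) + (real (p choose (2 * s)) * (5 * exp (- H)) + real (p choose (2 * s)) * (5 * exp (- H))))"
      using B0(2) B by (intro add_mono) auto
    also have "\<dots> \<le> 2 * \<delta>" using budget(3) by linarith
    finally have bad_small: "measure ?PP bad \<le> 2 * \<delta>" .
    have good: "(op_norm p ((1 / depth_beta) \<cdot>\<^sub>m \<Gamma>_hat X - \<Sigma>))\<^sup>2 \<le> C * (max (L / real n) (\<epsilon>\<^sup>2) + l / real n)"
      if X: "X \<in> space ?PP - bad" for X
    proof -
      define \<Gamma> where "\<Gamma> = \<Gamma>_hat X"
      let ?U = "U_sparse p s"
      let ?d = "\<lambda>\<Gamma>. matrix_depth p n ?U \<Gamma> X"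
      have am: "\<Gamma> \<in> F_sparse p s" "\<And>\<Gamma>'. \<Gamma>' \<in> F_sparse p s \<Longrightarrow> ?d \<Gamma>' \<le> ?d \<Gamma>"
        using argmax X spPP unfolding is_arg_max_def \<Gamma>_def by (auto simp: not_less)
      have psdG: "psd p \<Gamma>" by (rule F_sparse_support(1)[OF am(1)])
      have GC: "\<Gamma> \<in> carrier_mat p p" using psdG by (simp add: psd_def)
      have dot: "u \<bullet> vec p x = (\<Sum>j<p. u $ j * x j)" if "u \<in> carrier_vec p" for u x
        by (simp add: scalar_prod_def lessThan_atLeast0)
      have tot: "\<bar>(\<Sum>i<n. h (X i)) / real n - (1 - \<epsilon>)\<bar> \<le> \<kappa>" using B0(3) X by (simp add: bad_def)
      have hit: "\<bar>(\<Sum>i<n. h (X i) * of_bool (\<bar>u \<bullet> vec p (X i)\<bar> \<le> t * \<sigma> (\<lambda>i. u $ i))) / real n - (1 - \<epsilon>) * half_normal_cdf t\<bar> \<le> \<kappa>"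
        if u: "u \<in> ?U" and t: "t \<in> {sqrt depth_beta, lo, hi}" and pos: "0 < \<sigma> (\<lambda>i. u $ i)" for u t
      proof -
        obtain S where S: "S \<subseteq> {..<p}" "card S = 2 * s" "\<forall>i<p. i \<notin> S \<longrightarrow> u $ i = 0" using U_sparseD(3)[OF u] by blast
        have "X \<in> space ?PP - B t" using X t by (auto simp: bad_def)
        thus ?thesis unfolding dot[OF U_sparseD(1)[OF u]] using B S pos by blast
      qed
      have ker: "u \<bullet> vec p (X i) = 0" if u: "u \<in> ?U" and "\<sigma> (\<lambda>i. u $ i) = 0" "h (X i) \<noteq> 0" for u i
      proof -
        obtain S where S: "S \<subseteq> {..<p}" "card S = 2 * s" "\<forall>i<p. i \<notin> S \<longrightarrow> u $ i = 0" using U_sparseD(3)[OF u] by blast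
        thus ?thesis unfolding dot[OF U_sparseD(1)[OF u]] using hker that by blast
      qed
      have qS: "u \<bullet> ((depth_beta \<cdot>\<^sub>m \<Sigma>) *\<^sub>v u) = depth_beta * (\<sigma> (\<lambda>i. u $ i))\<^sup>2" if "u \<in> ?U" for u
        using U_sparseD(1)[OF that] SC
        by (subst quadratic_form_bil) (auto simp: \<sigma>_sq bil_def sum_distrib_left mult_ac intro!: sum.cong)
      have "(1 - \<epsilon>) / 2 - 2 * \<kappa> \<le> ?d (depth_beta \<cdot>\<^sub>m \<Sigma>)"
        unfolding matrix_depth_def
      proof (rule cINF_greatest[OF U_sparse_nonempty[OF s]])
        fix u assume u: "u \<in> ?U"
        show "(1 - \<epsilon>) / 2 - 2 * \<kappa> \<le> min ((\<Sum>i<n. of_bool (\<bar>u \<bullet> vec p (X i)\<bar>\<^sup>2 \<le> u \<bullet> ((depth_beta \<cdot>\<^sub>m \<Sigma>) *\<^sub>v u))) / real n)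
         ((\<Sum>i<n. of_bool (\<bar>u \<bullet> vec p (X i)\<bar>\<^sup>2 \<ge> u \<bullet> ((depth_beta \<cdot>\<^sub>m \<Sigma>) *\<^sub>v u))) / real n)"
          unfolding qS[OF u]
          by (intro min.boundedI depth_of_scaled_truth[where w = "\<lambda>i. h (X i)"] n0 \<sigma>0 eps tot hit[OF u] ker[OF u])
             (use h01 in auto)
      qed
      also have "\<dots> \<le> ?d \<Gamma>" using F_sparse_scale[OF SF, of depth_beta] depth_beta_pos by (intro am(2)) simp
      finally have deep: "(1 - \<epsilon>) / 2 - 2 * \<kappa> \<le> ?d \<Gamma>" .
      define D where "D = (1 / depth_beta) \<cdot>\<^sub>m \<Gamma> - \<Sigma>"
      have DC: "D \<in> carrier_mat p p" unfolding D_def using SC by (rule minus_carrier_mat)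
      have Dij: "D $$ (i, j) = \<Gamma> $$ (i, j) / depth_beta - \<Sigma> $$ (i, j)" if "i < p" "j < p" for i j
        using that GC SC by (simp add: D_def)
      have quad: "\<bar>bil p (\<lambda>i j. D $$ (i, j)) (\<lambda>i. u $ i) (\<lambda>i. u $ i)\<bar> \<le> K1 * \<Delta>" if u: "u \<in> ?U" for u
      proof -
        let ?u = "\<lambda>i. u $ i"
        define \<gamma> where "\<gamma> = bil p (\<lambda>i j. \<Gamma> $$ (i, j)) ?u ?u"
        have \<gamma>eq: "u \<bullet> (\<Gamma> *\<^sub>v u) = \<gamma>" unfolding \<gamma>_def using U_sparseD(1)[OF u] GC by (intro quadratic_form_bil)
        have "\<bar>\<gamma> - depth_beta * (\<sigma> ?u)\<^sup>2\<bar> \<le> 8 * \<eta> * (\<sigma> ?u)\<^sup>2"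
          unfolding \<eta>_def \<Delta>_def \<phi>_def
        proof (rule deep_direction_bound[where w = "\<lambda>i. h (X i)" and t = "\<lambda>i. u \<bullet> vec p (X i)" and n = n])
          show "0 \<le> \<gamma>" unfolding \<gamma>_def by (rule psd_bil(1)[OF psdG])
          show "0 \<le> h (X i) \<and> h (X i) \<le> 1" for i using h01 by blast
          show "(1 - \<epsilon>) / 2 - 2 * \<kappa> \<le> (\<Sum>i<n. of_bool (\<bar>u \<bullet> vec p (X i)\<bar>\<^sup>2 \<le> \<gamma>)) / real n"
            using deep matrix_depth_le(1)[OF u, where p = p and n = n and \<Gamma> = \<Gamma> and X = X] unfolding \<gamma>eq by (rule order.trans)
          show "(1 - \<epsilon>) / 2 - 2 * \<kappa> \<le> (\<Sum>i<n. of_bool (\<bar>u \<bullet> vec p (X i)\<bar>\<^sup>2 \<ge> \<gamma>)) / real n"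
            using deep matrix_depth_le(2)[OF u, where p = p and n = n and \<Gamma> = \<Gamma> and X = X] unfolding \<gamma>eq by (rule order.trans)
          fix t assume "t \<in> {max 0 (sqrt depth_beta - 2 * (5 / 4 * (\<epsilon> + 5 * \<kappa>)) / std_normal_density 4),
             min 4 (sqrt depth_beta + 2 * (5 / 4 * (\<epsilon> + 5 * \<kappa>)) / std_normal_density 4)}" and "0 < \<sigma> ?u"
          thus "\<bar>(\<Sum>i<n. h (X i) * of_bool (\<bar>u \<bullet> vec p (X i)\<bar> \<le> t * \<sigma> ?u)) / real n - (1 - \<epsilon>) * half_normal_cdf t\<bar> \<le> \<kappa>"
            by (intro hit[OF u]) (auto simp: lo_def hi_def \<eta>_def \<Delta>_def \<phi>_def)
        qed (use n0 \<sigma>0 eps kap tot ker[OF u] in auto)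
        also have "\<dots> \<le> 8 * \<eta> * M"
        proof (rule mult_left_mono)
          have "(\<sigma> ?u)\<^sup>2 \<le> s_max \<Sigma> * sq_norm p ?u" unfolding \<sigma>_sq by (rule quadratic_form_le_s_max[OF SC p0])
          thus "(\<sigma> ?u)\<^sup>2 \<le> M" using SM U_sparseD(2)[OF u] by simp
          show "0 \<le> 8 * \<eta>" using eps kap phi by (simp add: \<eta>_def \<Delta>_def)
        qed
        finally have "\<bar>\<gamma> - depth_beta * (\<sigma> ?u)\<^sup>2\<bar> / depth_beta \<le> 8 * \<eta> * M / depth_beta"
          using depth_beta_pos by (intro divide_right_mono) auto
        also have "8 * \<eta> * M / depth_beta = K1 * \<Delta>" by (simp add: K1_def \<eta>_def)
        finally have *: "\<bar>\<gamma> - depth_beta * (\<sigma> ?u)\<^sup>2\<bar> / depth_beta \<le> K1 * \<Delta>" .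
        have "bil p (\<lambda>i j. D $$ (i, j)) ?u ?u = \<gamma> / depth_beta - (\<sigma> ?u)\<^sup>2"
          unfolding \<sigma>_sq \<gamma>_def bil_def sum_divide_distrib sum_subtractf[symmetric]
          by (intro sum.cong refl) (simp add: Dij left_diff_distrib right_diff_distrib)
        also have "\<dots> = (\<gamma> - depth_beta * (\<sigma> ?u)\<^sup>2) / depth_beta" using depth_beta_pos by (simp add: diff_divide_distrib)
        finally show ?thesis using * depth_beta_pos by (simp add: abs_divide)
      qed
      obtain T1 where T1: "T1 \<subseteq> {..<p}" "card T1 \<le> s" "\<forall>i<p. \<forall>j<p. i \<noteq> j \<longrightarrow> i \<notin> T1 \<or> j \<notin> T1 \<longrightarrow> \<Gamma> $$ (i, j) = 0"
        using F_sparse_support(2)[OF am(1)] by blast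
      obtain T2 where T2: "T2 \<subseteq> {..<p}" "card T2 \<le> s" "\<forall>i<p. \<forall>j<p. i \<noteq> j \<longrightarrow> i \<notin> T2 \<or> j \<notin> T2 \<longrightarrow> \<Sigma> $$ (i, j) = 0"
        using F_sparse_support(2)[OF SF] by blast
      have quad_all: "\<bar>bil p (\<lambda>i j. D $$ (i, j)) v v\<bar> \<le> K1 * \<Delta> * sq_norm p v" for v
      proof (rule sparse_quadratic_form[of "T1 \<union> T2" p s D "K1 * \<Delta>" v])
        show "T1 \<union> T2 \<subseteq> {..<p}" using T1 T2 by blast
        show "card (T1 \<union> T2) \<le> 2 * s" using card_Un_le[of T1 T2] T1(2) T2(2) by linarith
        show "1 \<le> s" "2 * s \<le> p" "D \<in> carrier_mat p p" using s DC by auto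
        show "D $$ (i, j) = 0" if "i < p" "j < p" "i \<noteq> j" "i \<notin> T1 \<union> T2 \<or> j \<notin> T1 \<union> T2" for i j
        proof -
          have "\<Gamma> $$ (i, j) = 0" using T1(3) that by blast
          moreover have "\<Sigma> $$ (i, j) = 0" using T2(3) that by blast
          ultimately show ?thesis using that(1,2) by (simp add: Dij)
        qed
      qed (rule quad)
      have Dsym: "D $$ (i, j) = D $$ (j, i)" if "i < p" "j < p" for i j
        using that psd_bil(2)[OF psdG that] psd_bil(2)[OF psdS that] by (simp add: Dij)
      note op = op_norm_le_quadratic_form[OF DC Dsym p0 quad_all]
      have "(op_norm p D)\<^sup>2 \<le> (K1 * \<Delta>)\<^sup>2" using op by (intro power_mono)
      also have "\<dots> = K1\<^sup>2 * \<Delta>\<^sup>2" by (rule power_mult_distrib)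
      also have "\<dots> \<le> K1\<^sup>2 * (40000000 * (max (L / real n) (\<epsilon>\<^sup>2) + l / real n))"
        unfolding \<Delta>_def \<kappa>_def using e_le budget(4,5) e0
        by (intro mult_left_mono deviation_squared_bound) auto
      also have "\<dots> = C * (max (L / real n) (\<epsilon>\<^sup>2) + l / real n)"
        unfolding C_def by (simp only: mult.assoc mult.left_commute)
      finally show ?thesis unfolding D_def \<Gamma>_def .
    qed
    show ?thesis
      unfolding prob_at_least_def SL L_def[symmetric] l_def[symmetric]
    proof (intro bexI[of _ "space ?PP - bad"] conjI)
      show "space ?PP - bad \<subseteq> {X \<in> space ?PP. (op_norm p ((1 / depth_beta) \<cdot>\<^sub>m \<Gamma>_hat X - \<Sigma>))\<^sup>2
          \<le> C * (max (L / real n) (\<epsilon>\<^sup>2) + l / real n)}" using good by blast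
      show "1 - 2 * \<delta> \<le> measure ?PP (space ?PP - bad)" using fp.prob_compl[OF bad_sets] bad_small by simp
      show "space ?PP - bad \<in> sets ?PP" using bad_sets by auto
    qed
  qed
  have "0 < C" "0 < C1" using K1 by (auto simp: C_def C1_def)
  thus ?thesis using main by (intro exI[of _ C] conjI exI[of _ C1] allI impI) assumption+
qed

end
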